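(* Assume that $2\le p<N$, $1<s\le p$, $q\in(p,p^* )$ with $p^*=\frac{Np}{N-p}$, $\beta:=\max\{2,N/p\}$, $V\in L^\beta_{loc}(\mathbb{R}^N)$, $V\ge0$, and that $f:\mathbb{R}\to\mathbb{R}$ is continuous, odd and satisfies, for some constant $c>0$, $$-ct^{s-1}\le f(t)\le ct^{q-1}\qquad\forall\,t>0.$$ Let $u\in X:=W^{1,p}(\mathbb{R}^N)\cap L^s(\mathbb{R}^N)$ be a local weak solution to $$-\Delta_pu+V(x)|u|^{p-2}u=f(u)\qquad\text{in }\mathbb{R}^N$$ such that the function $x\mapsto V(x)|x||u(x)|^{p-1}|\nabla u(x)|$ belongs to $L^1(\mathbb{R}^N)$. Then $u$ satisfies the Pohozaev identity $$\frac{N-p}{p}\int_{\mathbb{R}^N}|\nabla u|^p\,dx-N\int_{\mathbb{R}^N}F(u)\,dx-\int_{\mathbb{R}^N}V(x)|u|^{p-2}u\,(x\cdot\nabla u)\,dx=0,$$ where $F(u):=\int_0^uf(t)\,dt$.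
   Context: $\Delta_pu=\operatorname{div}(|\nabla u|^{p-2}\nabla u)$. A function $u\in W^{1,p}_{loc}(\mathbb{R}^N)$ is a local weak solution to $-\Delta_pu+V(x)|u|^{p-2}u=f(u)$ in $\mathbb{R}^N$ if $$\int_{\mathbb{R}^N}|\nabla u|^{p-2}\nabla u\cdot\nabla v\,dx+\int_{\mathbb{R}^N}V(x)|u|^{p-2}uv\,dx=\int_{\mathbb{R}^N}f(u)v\,dx\qquad\forall\,v\in C_c^\infty(\mathbb{R}^N).$$ Here $N$ is an integer (the dimension), and $N\ge3$ follows from $2\le p<N$. *)

theory Defs
  imports "HOL-Analysis.Analysis"
begin

text \<open>
  Functions on \<open>\<real>\<^sup>N\<close> are represented by pointwise-defined, Lebesgue measurable representatives.
\<close>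

definition Lp :: "real \<Rightarrow> ('a::euclidean_space \<Rightarrow> 'b::euclidean_space) set" where
  "Lp r = {g. g \<in> borel_measurable lebesgue \<and> integrable lebesgue (\<lambda>x. norm (g x) powr r)}"

definition Lp_loc :: "real \<Rightarrow> ('a::euclidean_space \<Rightarrow> 'b::euclidean_space) set" where
  "Lp_loc r = {g. g \<in> borel_measurable lebesgue \<and>
     (\<forall>K. compact K \<longrightarrow> set_integrable lebesgue K (\<lambda>x. norm (g x) powr r))}"

abbreviation partial_deriv :: "'a \<Rightarrow> ('a::euclidean_space \<Rightarrow> real) \<Rightarrow> 'a \<Rightarrow> real" where
  "partial_deriv b v x \<equiv> frechet_derivative v (at x) b"

primrec Ck :: "nat \<Rightarrow> ('a::euclidean_space \<Rightarrow> real) \<Rightarrow> bool" where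
  "Ck 0 v \<longleftrightarrow> continuous_on UNIV v"
| "Ck (Suc k) v \<longleftrightarrow>
     (\<forall>x. v differentiable (at x)) \<and> (\<forall>b\<in>Basis. Ck k (partial_deriv b v))"

definition test_functions :: "('a::euclidean_space \<Rightarrow> real) set" where
  "test_functions = {v. (\<forall>k. Ck k v) \<and> compact (closure {x. v x \<noteq> 0})}"

definition grad :: "('a::euclidean_space \<Rightarrow> real) \<Rightarrow> 'a \<Rightarrow> 'a" where
  "grad v x = (\<Sum>b\<in>Basis. partial_deriv b v x *\<^sub>R b)"

definition has_weak_gradient :: "('a::euclidean_space \<Rightarrow> real) \<Rightarrow> ('a \<Rightarrow> 'a) \<Rightarrow> bool" where
  "has_weak_gradient u g \<longleftrightarrow> u \<in> Lp_loc 1 \<and> g \<in> Lp_loc 1 \<and>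
     (\<forall>v\<in>test_functions. \<forall>b\<in>Basis.
        (\<integral>x. u x * partial_deriv b v x \<partial>lebesgue) = - (\<integral>x. (g x \<bullet> b) * v x \<partial>lebesgue))"

text \<open>
  A weak gradient is unique up to a null set; \<open>weak_grad u\<close> selects one representative
  (an arbitrary function if \<open>u\<close> has no weak gradient).
\<close>

definition weak_grad :: "('a::euclidean_space \<Rightarrow> real) \<Rightarrow> 'a \<Rightarrow> 'a" where
  "weak_grad u = (SOME g. has_weak_gradient u g)"

definition W1p :: "real \<Rightarrow> ('a::euclidean_space \<Rightarrow> real) set" where
  "W1p p = {u. u \<in> Lp p \<and> (\<exists>g. has_weak_gradient u g \<and> g \<in> Lp p)}"

definition W1p_loc :: "real \<Rightarrow> ('a::euclidean_space \<Rightarrow> real) set" where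
  "W1p_loc p = {u. u \<in> Lp_loc p \<and> (\<exists>g. has_weak_gradient u g \<and> g \<in> Lp_loc p)}"

text \<open>
  Local weak solutions of \<open>- \<Delta>\<^sub>p u + V(x) |u|\<^bsup>p-2\<^esup> u = f(u)\<close>. The Bochner integral of a
  non-integrable function is 0, so the existence of the three integrals is required explicitly.
  As \<open>0 powr a = 0\<close>, the terms \<open>|u|\<^bsup>p-2\<^esup> u\<close> and \<open>|\<nabla>u|\<^bsup>p-2\<^esup> \<nabla>u\<close> vanish where \<open>u\<close>,
  respectively \<open>\<nabla>u\<close>, does, also for \<open>p = 2\<close>.
\<close>

definition local_weak_solution ::
  "real \<Rightarrow> ('a::euclidean_space \<Rightarrow> real) \<Rightarrow> (real \<Rightarrow> real) \<Rightarrow> ('a \<Rightarrow> real) \<Rightarrow> bool" where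
  "local_weak_solution p V f u \<longleftrightarrow> u \<in> W1p_loc p \<and>
     (\<forall>v\<in>test_functions.
        integrable lebesgue
          (\<lambda>x. (norm (weak_grad u x) powr (p - 2) *\<^sub>R weak_grad u x) \<bullet> grad v x) \<and>
        integrable lebesgue (\<lambda>x. V x * \<bar>u x\<bar> powr (p - 2) * u x * v x) \<and>
        integrable lebesgue (\<lambda>x. f (u x) * v x) \<and>
        (\<integral>x. (norm (weak_grad u x) powr (p - 2) *\<^sub>R weak_grad u x) \<bullet> grad v x \<partial>lebesgue)
          + (\<integral>x. V x * \<bar>u x\<bar> powr (p - 2) * u x * v x \<partial>lebesgue)
        = (\<integral>x. f (u x) * v x \<partial>lebesgue))"

text \<open>\<open>F(t) = \<integral>\<^sub>0\<^sup>t f\<close>; the interval integral is signed, so this also covers \<open>t < 0\<close>.\<close>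

definition primitive :: "(real \<Rightarrow> real) \<Rightarrow> real \<Rightarrow> real" where
  "primitive f t = (LBINT y=ereal 0..ereal t. f y)"

end

theory Submission
  imports Defs
begin

text \<open>
  The identity is obtained by differentiating along the dilations \<open>u\<^sub>\<lambda>(x) = u(\<lambda> x)\<close>, without any regularity
  theory for \<open>\<nabla>u\<close>. Testing the equation with \<open>\<phi> (u\<^sub>\<lambda> - u)\<close>, \<open>\<phi> \<ge> 0\<close> a cut-off function, convexity of \<open>|\<cdot>|\<^sup>p\<close> gives
  \<open>\<integral> \<phi> |\<nabla>u|\<^bsup>p-2\<^esup> \<nabla>u \<bullet> \<nabla>(u\<^sub>\<lambda> - u) \<le> (1/p) \<integral> \<phi> (|\<nabla>u\<^sub>\<lambda>|\<^sup>p - |\<nabla>u|\<^sup>p)\<close>, and by scaling the right-hand side is a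
  differentiable function of \<open>\<lambda>\<close>. Dividing by \<open>\<lambda> - 1\<close> and letting \<open>\<lambda> \<rightarrow> 1\<close> from both sides turns the inequality
  into an identity, and expanding \<open>\<phi>\<close> to \<open>1\<close> yields the claim.

  The lower order terms converge because \<open>u\<close> is bounded: \<open>V |u|\<^bsup>p-2\<^esup> u\<close> is then locally in \<open>L\<^sup>2\<close>, while the quotients
  \<open>(u\<^sub>\<lambda> - u) / (\<lambda> - 1)\<close> converge in \<open>L\<^sup>p\<close> locally. Boundedness follows from De Giorgi's method, where a weak-type
  estimate for the level sets \<open>{u > k}\<close>, derived from \<open>\<parallel>u(\<cdot> + h) - u\<parallel>\<^sub>p \<le> C |h| \<parallel>\<nabla>u\<parallel>\<^sub>p\<close>, plays the role of the Sobolev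
  inequality.
\<close>

section \<open>Smooth functions and test functions\<close>

text \<open>A direct proof would test with a cut-off times \<open>x \<bullet> grad u\<close>, whose
  gradient contains second derivatives of \<open>u\<close>. The gradient of the difference quotient
  in \<open>\<lambda>\<close> need not converge either; the convexity inequality is what avoids that
  limit. The limits actually taken are those of \<open>(u_\<lambda> - u) / (\<lambda> - 1)\<close>
  in \<open>L^p\<close> on balls, and of integrals in which the dilation has been moved onto a
  smooth factor.

  Boundedness rests on one estimate for \<open>|{u > k}|\<close>, used in three stages. A decay like
  \<open>k^(-r)\<close> improves to exponent \<open>p + p r / N\<close>, a map with fixed point
  \<open>N p / (N - p)\<close>. Once \<open>p r / N > q - p\<close>, possible because
  \<open>q\<close> lies below that fixed point, the growth of \<open>f\<close> gives a fixed gain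
  per round, hence decay of every order. Then the estimate is superlinear in
  \<open>|{u > k}|\<close> and forces this measure to vanish at a finite level. Oddness of
  \<open>f\<close> transfers the bound to \<open>- u\<close>.

  Membership in \<open>L^s\<close> makes \<open>F(u)\<close> integrable: near 0 the primitive is
  controlled by \<open>|t|^s\<close>.\<close>

definition flat :: "nat \<Rightarrow> real \<Rightarrow> real" where
  "flat m t = (if t \<le> 0 then 0 else exp (- 1 / t) / t ^ m)"

lemma flat_nonpos [simp]: "t \<le> 0 \<Longrightarrow> flat m t = 0"
  by (simp add: flat_def)

lemma flat_nonneg [simp]: "0 \<le> flat m t"
  by (simp add: flat_def)

lemma flat_tendsto_0: "(flat m \<longlongrightarrow> 0) (at 0)"
proof -
  have "((\<lambda>x. x ^ m / exp x) \<longlongrightarrow> (0::real)) at_top"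
    by (rule tendsto_power_div_exp_0)
  then have "((\<lambda>x. (inverse x) ^ m / exp (inverse x)) \<longlongrightarrow> (0::real)) (at_right 0)"
    unfolding filterlim_at_right_to_top by simp
  then have 1: "(flat m \<longlongrightarrow> 0) (at_right 0)"
    by (rule filterlim_cong[THEN iffD1, rotated 3])
       (auto simp: flat_def eventually_at_filter exp_minus field_simps)
  have 2: "(flat m \<longlongrightarrow> 0) (at_left 0)"
    by (rule Lim_transform_eventually[OF tendsto_const])
       (auto simp: eventually_at_filter)
  show ?thesis using 1 2 by (simp add: filterlim_at_split)
qed

text \<open>The index \<open>m\<close> exists for the sake of this formula: differentiating
  \<open>exp (- 1 / t) / t ^ m\<close> stays within the family, so compositions with
  \<open>flat\<close> need no bookkeeping of higher derivatives. At \<open>t = 0\<close> the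
  difference quotient is \<open>flat (m + 1)\<close>, which tends to 0.\<close>

lemma flat_has_derivative:
  "(flat m has_real_derivative (flat (m + 2) t - real m * flat (m + 1) t)) (at t)"
proof -
  consider "t < 0" | "t = 0" | "t > 0" by linarith
  then show ?thesis
  proof cases
    case 1
    have "((\<lambda>t. 0) has_real_derivative 0) (at t)" by simp
    moreover have "eventually (\<lambda>x. x < 0) (nhds t)"
      using 1 eventually_nhds_in_open[of "{..<0}" t] by auto
    then have "eventually (\<lambda>x. 0 = flat m x) (nhds t)"
      by eventually_elim auto
    ultimately show ?thesis using 1 by (simp add: DERIV_cong_ev)
  next
    case 2
    have "((\<lambda>h. flat (Suc m) h) \<longlongrightarrow> 0) (at 0)" by (rule flat_tendsto_0)
    then have "((\<lambda>h. (flat m (0 + h) - flat m 0) / h) \<longlongrightarrow> 0) (at 0)"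
      by (rule Lim_transform_eventually) (auto simp: flat_def eventually_at_filter)
    then show ?thesis using 2 by (simp add: DERIV_def)
  next
    case 3
    have "((\<lambda>t. exp (- 1 / t) / t ^ m) has_real_derivative
        (flat (m + 2) t - real m * flat (m + 1) t)) (at t)"
    proof -
      have "((\<lambda>t. exp (- 1 / t)) has_real_derivative exp (- 1 / t) / t\<^sup>2) (at t)"
        using 3 by (auto intro!: derivative_eq_intros simp: power2_eq_square)
      from DERIV_divide[OF this DERIV_pow[of m t]] 3
      have "((\<lambda>t. exp (- 1 / t) / t ^ m) has_real_derivative
        (exp (- 1 / t) / t\<^sup>2 * t ^ m - exp (- 1 / t) * (real m * t ^ (m - Suc 0))) / (t ^ m * t ^ m)) (at t)"
        by simp
      moreover have "(exp (- 1 / t) / t\<^sup>2 * t ^ m - exp (- 1 / t) * (real m * t ^ (m - Suc 0))) / (t ^ m * t ^ m)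
        = flat (m + 2) t - real m * flat (m + 1) t"
        using 3 by (cases m) (auto simp: flat_def field_simps power2_eq_square)
      ultimately show ?thesis by simp
    qed
    moreover have "eventually (\<lambda>x. x > 0) (nhds t)"
      using 3 eventually_nhds_in_open[of "{0<..}" t] by auto
    then have "eventually (\<lambda>x. exp (- 1 / x) / x ^ m = flat m x) (nhds t)"
      by eventually_elim (auto simp: flat_def)
    ultimately show ?thesis by (simp add: DERIV_cong_ev)
  qed
qed

lemma flat_continuous: "continuous_on A (flat m)"
  by (meson DERIV_isCont continuous_at_imp_continuous_on flat_has_derivative)

lemma flat_0_le_1: "flat 0 t \<le> 1"
  by (simp add: flat_def)

text \<open>\<open>flat 2\<close> is the derivative of \<open>flat 0\<close>, so truncations built
  from \<open>flat 0\<close> get slope at most 1. With \<open>s = 1 / t\<close> the claim is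
  \<open>s^2 \<le> exp s\<close>, which follows from \<open>exp (s / 4) \<ge> 1 + s / 4\<close> and
  \<open>(1 + s / 4)^2 \<ge> s\<close>.\<close>

lemma flat_2_le_1: "flat 2 t \<le> 1"
proof (cases "t \<le> 0")
  case False
  define s where "s = 1 / t"
  have s: "s > 0" using False by (simp add: s_def)
  have "1 + s / 2 \<le> exp (s / 2)" by (rule exp_ge_add_one_self)
  then have "(1 + s / 2)\<^sup>2 \<le> exp (s / 2) ^ 2" using s by (intro power_mono) auto
  also have "\<dots> = exp s" by (simp add: power2_eq_square flip: exp_add)
  finally have a: "1 + s + s\<^sup>2 / 4 \<le> exp s" by (simp add: power2_eq_square field_simps)
  have "1 + s/4 \<le> exp (s / 4)" by (rule exp_ge_add_one_self)
  then have "(1 + s / 4)^4 \<le> exp (s / 4) ^ 4" using s by (intro power_mono) auto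
  also have "\<dots> = exp s" by (simp flip: exp_of_nat_mult)
  finally have b: "(1 + s / 4)^4 \<le> exp s" .
  have "(1 + s/4)^2 \<ge> s"
    using zero_le_power2[of "1 - s/4"] by (simp add: power2_eq_square field_simps)
  then have "((1 + s/4)^2)^2 \<ge> s^2" using s by (intro power_mono) auto
  then have "s\<^sup>2 \<le> exp s" using b by (simp flip: power_mult)
  then show ?thesis using False s
    by (simp add: flat_def s_def field_simps exp_minus)
qed simp

section \<open>Smooth functions and their closure properties\<close>

definition smooth :: "('a::euclidean_space \<Rightarrow> real) \<Rightarrow> bool" where
  "smooth v \<longleftrightarrow> (\<forall>k. Ck k v)"

text \<open>The induction on \<open>k\<close> must treat the whole class \<open>C\<close> at once,
  since \<open>Ck (Suc k) v\<close> asks for \<open>Ck k\<close> of the partial derivatives, which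
  are other members of \<open>C\<close>.\<close>

lemma smooth_coinduct:
  assumes "v \<in> C"
    and C: "\<And>v x. v \<in> C \<Longrightarrow> v differentiable (at x)"
           "\<And>v b. v \<in> C \<Longrightarrow> b \<in> Basis \<Longrightarrow> (\<lambda>x. partial_deriv b v x) \<in> C"
  shows "smooth v"
proof -
  have "\<forall>v\<in>C. Ck k v" for k
  proof (induction k)
    case 0
    then show ?case using C(1)
      by (auto intro!: continuous_at_imp_continuous_on differentiable_imp_continuous_within)
  next
    case (Suc k)
    then show ?case using C by auto
  qed
  then show ?thesis using assms(1) by (auto simp: smooth_def)
qed

lemma smooth_differentiable: "smooth v \<Longrightarrow> v differentiable (at x)"
  unfolding smooth_def by (metis Ck.simps(2))

lemma smooth_continuous: "smooth v \<Longrightarrow> continuous_on A v"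
  using Ck.simps(1) continuous_on_subset unfolding smooth_def by blast

lemma smooth_partial: "smooth v \<Longrightarrow> b \<in> Basis \<Longrightarrow> smooth (\<lambda>x. partial_deriv b v x)"
  unfolding smooth_def by (metis Ck.simps(2))

lemma has_derivative_grad:
  assumes "v differentiable (at x)"
  shows "(v has_derivative (\<lambda>h. grad v x \<bullet> h)) (at x)"
proof -
  define D where "D = frechet_derivative v (at x)"
  have D: "(v has_derivative D) (at x)"
    using assms D_def frechet_derivative_works by blast
  then interpret linear D by (rule has_derivative_linear)
  have "D h = grad v x \<bullet> h" for h
  proof -
    have "D h = D (\<Sum>b\<in>Basis. (h \<bullet> b) *\<^sub>R b)" by (simp add: euclidean_representation)
    also have "\<dots> = (\<Sum>b\<in>Basis. (h \<bullet> b) * D b)" by (simp add: sum scale)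
    finally show ?thesis
      by (simp add: grad_def D_def inner_sum_left inner_sum_right inner_commute[of _ h] mult.commute)
  qed
  then show ?thesis using D by presburger
qed

lemma grad_eqI:
  assumes "(v has_derivative (\<lambda>h. G \<bullet> h)) (at x)"
  shows "grad v x = G" "b \<in> Basis \<Longrightarrow> partial_deriv b v x = G \<bullet> b"
proof -
  have *: "frechet_derivative v (at x) = (\<lambda>h. G \<bullet> h)"
    using frechet_derivative_at[OF assms] by simp
  then show "grad v x = G" by (simp add: grad_def euclidean_representation)
  show "b \<in> Basis \<Longrightarrow> partial_deriv b v x = G \<bullet> b" using * by simp
qed

lemma partial_deriv_eqI:
  "(v has_derivative D) (at x) \<Longrightarrow> partial_deriv b v x = D b"
  by (simp add: frechet_derivative_at[symmetric])

lemma grad_inner_Basis: "b \<in> Basis \<Longrightarrow> grad v x \<bullet> b = partial_deriv b v x"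
  by (simp add: grad_def)

lemma smooth_grad_continuous: "smooth v \<Longrightarrow> continuous_on A (grad v)"
  unfolding grad_def by (intro continuous_intros smooth_continuous smooth_partial) auto

lemma smooth_has_derivative: "smooth v \<Longrightarrow> (v has_derivative (\<lambda>h. grad v x \<bullet> h)) (at x)"
  by (rule has_derivative_grad[OF smooth_differentiable])

text \<open>A set of functions closed under partial differentiation. The rule \<open>base\<close>
  admits arbitrary smooth functions, so that once all members are known to be smooth, every other
  rule reads as a closure property of \<open>smooth\<close>.\<close>

inductive_set smooth_gen :: "('a::euclidean_space \<Rightarrow> real) set" where
  base: "smooth v \<Longrightarrow> v \<in> smooth_gen"
| const: "(\<lambda>x. c) \<in> smooth_gen"
| coord: "(\<lambda>x. x \<bullet> b) \<in> smooth_gen"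
| square: "(\<lambda>x. x \<bullet> x) \<in> smooth_gen"
| add: "v \<in> smooth_gen \<Longrightarrow> w \<in> smooth_gen \<Longrightarrow> (\<lambda>x. v x + w x) \<in> smooth_gen"
| mult: "v \<in> smooth_gen \<Longrightarrow> w \<in> smooth_gen \<Longrightarrow> (\<lambda>x. v x * w x) \<in> smooth_gen"
| flat: "v \<in> smooth_gen \<Longrightarrow> (\<lambda>x. flat m (v x)) \<in> smooth_gen"
| affine: "v \<in> smooth_gen \<Longrightarrow> (\<lambda>x. v (c *\<^sub>R x + a)) \<in> smooth_gen"

text \<open>Sum, product and chain rule lead back into the set, which is the closure that
  \<open>smooth_coinduct\<close> asks for.\<close>

lemma smooth_gen_derivative:
  assumes "v \<in> smooth_gen"
  shows "\<exists>D. (\<forall>x. (v has_derivative D x) (at x)) \<and> (\<forall>b\<in>Basis. (\<lambda>x. D x b) \<in> smooth_gen)"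
  using assms
proof induction
  case (base v)
  then show ?case
    by (intro exI[of _ "\<lambda>x. (\<bullet>) (grad v x)"] conjI)
       (auto simp: grad_inner_Basis intro!: smooth_has_derivative smooth_gen.base smooth_partial)
next
  case (const c)
  show ?case
    by (intro exI[of _ "\<lambda>x h. 0"]) (auto intro: smooth_gen.const)
next
  case (coord b)
  show ?case
    by (intro exI[of _ "\<lambda>x h. h \<bullet> b"]) (auto intro: smooth_gen.const intro!: derivative_eq_intros)
next
  case square
  show ?case
  proof (intro exI[of _ "\<lambda>x h. 2 * (x \<bullet> h)"] conjI allI ballI)
    show "((\<lambda>x. x \<bullet> x) has_derivative (\<lambda>h. 2 * (x \<bullet> h))) (at x)" for x :: 'a
      by (auto intro!: derivative_eq_intros simp: inner_commute)
    show "(\<lambda>x::'a. 2 * (x \<bullet> b)) \<in> smooth_gen" for b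
      by (intro smooth_gen.mult smooth_gen.const smooth_gen.coord)
  qed
next
  case (add v w)
  then obtain D E where "\<forall>x. (v has_derivative D x) (at x)" "\<forall>b\<in>Basis. (\<lambda>x. D x b) \<in> smooth_gen"
     "\<forall>x. (w has_derivative E x) (at x)" "\<forall>b\<in>Basis. (\<lambda>x. E x b) \<in> smooth_gen" by blast
  then show ?case
    by (intro exI[of _ "\<lambda>x h. D x h + E x h"])
       (auto intro: smooth_gen.add intro!: derivative_eq_intros)
next
  case (mult v w)
  then obtain D E where "\<forall>x. (v has_derivative D x) (at x)" "\<forall>b\<in>Basis. (\<lambda>x. D x b) \<in> smooth_gen"
     "\<forall>x. (w has_derivative E x) (at x)" "\<forall>b\<in>Basis. (\<lambda>x. E x b) \<in> smooth_gen" by blast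
  with mult.hyps show ?case
    by (intro exI[of _ "\<lambda>x h. v x * E x h + D x h * w x"])
       (auto intro!: smooth_gen.add smooth_gen.mult has_derivative_mult)
next
  case (flat v m)
  then obtain D where D: "\<forall>x. (v has_derivative D x) (at x)" "\<forall>b\<in>Basis. (\<lambda>x. D x b) \<in> smooth_gen"
    by blast
  show ?case
  proof (intro exI[of _ "\<lambda>x h. (flat (m + 2) (v x) + (- real m) * flat (m + 1) (v x)) * D x h"] conjI allI ballI)
    fix x
    have "(flat m has_derivative (*) (flat (m + 2) (v x) + (- real m) * flat (m + 1) (v x))) (at (v x))"
      using flat_has_derivative[of m "v x"] by (simp add: has_field_derivative_def)
    from has_derivative_compose[OF D(1)[rule_format] this]
    show "((\<lambda>x. flat m (v x)) has_derivative
       (\<lambda>h. (flat (m + 2) (v x) + (- real m) * flat (m + 1) (v x)) * D x h)) (at x)" .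
  next
    fix b :: 'a assume "b \<in> Basis"
    then show "(\<lambda>x. (flat (m + 2) (v x) + (- real m) * flat (m + 1) (v x)) * D x b) \<in> smooth_gen"
      using D flat.hyps
      by (intro smooth_gen.mult smooth_gen.add smooth_gen.flat smooth_gen.const) auto
  qed
next
  case (affine v c a)
  then obtain D where D: "\<forall>x. (v has_derivative D x) (at x)" "\<forall>b\<in>Basis. (\<lambda>x. D x b) \<in> smooth_gen"
    by blast
  show ?case
  proof (intro exI[of _ "\<lambda>x h. c * D (c *\<^sub>R x + a) h"] conjI allI ballI)
    fix x
    have "((\<lambda>x. c *\<^sub>R x + a) has_derivative (\<lambda>h. c *\<^sub>R h)) (at x)"
      by (auto intro!: derivative_eq_intros)
    from has_derivative_compose[OF this D(1)[rule_format]]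
    have "((\<lambda>x. v (c *\<^sub>R x + a)) has_derivative (\<lambda>h. D (c *\<^sub>R x + a) (c *\<^sub>R h))) (at x)" .
    moreover have "linear (D (c *\<^sub>R x + a))" using D(1) has_derivative_linear by blast
    ultimately show "((\<lambda>x. v (c *\<^sub>R x + a)) has_derivative (\<lambda>h. c * D (c *\<^sub>R x + a) h)) (at x)"
      by (simp add: linear_scale)
  next
    fix b :: 'a assume "b \<in> Basis"
    then show "(\<lambda>x. c * D (c *\<^sub>R x + a) b) \<in> smooth_gen"
      using D(2) smooth_gen.affine[of "\<lambda>x. D x b"] by (intro smooth_gen.mult smooth_gen.const) auto
  qed
qed

lemma smooth_gen_smooth:
  assumes "v \<in> smooth_gen" shows "smooth v"
  using assms
proof (rule smooth_coinduct)
  fix v :: "'a \<Rightarrow> real" and x assume "v \<in> smooth_gen"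
  from smooth_gen_derivative[OF this] show "v differentiable (at x)"
    by (auto simp: differentiable_def)
next
  fix v :: "'a \<Rightarrow> real" and b :: 'a assume "v \<in> smooth_gen" and b: "b \<in> Basis"
  from smooth_gen_derivative[OF this(1)] obtain D where
    "\<forall>x. (v has_derivative D x) (at x)" "\<forall>b\<in>Basis. (\<lambda>x. D x b) \<in> smooth_gen" by blast
  moreover from this have "partial_deriv b v = (\<lambda>x. D x b)"
    by (intro ext partial_deriv_eqI) auto
  ultimately show "(\<lambda>x. partial_deriv b v x) \<in> smooth_gen"
    using b by auto
qed

lemma smooth_const: "smooth (\<lambda>x. c)"
  and smooth_square: "smooth (\<lambda>x. x \<bullet> x)"
  and smooth_add: "smooth v \<Longrightarrow> smooth w \<Longrightarrow> smooth (\<lambda>x. v x + w x)"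
  and smooth_mult: "smooth v \<Longrightarrow> smooth w \<Longrightarrow> smooth (\<lambda>x. v x * w x)"
  and smooth_flat: "smooth v \<Longrightarrow> smooth (\<lambda>x. flat m (v x))"
  and smooth_affine: "smooth v \<Longrightarrow> smooth (\<lambda>x. v (c *\<^sub>R x + a))"
  by (blast intro: smooth_gen_smooth smooth_gen.intros)+

lemma smooth_cmult: "smooth v \<Longrightarrow> smooth (\<lambda>x. c * v x)"
  by (intro smooth_mult smooth_const)

lemma smooth_diff: "smooth v \<Longrightarrow> smooth w \<Longrightarrow> smooth (\<lambda>x. v x - w x)"
  using smooth_add[of v "\<lambda>x. -1 * w x"] smooth_cmult[of w "-1"] by simp

lemma grad_mult:
  assumes "smooth v" "smooth w"
  shows "grad (\<lambda>x. v x * w x) x = v x *\<^sub>R grad w x + w x *\<^sub>R grad v x"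
  by (rule grad_eqI)
     (auto intro!: derivative_eq_intros smooth_has_derivative assms simp: inner_add_left algebra_simps)

lemma grad_diff:
  assumes "smooth v" "smooth w"
  shows "grad (\<lambda>x. v x - w x) x = grad v x - grad w x"
  by (rule grad_eqI)
     (auto intro!: derivative_eq_intros smooth_has_derivative assms simp: inner_diff_left algebra_simps)

lemma grad_affine:
  assumes "smooth v"
  shows "grad (\<lambda>x. v (c *\<^sub>R x + a)) x = c *\<^sub>R grad v (c *\<^sub>R x + a)"
proof (rule grad_eqI(1))
  have "((\<lambda>x. c *\<^sub>R x + a) has_derivative (\<lambda>h. c *\<^sub>R h)) (at x)"
    by (auto intro!: derivative_eq_intros)
  from has_derivative_compose[OF this smooth_has_derivative[OF assms]]
  have "((\<lambda>x. v (c *\<^sub>R x + a)) has_derivative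
      (\<lambda>h. (c *\<^sub>R grad v (c *\<^sub>R x + a)) \<bullet> h)) (at x)" by simp
  then show "((\<lambda>x. v (c *\<^sub>R x + a)) has_derivative (\<bullet>) (c *\<^sub>R grad v (c *\<^sub>R x + a))) (at x)" .
qed

lemma grad_compose:
  assumes "smooth v" "(S has_real_derivative d) (at (v x))"
  shows "grad (\<lambda>x. S (v x)) x = d *\<^sub>R grad v x"
proof (rule grad_eqI(1))
  have "((\<lambda>x. S (v x)) has_derivative (\<lambda>h. (d *\<^sub>R grad v x) \<bullet> h)) (at x)"
    using has_derivative_compose[OF smooth_has_derivative[OF assms(1)] assms(2)[unfolded has_field_derivative_def]]
    by simp
  then show "((\<lambda>x. S (v x)) has_derivative (\<bullet>) (d *\<^sub>R grad v x)) (at x)" .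
qed

section \<open>Compact support and test functions\<close>

lemma compact_support_iff:
  fixes v :: "'a::euclidean_space \<Rightarrow> real"
  shows "compact (closure {x. v x \<noteq> 0}) \<longleftrightarrow> (\<exists>R. \<forall>x. norm x > R \<longrightarrow> v x = 0)"
proof
  assume "compact (closure {x. v x \<noteq> 0})"
  then have "bounded {x. v x \<noteq> 0}"
    by (rule bounded_subset[OF compact_imp_bounded closure_subset])
  then obtain R where "\<forall>x\<in>{x. v x \<noteq> 0}. norm x \<le> R" unfolding bounded_iff by blast
  then show "\<exists>R. \<forall>x. norm x > R \<longrightarrow> v x = 0" by (intro exI[of _ R]) force
next
  assume "\<exists>R. \<forall>x. norm x > R \<longrightarrow> v x = 0"
  then obtain R where "\<forall>x. norm x > R \<longrightarrow> v x = 0" by blast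
  then have "{x. v x \<noteq> 0} \<subseteq> cball 0 R" by (force simp: not_less)
  then show "compact (closure {x. v x \<noteq> 0})"
    by (meson bounded_cball bounded_subset compact_closure)
qed

lemma test_functions_iff: "v \<in> test_functions \<longleftrightarrow> smooth v \<and> (\<exists>R. \<forall>x. norm x > R \<longrightarrow> v x = 0)"
  unfolding test_functions_def smooth_def compact_support_iff by simp

lemma test_functions_smooth: "v \<in> test_functions \<Longrightarrow> smooth v"
  by (simp add: test_functions_iff)

lemma grad_eq_0:
  fixes v :: "'a::euclidean_space \<Rightarrow> real"
  assumes "\<And>x. norm x > R \<Longrightarrow> v x = 0" "norm x > R"
  shows "grad v x = 0"
proof (rule grad_eqI(1))
  have "open {x::'a. norm x > R}" by (intro open_Collect_less continuous_intros)
  then have "(v has_derivative (\<lambda>h. 0)) (at x)"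
    using has_derivative_transform_within_open[of "\<lambda>x. 0" "\<lambda>h. 0" x UNIV "{x. norm x > R}" v] assms
    by auto
  then have "(v has_derivative (\<lambda>h. 0 \<bullet> h)) (at x)" by simp
  then show "(v has_derivative (\<bullet>) 0) (at x)" .
qed

lemma test_functions_obtain:
  assumes "v \<in> test_functions"
  obtains R where "R > 0" "\<And>x. norm x > R \<Longrightarrow> v x = 0" "\<And>x. norm x > R \<Longrightarrow> grad v x = 0"
proof -
  obtain R where R: "\<forall>x. norm x > R \<longrightarrow> v x = 0" using assms by (auto simp: test_functions_iff)
  show ?thesis
    using R by (intro that[of "max R 1"]) (auto intro!: grad_eq_0[of "max R 1"])
qed

lemma test_functions_partial:
  assumes "v \<in> test_functions" "b \<in> Basis"
  shows "(\<lambda>x. partial_deriv b v x) \<in> test_functions"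
proof -
  obtain R where "\<And>x. norm x > R \<Longrightarrow> grad v x = 0" using test_functions_obtain[OF assms(1)] by metis
  then have "\<exists>R. \<forall>x. norm x > R \<longrightarrow> partial_deriv b v x = 0"
    using assms(2) by (auto intro!: exI[of _ R] simp flip: grad_inner_Basis)
  then show ?thesis using assms smooth_partial test_functions_smooth
    by (auto simp: test_functions_iff)
qed

lemma test_functions_mult:
  assumes "v \<in> test_functions" "smooth w"
  shows "(\<lambda>x. v x * w x) \<in> test_functions"
  using assms by (auto simp: test_functions_iff intro!: smooth_mult)

lemma test_functions_affine:
  assumes "v \<in> test_functions" "c \<noteq> 0"
  shows "(\<lambda>x. v (c *\<^sub>R x + a)) \<in> test_functions"
proof -
  obtain R where R: "R > 0" "\<And>x. norm x > R \<Longrightarrow> v x = 0" using test_functions_obtain[OF assms(1)] by metis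
  have "v (c *\<^sub>R x + a) = 0" if "norm x > (R + norm a) / \<bar>c\<bar>" for x
  proof (rule R(2))
    have "R + norm a < norm (c *\<^sub>R x)" using that assms(2) by (simp add: field_simps)
    also have "\<dots> \<le> norm (c *\<^sub>R x + a) + norm a" using norm_triangle_ineq4[of "c *\<^sub>R x + a" a] by simp
    finally show "R < norm (c *\<^sub>R x + a)" by simp
  qed
  then show ?thesis using assms(1) by (auto simp: test_functions_iff intro!: smooth_affine)
qed

text \<open>The standard bump \<open>exp (- 1 / (1 - |x|^2))\<close> on the unit ball, extended by
  0.\<close>

definition bump :: "'a::euclidean_space \<Rightarrow> real" where
  "bump x = flat 0 (1 - x \<bullet> x)"

lemma bump_nonneg: "0 \<le> bump x"
  by (simp add: bump_def)

lemma bump_eq_0: "norm x \<ge> 1 \<Longrightarrow> bump x = 0"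
  using power_mono[of 1 "norm x" 2] by (simp add: bump_def power2_norm_eq_inner)

lemma bump_le: "bump x \<le> exp (- 1)"
  by (auto simp: bump_def flat_def field_simps)

lemma bump_0: "bump 0 = exp (- 1)"
  by (simp add: bump_def flat_def)

lemma bump_test: "bump \<in> test_functions"
proof -
  have "smooth (bump :: 'a \<Rightarrow> real)"
    unfolding bump_def by (intro smooth_flat smooth_diff smooth_const smooth_square)
  then show ?thesis
    by (auto simp: test_functions_iff intro!: exI[of _ 1] bump_eq_0)
qed

lemma continuous_compact_support_bounded:
  fixes w :: "'a::euclidean_space \<Rightarrow> 'b::real_normed_vector"
  assumes "continuous_on UNIV w" "\<And>x. norm x > R \<Longrightarrow> w x = 0"
  obtains B where "B > 0" "\<And>x. norm (w x) \<le> B"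
proof -
  have "compact (w ` cball 0 R)"
    by (intro compact_continuous_image continuous_on_subset[OF assms(1)]) auto
  then obtain B where B: "\<forall>y\<in>w ` cball 0 R. norm y \<le> B" using compact_imp_bounded bounded_iff by blast
  have "norm (w x) \<le> max B 1" for x
    using B assms(2)[of x] by (cases "norm x \<le> R") (auto simp: le_max_iff_disj)
  then show ?thesis by (intro that[of "max B 1"]) auto
qed

lemma continuous_compact_support_uniformly_continuous:
  fixes w :: "'a::euclidean_space \<Rightarrow> 'b::real_normed_vector"
  assumes "continuous_on UNIV w" "\<And>x. norm x > R \<Longrightarrow> w x = 0"
  shows "uniformly_continuous_on UNIV w"
  unfolding uniformly_continuous_on_def
proof (intro allI impI)
  fix e :: real assume "e > 0"
  \<comment> \<open>The margin 1 handles pairs at distance less than 1: either both points lie in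
    the larger ball, or both lie outside the ball of radius \<open>R\<close>, where \<open>w\<close>
    vanishes.\<close>
  have "uniformly_continuous_on (cball 0 (R + 1)) w"
    by (intro compact_uniformly_continuous continuous_on_subset[OF assms(1)]) auto
  with \<open>e > 0\<close> obtain d where d: "d > 0" 
     "\<And>x y. x \<in> cball 0 (R+1) \<Longrightarrow> y \<in> cball 0 (R+1) \<Longrightarrow> dist y x < d \<Longrightarrow> dist (w y) (w x) < e"
    unfolding uniformly_continuous_on_def by meson
  show "\<exists>d>0. \<forall>x\<in>UNIV. \<forall>y\<in>UNIV. dist y x < d \<longrightarrow> dist (w y) (w x) < e"
  proof (intro exI[of _ "min d 1"] conjI ballI impI)
    fix x y :: 'a assume *: "dist y x < min d 1"
    then have **: "norm (y - x) < 1" by (simp add: dist_norm)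
    show "dist (w y) (w x) < e"
    proof (cases "norm x \<le> R + 1 \<and> norm y \<le> R + 1")
      case True then show ?thesis using d * by auto
    next
      case False
      then have "norm x > R" "norm y > R"
        using ** norm_triangle_ineq2[of x y] norm_triangle_ineq2[of y x] by (auto simp: norm_minus_commute)
      then show ?thesis using assms(2) \<open>e > 0\<close> by simp
    qed
  qed (use d in auto)
qed

text \<open>The remainder bound is uniform in \<open>x\<close>, as differentiation under a
  convolution integral requires. It comes from the mean value inequality for \<open>w\<close> minus
  its linear part at \<open>x\<close>, whose derivative is small by uniform continuity of
  \<open>G\<close>.\<close>

lemma uniform_differentiability:
  fixes w :: "'a::euclidean_space \<Rightarrow> real"
  assumes w: "\<And>x. (w has_derivative (\<lambda>h. G x \<bullet> h)) (at x)"
    and G: "continuous_on UNIV G" "\<And>x. norm x > R \<Longrightarrow> G x = 0" and "e > 0"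
  obtains d where "d > 0" "\<And>x h. norm h < d \<Longrightarrow> \<bar>w (x + h) - w x - G x \<bullet> h\<bar> \<le> e * norm h"
proof -
  obtain d where d: "d > 0" "\<And>x y. dist y x < d \<Longrightarrow> dist (G y) (G x) < e"
    using continuous_compact_support_uniformly_continuous[OF G] \<open>e > 0\<close>
    unfolding uniformly_continuous_on_def by auto meson
  show ?thesis
  proof (rule that[OF d(1)])
    fix x h :: 'a assume h: "norm h < d"
    have "norm ((w (x + h) - G x \<bullet> (x + h)) - (w x - G x \<bullet> x)) \<le> norm h * e"
    proof (rule differentiable_bound_segment)
      fix t :: real assume "t \<in> {0..1}"
      then show "x + t *\<^sub>R h \<in> ball x d"
        using h by (auto simp: dist_norm intro: le_less_trans[OF mult_right_mono[of t 1 "norm h"]])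
    next
      fix z assume z: "z \<in> ball x d"
      show "((\<lambda>x'. w x' - G x \<bullet> x') has_derivative (\<lambda>h. G z \<bullet> h - G x \<bullet> h)) (at z within ball x d)"
        by (auto intro!: derivative_eq_intros has_derivative_at_withinI[OF w])
    next
      fix t :: real assume t: "t \<in> {0..1}"
      have "\<bar>(G (x + t *\<^sub>R h) - G x) \<bullet> k\<bar> \<le> e * norm k" for k
      proof (rule order_trans[OF Cauchy_Schwarz_ineq2 mult_right_mono])
        have "norm (t *\<^sub>R h) < d"
          using h t by (auto intro: le_less_trans[OF mult_right_mono[of t 1 "norm h"]])
        then show "norm (G (x + t *\<^sub>R h) - G x) \<le> e"
          using d(2)[of "x + t *\<^sub>R h" x] by (simp add: dist_norm)
      qed simp
      then show "onorm (\<lambda>k. G (x + t *\<^sub>R h) \<bullet> k - G x \<bullet> k) \<le> e"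
        by (intro onorm_bound) (use \<open>e > 0\<close> in \<open>auto simp: inner_diff_left\<close>)
    qed
    then show "\<bar>w (x + h) - w x - G x \<bullet> h\<bar> \<le> e * norm h"
      by (simp add: algebra_simps inner_add_right)
  qed
qed

section \<open>Powers of norms and their integrals\<close>

lemma nn_integral_lborel_affine:
  fixes f :: "'a::euclidean_space \<Rightarrow> ennreal"
  assumes f: "f \<in> borel_measurable borel" and c: "c \<noteq> 0"
  shows "(\<integral>\<^sup>+x. f (c *\<^sub>R x + a) \<partial>lborel) = ennreal (1 / \<bar>c\<bar> ^ DIM('a)) * (\<integral>\<^sup>+x. f x \<partial>lborel)"
proof -
  have [measurable]: "(\<lambda>x. a + c *\<^sub>R x) \<in> borel \<rightarrow>\<^sub>M borel" by measurable
  have "(\<integral>\<^sup>+x. f x \<partial>lborel) = (\<integral>\<^sup>+x. f x \<partial>density (distr lborel borel (\<lambda>x. a + c *\<^sub>R x)) (\<lambda>_. \<bar>c\<bar> ^ DIM('a)))"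
    using lborel_affine[OF c, of a] by simp
  also have "\<dots> = ennreal (\<bar>c\<bar> ^ DIM('a)) * (\<integral>\<^sup>+x. f (c *\<^sub>R x + a) \<partial>lborel)"
    using f by (simp add: nn_integral_density nn_integral_distr nn_integral_cmult add.commute)
  finally show ?thesis
    using c by (simp add: mult.assoc[symmetric] ennreal_mult[symmetric])
qed

lemma lborel_integral_affine:
  fixes f :: "'a::euclidean_space \<Rightarrow> 'b::{banach, second_countable_topology}"
  assumes f: "f \<in> borel_measurable borel" and c: "c \<noteq> 0"
  shows "(\<integral>x. f (c *\<^sub>R x + a) \<partial>lborel) = (1 / \<bar>c\<bar> ^ DIM('a)) *\<^sub>R (\<integral>x. f x \<partial>lborel)"
    and "integrable lborel f \<Longrightarrow> integrable lborel (\<lambda>x. f (c *\<^sub>R x + a))"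
proof -
  have [measurable]: "(\<lambda>x. a + c *\<^sub>R x) \<in> borel \<rightarrow>\<^sub>M borel" by measurable
  note [measurable] = f
  have "(\<integral>x. f x \<partial>lborel) = (\<integral>x. f x \<partial>density (distr lborel borel (\<lambda>x. a + c *\<^sub>R x)) (\<lambda>_. \<bar>c\<bar> ^ DIM('a)))"
    using lborel_affine[OF c, of a] by simp
  also have "\<dots> = (\<bar>c\<bar> ^ DIM('a)) *\<^sub>R (\<integral>x. f (c *\<^sub>R x + a) \<partial>lborel)"
    by (simp add: integral_density integral_distr add.commute)
  finally show "(\<integral>x. f (c *\<^sub>R x + a) \<partial>lborel) = (1 / \<bar>c\<bar> ^ DIM('a)) *\<^sub>R (\<integral>x. f x \<partial>lborel)"
    using c by simp
  assume "integrable lborel f"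
  then have "integrable (density (distr lborel borel (\<lambda>x. a + c *\<^sub>R x)) (\<lambda>_. \<bar>c\<bar> ^ DIM('a))) f"
    using lborel_affine[OF c, of a] by simp
  then have "integrable lborel (\<lambda>x. (\<bar>c\<bar> ^ DIM('a)) *\<^sub>R f (c *\<^sub>R x + a))"
    by (simp add: integrable_density integrable_distr_eq add.commute)
  from integrable_scaleR_right[OF this, of "1 / \<bar>c\<bar> ^ DIM('a)"]
  show "integrable lborel (\<lambda>x. f (c *\<^sub>R x + a))"
    using c by simp
qed

section \<open>Convexity of powers and Jensen's inequality\<close>

lemma powr_add_le:
  fixes a b p :: real
  assumes "0 \<le> a" "0 \<le> b" "0 \<le> p"
  shows "(a + b) powr p \<le> 2 powr p * (a powr p + b powr p)"
proof -
  have "(a + b) powr p \<le> (2 * max a b) powr p"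
    using assms by (intro powr_mono2) auto
  also have "\<dots> = 2 powr p * max a b powr p" using assms by (simp add: powr_mult)
  also have "max a b powr p \<le> a powr p + b powr p" by (auto simp: max_def)
  finally show ?thesis by (simp add: mult_left_mono)
qed

text \<open>Young's inequality for the product of \<open>t\<close> and \<open>a powr (p - 1)\<close>
  with exponents \<open>p\<close> and \<open>p / (p - 1)\<close>, rearranged: a convex power lies
  above its tangent at \<open>a\<close>.\<close>

lemma powr_tangent:
  fixes a t p :: real
  assumes "0 \<le> a" "0 \<le> t" "1 \<le> p"
  shows "a powr p + p * a powr (p - 1) * (t - a) \<le> t powr p"
proof (cases "p = 1 \<or> a = 0")
  case False
  then have p: "p > 1" and a: "a > 0" using assms by auto
  define p' where "p' = p / (p - 1)"
  have p': "p' > 1" "1 / p + 1 / p' = 1" using p by (auto simp: p'_def field_simps)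
  have "t * a powr (p - 1) \<le> t powr p / p + (a powr (p - 1)) powr p' / p'"
    by (rule Youngs_inequality[OF p p']) (use assms in auto)
  also have "(a powr (p - 1)) powr p' = a powr p"
    using p by (simp add: powr_powr p'_def)
  finally have "p * (t * a powr (p - 1)) \<le> p * (t powr p / p + a powr p / p')"
    using p by simp
  also have "\<dots> = t powr p + (p - 1) * a powr p"
    using p by (simp add: p'_def field_simps)
  finally have "p * (t * a powr (p - 1)) \<le> t powr p + (p - 1) * a powr p" .
  moreover have "a powr (p - 1) * a = a powr p"
    using a by (simp add: powr_diff)
  ultimately show ?thesis by (simp add: algebra_simps)
next
  case True
  then show ?thesis using assms by (cases "a = 0") auto
qed

text \<open>The left factor is the gradient of \<open>|.|^p / p\<close> at \<open>\<xi>\<close>.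
  With \<open>\<xi>\<close> the gradient of \<open>u\<close> and \<open>\<eta>\<close> that of its
  dilate, the inequality compares the variation with a difference of energies. Cauchy-Schwarz
  reduces it to one dimension.\<close>

lemma norm_powr_tangent:
  fixes \<xi> \<eta> :: "'a::real_inner"
  assumes "1 < p"
  shows "(norm \<xi> powr (p - 2) *\<^sub>R \<xi>) \<bullet> (\<eta> - \<xi>) \<le> (norm \<eta> powr p - norm \<xi> powr p) / p"
proof (cases "\<xi> = 0")
  case False
  have 1: "norm \<xi> powr (p - 2) * (\<xi> \<bullet> \<eta>) \<le> norm \<xi> powr (p - 2) * (norm \<xi> * norm \<eta>)"
    by (intro mult_left_mono norm_cauchy_schwarz) auto
  have 2: "norm \<xi> powr (p - 2) * norm \<xi> = norm \<xi> powr (p - 1)"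
    using False powr_add[of "norm \<xi>" "p - 2" 1] by simp
  have 3: "norm \<xi> powr (p - 2) * (\<xi> \<bullet> \<xi>) = norm \<xi> powr p"
    using False powr_add[of "norm \<xi>" "p - 2" 2] by (simp add: power2_norm_eq_inner)
  have 4: "norm \<xi> powr (p - 1) * norm \<xi> = norm \<xi> powr p"
    using False powr_add[of "norm \<xi>" "p - 1" 1] by simp
  have "(norm \<xi> powr (p - 2) *\<^sub>R \<xi>) \<bullet> (\<eta> - \<xi>) \<le> norm \<xi> powr (p - 1) * (norm \<eta> - norm \<xi>)"
  proof -
    have "norm \<xi> powr (p - 2) * (norm \<xi> * norm \<eta>) = norm \<xi> powr (p - 1) * norm \<eta>"
      using 2 by (metis mult.assoc)
    with 1 have "norm \<xi> powr (p - 2) * (\<xi> \<bullet> \<eta>) \<le> norm \<xi> powr (p - 1) * norm \<eta>" by linarith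
    then show ?thesis using 3 4 by (simp add: inner_diff_right right_diff_distrib)
  qed
  also have "\<dots> \<le> (norm \<eta> powr p - norm \<xi> powr p) / p"
    using powr_tangent[of "norm \<xi>" "norm \<eta>" p] assms by (simp add: field_simps)
  finally show ?thesis .
qed (use assms in auto)

text \<open>The tangent inequality at the mean \<open>a\<close> of \<open>norm (f x)\<close>,
  integrated against the probability density \<open>w\<close>: the linear term integrates to
  0.\<close>

lemma weighted_jensen:
  fixes f :: "'a \<Rightarrow> 'b::{banach, second_countable_topology}"
  assumes [measurable]: "f \<in> borel_measurable M" "w \<in> borel_measurable M"
    and w: "\<And>x. 0 \<le> w x" "integrable M w" "(\<integral>x. w x \<partial>M) = 1" and p: "1 \<le> p"
  shows "ennreal (norm (\<integral>x. w x *\<^sub>R f x \<partial>M) powr p) \<le> (\<integral>\<^sup>+x. ennreal (w x * norm (f x) powr p) \<partial>M)"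
proof (cases "integrable M (\<lambda>x. w x *\<^sub>R f x) \<and> (\<integral>\<^sup>+x. ennreal (w x * norm (f x) powr p) \<partial>M) < \<infinity>")
  case True
  then have i1: "integrable M (\<lambda>x. w x *\<^sub>R f x)" by auto
  have i2: "integrable M (\<lambda>x. w x * norm (f x) powr p)"
    using True w by (intro integrableI_nonneg) auto
  have i3: "integrable M (\<lambda>x. w x * norm (f x))"
    using integrable_norm[OF i1] w by simp
  define a where "a = (\<integral>x. w x * norm (f x) \<partial>M)"
  have a: "0 \<le> a" unfolding a_def using w by (intro integral_nonneg_AE) auto
  have "(\<integral>x. (a powr p - p * a powr (p - 1) * a) * w x + p * a powr (p - 1) * (w x * norm (f x)) \<partial>M)
     \<le> (\<integral>x. w x * norm (f x) powr p \<partial>M)"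
  proof (rule integral_mono)
    fix x
    have "w x * (a powr p + p * a powr (p - 1) * (norm (f x) - a)) \<le> w x * norm (f x) powr p"
      by (intro mult_left_mono powr_tangent a p w) auto
    then show "(a powr p - p * a powr (p - 1) * a) * w x + p * a powr (p - 1) * (w x * norm (f x))
       \<le> w x * norm (f x) powr p" by (simp add: algebra_simps)
  qed (intro Bochner_Integration.integrable_add integrable_mult_right w i2 i3)+
  also have "(\<integral>x. (a powr p - p * a powr (p - 1) * a) * w x + p * a powr (p - 1) * (w x * norm (f x)) \<partial>M)
    = a powr p"
  proof -
    have "(\<integral>x. C * w x + D * (w x * norm (f x)) \<partial>M) = C + D * a" for C D
      using w i3 by (simp add: a_def)
    then show ?thesis by simp
  qed
  finally have "a powr p \<le> (\<integral>x. w x * norm (f x) powr p \<partial>M)" .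
  moreover have "norm (\<integral>x. w x *\<^sub>R f x \<partial>M) \<le> a"
    using integral_norm_bound[of M "\<lambda>x. w x *\<^sub>R f x"] w by (simp add: a_def)
  then have "norm (\<integral>x. w x *\<^sub>R f x \<partial>M) powr p \<le> a powr p"
    using p by (intro powr_mono2) auto
  ultimately have "norm (\<integral>x. w x *\<^sub>R f x \<partial>M) powr p \<le> (\<integral>x. w x * norm (f x) powr p \<partial>M)" by simp
  then show ?thesis
    using w i2 by (subst nn_integral_eq_integral) (auto intro: ennreal_leI)
next
  \<comment> \<open>If \<open>w x *\<^sub>R f x\<close> is not integrable, its Bochner integral is 0
    and the left side vanishes; otherwise the right side is infinite.\<close>
  case False
  then show ?thesis
    by (auto simp: not_integrable_integral_eq not_less top_unique)
qed

text \<open>The p-th power of the \<open>L^p\<close> norm, kept as an extended real and without the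
  root. Membership in \<open>L^p\<close> thus becomes an inequality, and the triangle inequality
  takes the form \<open>pow_int_add\<close> with the factor \<open>2 powr p\<close>.\<close>

definition pow_int :: "real \<Rightarrow> ('a::euclidean_space \<Rightarrow> 'b::real_normed_vector) \<Rightarrow> ennreal" where
  "pow_int p f = (\<integral>\<^sup>+x. ennreal (norm (f x) powr p) \<partial>lborel)"

lemma pow_int_mono:
  assumes "\<And>x. norm (f x) \<le> norm (g x)" "0 \<le> p"
  shows "pow_int p f \<le> pow_int p g"
  unfolding pow_int_def using assms by (intro nn_integral_mono ennreal_leI powr_mono2) auto

lemma pow_int_uminus: "pow_int p (\<lambda>x. - f x) = pow_int p f"
  and pow_int_minus_commute: "pow_int p (\<lambda>x. f x - g x) = pow_int p (\<lambda>x. g x - f x)"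
  by (simp_all add: pow_int_def norm_minus_commute)

lemma pow_int_add:
  fixes f g :: "'a::euclidean_space \<Rightarrow> 'b::{real_normed_vector, second_countable_topology}"
  assumes [measurable]: "f \<in> borel_measurable borel" "g \<in> borel_measurable borel" and "0 \<le> p"
  shows "pow_int p (\<lambda>x. f x + g x) \<le> ennreal (2 powr p) * (pow_int p f + pow_int p g)"
proof -
  have "pow_int p (\<lambda>x. f x + g x) \<le> (\<integral>\<^sup>+x. ennreal (2 powr p * (norm (f x) powr p + norm (g x) powr p)) \<partial>lborel)"
    unfolding pow_int_def
  proof (intro nn_integral_mono ennreal_leI)
    fix x
    have "norm (f x + g x) powr p \<le> (norm (f x) + norm (g x)) powr p"
      by (intro powr_mono2 assms norm_triangle_ineq) auto
    also have "\<dots> \<le> 2 powr p * (norm (f x) powr p + norm (g x) powr p)"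
      by (intro powr_add_le assms) auto
    finally show "norm (f x + g x) powr p \<le> 2 powr p * (norm (f x) powr p + norm (g x) powr p)" .
  qed
  also have "\<dots> = ennreal (2 powr p) * (pow_int p f + pow_int p g)"
    by (simp add: pow_int_def ennreal_mult nn_integral_cmult nn_integral_add ennreal_plus[symmetric] del: ennreal_plus)
       (simp add: nn_integral_add)
  finally show ?thesis .
qed

lemma pow_int_diff:
  fixes f g :: "'a::euclidean_space \<Rightarrow> 'b::{real_normed_vector, second_countable_topology}"
  assumes [measurable]: "f \<in> borel_measurable borel" "g \<in> borel_measurable borel" and "0 \<le> p"
  shows "pow_int p (\<lambda>x. f x - g x) \<le> ennreal (2 powr p) * (pow_int p f + pow_int p g)"
  using pow_int_add[of f "\<lambda>x. - g x" p] assms by (simp add: pow_int_uminus)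

lemma pow_int_affine:
  fixes f :: "'a::euclidean_space \<Rightarrow> 'b::{real_normed_vector, second_countable_topology}"
  assumes [measurable]: "f \<in> borel_measurable borel" and "c \<noteq> 0"
  shows "pow_int p (\<lambda>x. f (c *\<^sub>R x + a)) = ennreal (1 / \<bar>c\<bar> ^ DIM('a)) * pow_int p f"
  unfolding pow_int_def
  by (rule nn_integral_lborel_affine[of "\<lambda>x. ennreal (norm (f x) powr p)"]) (use assms in auto)

lemma pow_int_cmult:
  fixes f :: "'a::euclidean_space \<Rightarrow> 'b::{real_normed_vector, second_countable_topology}"
  assumes [measurable]: "f \<in> borel_measurable borel" and "0 \<le> p"
  shows "pow_int p (\<lambda>x. c *\<^sub>R f x) = ennreal (\<bar>c\<bar> powr p) * pow_int p f"
  by (simp add: pow_int_def powr_mult ennreal_mult nn_integral_cmult)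

lemma pow_int_finite_iff:
  fixes f :: "'a::euclidean_space \<Rightarrow> 'b::{real_normed_vector, second_countable_topology}"
  assumes [measurable]: "f \<in> borel_measurable borel"
  shows "pow_int p f < \<infinity> \<longleftrightarrow> integrable lborel (\<lambda>x. norm (f x) powr p)"
  by (simp add: pow_int_def integrable_iff_bounded)

lemma pow_int_eq_integral:
  fixes f :: "'a::euclidean_space \<Rightarrow> 'b::{real_normed_vector, second_countable_topology}"
  assumes "integrable lborel (\<lambda>x. norm (f x) powr p)"
  shows "pow_int p f = ennreal (\<integral>x. norm (f x) powr p \<partial>lborel)"
  unfolding pow_int_def using assms by (intro nn_integral_eq_integral) auto

lemma ennreal_tendsto_0I:
  fixes F :: "nat \<Rightarrow> ennreal"
  assumes "\<And>e. 0 < e \<Longrightarrow> eventually (\<lambda>n. F n \<le> ennreal e) sequentially"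
  shows "F \<longlonglongrightarrow> 0"
proof (rule order_tendstoI)
  fix a :: ennreal assume "a > 0"
  then obtain e where e: "0 < e" "ennreal e < a"
    by (metis dense ennreal_cases ennreal_less_zero_iff less_top not_less_iff_gr_or_eq top.not_eq_extremum)
  from assms[OF e(1)] show "eventually (\<lambda>n. F n < a) sequentially"
    by eventually_elim (use e in auto)
qed auto

text \<open>Two dominated approximations: first \<open>f\<close> is cut off where \<open>x\<close>
  or its value is large; then the bounded remainder is approximated almost everywhere by continuous
  functions, confined to a slightly larger ball and to the same bound so that domination applies
  again.\<close>

lemma pow_int_density_continuous:
  fixes f :: "'a::euclidean_space \<Rightarrow> 'b::euclidean_space"
  assumes f [measurable]: "f \<in> borel_measurable borel" and p: "1 \<le> p"
    and fin: "pow_int p f < \<infinity>" and e: "0 < e"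
  obtains h R where "continuous_on UNIV h" "\<And>x. norm x > R \<Longrightarrow> h x = 0" "pow_int p (\<lambda>x. f x - h x) < ennreal e"
proof -
  define f' where "f' n x = (if norm x \<le> real n \<and> norm (f x) \<le> real n then f x else 0)" for n x
  have [measurable]: "f' n \<in> borel_measurable borel" for n unfolding f'_def by measurable
  define \<epsilon> where "\<epsilon> = e / (4 * 2 powr p)"
  have \<epsilon>: "\<epsilon> > 0" using e by (simp add: \<epsilon>_def)
  have "(\<lambda>n. \<integral>\<^sup>+x. ennreal (norm (f x - f' n x) powr p) \<partial>lborel) \<longlonglongrightarrow> (\<integral>\<^sup>+x. 0 \<partial>(lborel :: 'a measure))"
  proof (rule nn_integral_dominated_convergence[where w = "\<lambda>x. ennreal (norm (f x) powr p)"])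
    show "AE x in lborel. ennreal (norm (f x - f' n x) powr p) \<le> ennreal (norm (f x) powr p)" for n
      by (auto simp: f'_def)
    show "AE x in lborel. (\<lambda>n. ennreal (norm (f x - f' n x) powr p)) \<longlonglongrightarrow> 0"
    proof (rule AE_I2)
      fix x
      have "eventually (\<lambda>n. ennreal (norm (f x - f' n x) powr p) = 0) sequentially"
        using eventually_ge_at_top[of "nat \<lceil>max (norm x) (norm (f x))\<rceil>"]
        by eventually_elim (auto simp: f'_def nat_le_iff ceiling_le_iff)
      then show "(\<lambda>n. ennreal (norm (f x - f' n x) powr p)) \<longlonglongrightarrow> 0" by (rule tendsto_eventually)
    qed
  qed (use fin in \<open>auto simp: pow_int_def\<close>)
  then have "eventually (\<lambda>n. pow_int p (\<lambda>x. f x - f' n x) < ennreal \<epsilon>) sequentially"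
    using \<epsilon> unfolding pow_int_def by (intro order_tendstoD) auto
  then obtain n0 where "\<And>n. n \<ge> n0 \<Longrightarrow> pow_int p (\<lambda>x. f x - f' n x) < ennreal \<epsilon>"
    unfolding eventually_sequentially by auto
  then have n: "pow_int p (\<lambda>x. f x - f' (Suc n0) x) < ennreal \<epsilon>" by simp
  define n where "n = Suc n0"
  have "f' n \<in> borel_measurable lebesgue" by (simp add: measurable_completion)
  then have "f' n measurable_on UNIV"
    using measurable_on_iff_borel_measurable[of UNIV "f' n"] by (simp add: lebesgue_on_UNIV_eq)
  then obtain Z g where Z: "negligible Z" and g: "\<And>k. continuous_on UNIV (g k)"
    and lim: "\<And>x. x \<notin> Z \<Longrightarrow> (\<lambda>k. g k x) \<longlonglongrightarrow> f' n x"
    unfolding measurable_on_def by auto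
  \<comment> \<open>\<open>\<kappa>\<close> is 1 on the ball of radius \<open>n\<close> and 0 beyond
    \<open>n + 1\<close>; dividing by the maximum retracts values radially to norm at most
    \<open>n\<close>. Both operations leave \<open>f' n\<close> itself unchanged.\<close>
  define \<kappa> where "\<kappa> x = max 0 (min 1 (real n + 1 - norm x))" for x :: 'a
  define h where "h k x = (\<kappa> x / max 1 (norm (g k x) / real n)) *\<^sub>R g k x" for k x
  have npos: "real n > 0" by (simp add: n_def)
  have hc: "continuous_on UNIV (h k)" for k
    unfolding h_def \<kappa>_def using npos by (intro continuous_intros g) (auto simp: max_def)
  have h0: "h k x = 0" if "norm x > real n + 1" for k x using that by (simp add: h_def \<kappa>_def)
  have hb: "norm (h k x) \<le> real n" for k x
  proof -
    have "0 \<le> \<kappa> x" "\<kappa> x \<le> 1" by (auto simp: \<kappa>_def)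
    moreover have "norm (g k x) \<le> real n * max 1 (norm (g k x) / real n)"
      using npos by (auto simp: max_def field_simps)
    ultimately have "\<kappa> x * norm (g k x) \<le> real n * max 1 (norm (g k x) / real n)"
      by (metis mult_left_le_one_le norm_ge_zero order_trans)
    then show ?thesis using \<open>0 \<le> \<kappa> x\<close> by (simp add: h_def field_simps max_def split: if_splits)
  qed
  have hlim: "(\<lambda>k. h k x) \<longlonglongrightarrow> f' n x" if "x \<notin> Z" for x
  proof -
    have "(\<lambda>k. h k x) \<longlonglongrightarrow> (\<kappa> x / max 1 (norm (f' n x) / real n)) *\<^sub>R f' n x"
      unfolding h_def using npos by (intro tendsto_intros lim that) (auto simp: max_def)
    also have "(\<kappa> x / max 1 (norm (f' n x) / real n)) *\<^sub>R f' n x = f' n x"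
      using npos by (auto simp: f'_def \<kappa>_def)
    finally show ?thesis .
  qed
  have Zae: "AE x in lborel. x \<notin> Z"
  proof -
    have "AE x in lebesgue. x \<notin> Z" using Z by (simp add: AE_not_in negligible_iff_null_sets)
    then show ?thesis by (simp add: AE_completion_iff)
  qed
  have [measurable]: "h k \<in> borel_measurable borel" for k using hc by (rule borel_measurable_continuous_onI)
  have "(\<lambda>k. \<integral>\<^sup>+x. ennreal (norm (f' n x - h k x) powr p) \<partial>lborel) \<longlonglongrightarrow> (\<integral>\<^sup>+x. 0 \<partial>(lborel :: 'a measure))"
  proof (rule nn_integral_dominated_convergence[where
        w = "\<lambda>x. ennreal ((2 * real n) powr p) * indicator (cball 0 (real n + 1)) x"])
    show "AE x in lborel. ennreal (norm (f' n x - h k x) powr p)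
         \<le> ennreal ((2 * real n) powr p) * indicator (cball 0 (real n + 1)) x" for k
    proof (rule AE_I2)
      fix x
      have "norm (f' n x) \<le> real n" by (auto simp: f'_def)
      then have "norm (f' n x - h k x) \<le> 2 * real n"
        using norm_triangle_ineq4[of "f' n x" "h k x"] hb[of k x] by linarith
      then have "norm (f' n x - h k x) powr p \<le> (2 * real n) powr p"
        using p by (intro powr_mono2) auto
      moreover have "f' n x = 0 \<and> h k x = 0" if "norm x > real n + 1" using that h0 by (auto simp: f'_def)
      ultimately show "ennreal (norm (f' n x - h k x) powr p)
         \<le> ennreal ((2 * real n) powr p) * indicator (cball 0 (real n + 1)) x"
        by (cases "norm x > real n + 1") (auto simp: indicator_def intro: ennreal_leI)
    qed
    show "(\<integral>\<^sup>+x. ennreal ((2 * real n) powr p) * indicator (cball 0 (real n + 1)) x \<partial>(lborel::'a measure)) < \<infinity>"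
      using emeasure_lborel_cball_finite[of "0::'a" "real n + 1"]
      by (simp add: nn_integral_cmult_indicator ennreal_mult_less_top)
    show "AE x in lborel. (\<lambda>k. ennreal (norm (f' n x - h k x) powr p)) \<longlonglongrightarrow> 0"
      using Zae
    proof eventually_elim
      case (elim x)
      from tendsto_diff[OF tendsto_const hlim[OF elim], of "f' n x"]
      have "(\<lambda>k. norm (f' n x - h k x)) \<longlonglongrightarrow> 0" by (simp add: tendsto_norm_zero)
      from tendsto_powr'[OF this tendsto_const, of p] p
      have "(\<lambda>k. norm (f' n x - h k x) powr p) \<longlonglongrightarrow> 0" by simp
      from tendsto_ennrealI[OF this] show ?case by simp
    qed
    show "(\<lambda>x. ennreal (norm (f' n x - h k x) powr p)) \<in> borel_measurable lborel" for k by measurable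
    show "(\<lambda>x. ennreal ((2 * real n) powr p) * indicator (cball 0 (real n + 1)) x) \<in> borel_measurable (lborel :: 'a measure)"
      by (intro borel_measurable_times_ennreal borel_measurable_const borel_measurable_indicator) auto
  qed auto
  then have "eventually (\<lambda>k. pow_int p (\<lambda>x. f' n x - h k x) < ennreal \<epsilon>) sequentially"
    using \<epsilon> unfolding pow_int_def by (intro order_tendstoD) auto
  then obtain k where k: "pow_int p (\<lambda>x. f' n x - h k x) < ennreal \<epsilon>"
    unfolding eventually_sequentially by auto
  have "pow_int p (\<lambda>x. f x - h k x) = pow_int p (\<lambda>x. (f x - f' n x) + (f' n x - h k x))" by simp
  also have "\<dots> \<le> ennreal (2 powr p) * (pow_int p (\<lambda>x. f x - f' n x) + pow_int p (\<lambda>x. f' n x - h k x))"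
    by (intro pow_int_add) (use p in auto)
  also have "\<dots> \<le> ennreal (2 powr p) * (ennreal \<epsilon> + ennreal \<epsilon>)"
    using k n by (intro mult_left_mono add_mono) (auto simp: n_def)
  also have "\<dots> = ennreal (e / 2)"
    using \<epsilon> by (simp add: ennreal_plus[symmetric] ennreal_mult[symmetric] \<epsilon>_def del: ennreal_plus)
  also have "\<dots> < ennreal e" using e by (simp add: ennreal_less_iff)
  finally have "pow_int p (\<lambda>x. f x - h k x) < ennreal e" .
  then show ?thesis by (intro that[of "h k" "real n + 1"] hc h0)
qed

text \<open>Continuity of translations and dilations in \<open>L^p\<close>: it holds for continuous
  functions of compact support, and density transfers it, since an affine change with
  \<open>c \<ge> 1 / 2\<close> multiplies \<open>pow_int\<close> by at most
  \<open>2 ^ DIM('a)\<close>.\<close>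

lemma pow_int_affine_continuous:
  fixes f :: "'a::euclidean_space \<Rightarrow> 'b::euclidean_space"
  assumes f [measurable]: "f \<in> borel_measurable borel" and p: "1 \<le> p"
    and fin: "pow_int p f < \<infinity>" and e: "0 < e"
  obtains d where "0 < d" "\<And>a c. norm a < d \<Longrightarrow> \<bar>c - 1\<bar> < d \<Longrightarrow> pow_int p (\<lambda>x. f (c *\<^sub>R x + a) - f x) \<le> ennreal e"
proof -
  define K where "K = 2 powr p"
  have K: "K > 0" by (simp add: K_def)
  \<comment> \<open>The divisor makes two applications of \<open>pow_int_add\<close>, with errors
    \<open>2 ^ DIM('a) * \<epsilon>\<close>, \<open>\<epsilon>\<close> and
    \<open>\<epsilon>\<close>, add up to exactly \<open>e\<close>.\<close>
  define \<epsilon> where "\<epsilon> = e / (K * (K * (2 ^ DIM('a) + 1) + 1))"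
  have den: "K * (K * (2 ^ DIM('a) + 1) + 1) > 0" using K by (intro mult_pos_pos add_pos_pos) auto
  have \<epsilon>: "\<epsilon> > 0" using e den by (simp add: \<epsilon>_def)
  from pow_int_density_continuous[OF f p fin \<epsilon>] obtain h R0 where
    hc: "continuous_on UNIV h" and h00: "\<And>x. norm x > R0 \<Longrightarrow> h x = 0" and fh: "pow_int p (\<lambda>x. f x - h x) < ennreal \<epsilon>" by metis
  define R where "R = max R0 1"
  have R: "R > 0" and h0: "\<And>x. norm x > R \<Longrightarrow> h x = 0" using h00 by (auto simp: R_def)
  have [measurable]: "h \<in> borel_measurable borel" using hc by (rule borel_measurable_continuous_onI)
  \<comment> \<open>Outside this ball both terms vanish: \<open>c \<ge> 1 / 2\<close> and
    \<open>norm a < 1 / 2\<close> give \<open>norm (c *\<^sub>R x + a) > R\<close>.\<close>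
  define B where "B = cball (0::'a) (2 * (R + 1))"
  define m where "m = measure lborel B"
  have mB: "emeasure lborel B = ennreal m"
    using emeasure_lborel_cball_finite[of "0::'a" "2 * (R + 1)"] unfolding m_def B_def
    by (intro emeasure_eq_ennreal_measure) (simp add: less_top)
  define \<delta> where "\<delta> = (\<epsilon> / (m + 1)) powr (1 / p)"
  have m0: "m \<ge> 0" by (simp add: m_def)
  have \<delta>: "\<delta> > 0" "\<delta> powr p * m \<le> \<epsilon>" using \<epsilon> m0 p
    by (auto simp: \<delta>_def powr_powr field_simps)
  obtain d0 where d0: "d0 > 0" "\<And>x y. dist y x < d0 \<Longrightarrow> dist (h y) (h x) < \<delta>"
    using continuous_compact_support_uniformly_continuous[OF hc h0] \<delta>
    unfolding uniformly_continuous_on_def by auto meson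
  define d where "d = min (1/2) (d0 / (2 * (R + 1) + 1))"
  have d: "d > 0" using d0 R by (simp add: d_def)
  have "pow_int p (\<lambda>x. f (c *\<^sub>R x + a) - f x) \<le> ennreal e" if a: "norm a < d" and c: "\<bar>c - 1\<bar> < d" for a c
  proof -
    have "\<bar>c - 1\<bar> < 1 / 2" using c by (simp add: d_def)
    then have c2: "1 / 2 \<le> c" "c \<noteq> 0" by linarith+
    have "pow_int p (\<lambda>x. h (c *\<^sub>R x + a) - h x) \<le> (\<integral>\<^sup>+x. ennreal (\<delta> powr p) * indicator B x \<partial>lborel)"
      unfolding pow_int_def
    proof (rule nn_integral_mono)
      fix x
      show "ennreal (norm (h (c *\<^sub>R x + a) - h x) powr p) \<le> ennreal (\<delta> powr p) * indicator B x"
      proof (cases "x \<in> B")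
        case True
        then have nx: "norm x \<le> 2 * (R + 1)" by (simp add: B_def)
        have "dist (c *\<^sub>R x + a) x = norm ((c - 1) *\<^sub>R x + a)" by (simp add: dist_norm algebra_simps)
        also have "\<dots> \<le> \<bar>c - 1\<bar> * norm x + norm a" using norm_triangle_ineq[of "(c-1) *\<^sub>R x" a] by simp
        also have "\<dots> < d * (2 * (R + 1)) + d"
          using a c nx d R by (intro add_le_less_mono mult_mono) auto
        also have "\<dots> = d * (2 * (R + 1) + 1)" by (simp add: algebra_simps)
        also have "\<dots> \<le> d0 / (2 * (R + 1) + 1) * (2 * (R + 1) + 1)"
          using R by (intro mult_right_mono) (auto simp: d_def)
        also have "\<dots> = d0" using R by simp
        finally have "norm (h (c *\<^sub>R x + a) - h x) \<le> \<delta>"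
          using d0(2) by (metis dist_norm less_imp_le)
        then show ?thesis using True p by (auto intro!: ennreal_leI powr_mono2)
      next
        case False
        then have nx: "norm x > 2 * (R + 1)" by (simp add: B_def)
        have "(1/2) * norm x \<le> c * norm x" using c2 by (intro mult_right_mono) auto
        also have "\<dots> = norm (c *\<^sub>R x)" using c2 by simp
        also have "\<dots> \<le> norm (c *\<^sub>R x + a) + norm a" using norm_triangle_ineq4[of "c *\<^sub>R x + a" a] by simp
        finally have "norm (c *\<^sub>R x + a) > R" using nx a by (simp add: d_def)
        then show ?thesis using h0 nx R by simp
      qed
    qed
    also have "\<dots> = ennreal (\<delta> powr p * m)"
    proof -
      have "B \<in> sets lborel" by (simp add: B_def)
      then show ?thesis by (simp add: nn_integral_cmult_indicator mB ennreal_mult m0)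
    qed
    also have "\<dots> \<le> ennreal \<epsilon>" using \<delta> by (intro ennreal_leI)
    finally have 1: "pow_int p (\<lambda>x. h (c *\<^sub>R x + a) - h x) \<le> ennreal \<epsilon>" .
    have "1 / \<bar>c\<bar> ^ DIM('a) = (1 / \<bar>c\<bar>) ^ DIM('a)" by (simp add: power_one_over)
    also have "\<dots> \<le> 2 ^ DIM('a)" using c2 by (intro power_mono) (auto simp: field_simps)
    finally have "ennreal (1 / \<bar>c\<bar> ^ DIM('a)) \<le> ennreal (2 ^ DIM('a))" by (rule ennreal_leI)
    then have 2: "pow_int p (\<lambda>x. f (c *\<^sub>R x + a) - h (c *\<^sub>R x + a)) \<le> ennreal (2 ^ DIM('a)) * ennreal \<epsilon>"
      using pow_int_affine[of "\<lambda>x. f x - h x" c p a] c2 fh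
      by (auto intro!: mult_mono)
    have 3: "pow_int p (\<lambda>x. h x - f x) \<le> ennreal \<epsilon>"
      using fh by (subst pow_int_minus_commute) simp
    have "pow_int p (\<lambda>x. f (c *\<^sub>R x + a) - f x) =
       pow_int p (\<lambda>x. ((f (c *\<^sub>R x + a) - h (c *\<^sub>R x + a)) + (h x - f x)) + (h (c *\<^sub>R x + a) - h x))"
      by simp
    also have "\<dots> \<le> ennreal K * (pow_int p (\<lambda>x. (f (c *\<^sub>R x + a) - h (c *\<^sub>R x + a)) + (h x - f x)) + pow_int p (\<lambda>x. h (c *\<^sub>R x + a) - h x))"
      unfolding K_def by (intro pow_int_add) (use p in auto)
    also have "\<dots> \<le> ennreal K * (ennreal K * (pow_int p (\<lambda>x. f (c *\<^sub>R x + a) - h (c *\<^sub>R x + a)) + pow_int p (\<lambda>x. h x - f x)) + pow_int p (\<lambda>x. h (c *\<^sub>R x + a) - h x))"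
      unfolding K_def by (intro mult_left_mono add_right_mono pow_int_add) (use p in auto)
    also have "\<dots> \<le> ennreal K * (ennreal K * (ennreal (2 ^ DIM('a)) * ennreal \<epsilon> + ennreal \<epsilon>) + ennreal \<epsilon>)"
      by (intro mult_left_mono add_mono 1 2 3) auto
    also have "\<dots> = ennreal (K * (K * (2 ^ DIM('a) * \<epsilon> + \<epsilon>) + \<epsilon>))"
      using K \<epsilon> by (simp add: ennreal_plus[symmetric] ennreal_mult[symmetric] del: ennreal_plus)
    also have "K * (K * (2 ^ DIM('a) * \<epsilon> + \<epsilon>) + \<epsilon>) = K * (K * (2 ^ DIM('a) + 1) + 1) * \<epsilon>"
      by (simp add: algebra_simps)
    also have "\<dots> = e" unfolding \<epsilon>_def using den by (metis less_irrefl nonzero_mult_div_cancel_left times_divide_eq_right)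
    finally show ?thesis .
  qed
  then show ?thesis using that d by blast
qed

section \<open>Convolution and weak gradients\<close>

text \<open>The Borel counterpart of \<open>Lp_loc 1\<close>. Balls about 0 suffice, as every
  compact set lies in one; Borel measurability, unlike Lebesgue measurability, is stable under
  composition.\<close>

definition loc_int :: "('a::euclidean_space \<Rightarrow> 'b::euclidean_space) \<Rightarrow> bool" where
  "loc_int f \<longleftrightarrow> f \<in> borel_measurable borel \<and> (\<forall>R. integrable lborel (\<lambda>x. indicator (cball 0 R) x *\<^sub>R f x))"

lemma loc_int_measurable: "loc_int f \<Longrightarrow> f \<in> borel_measurable borel"
  by (simp add: loc_int_def)

lemma integrable_indicator_cball [simp]: "integrable lborel (\<lambda>x::'a::euclidean_space. indicator (cball a R) x :: real)"
  using emeasure_lborel_cball_finite[of a R] by (simp add: integrable_indicator_iff less_top)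

lemma le_one_plus_powr:
  fixes t p :: real
  assumes "0 \<le> t" "1 \<le> p"
  shows "t \<le> 1 + t powr p"
proof (cases "t \<le> 1")
  case False
  then have "t powr 1 \<le> t powr p" using assms by (intro powr_mono) auto
  then show ?thesis using False by simp
qed (use powr_ge_zero[of t p] in linarith)

lemma loc_intI:
  fixes f :: "'a::euclidean_space \<Rightarrow> 'b::euclidean_space"
  assumes [measurable]: "f \<in> borel_measurable borel" and "1 \<le> p" "pow_int p f < \<infinity>"
  shows "loc_int f"
  unfolding loc_int_def
proof (intro conjI allI)
  fix R
  have [measurable]: "(\<lambda>x. indicator (cball 0 R) x *\<^sub>R f x) \<in> borel_measurable lborel"
    by (intro borel_measurable_scaleR borel_measurable_indicator) auto
  show "integrable lborel (\<lambda>x. indicator (cball 0 R) x *\<^sub>R f x)"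
  proof (rule Bochner_Integration.integrable_bound)
    show "integrable lborel (\<lambda>x. indicator (cball 0 R) x + norm (f x) powr p)"
      using assms(3) pow_int_finite_iff[OF assms(1), of p] by (intro Bochner_Integration.integrable_add) auto
    show "AE x in lborel. norm (indicator (cball 0 R) x *\<^sub>R f x) \<le> norm (indicator (cball 0 R) x + norm (f x) powr p)"
      using le_one_plus_powr[OF _ assms(2)] by (auto simp: indicator_def)
  qed measurable
qed (use assms in auto)

lemma loc_int_mult_integrable:
  fixes f :: "'a::euclidean_space \<Rightarrow> 'b::euclidean_space" and \<eta> :: "'a \<Rightarrow> real"
  assumes f: "loc_int f" and [measurable]: "\<eta> \<in> borel_measurable borel"
    and b: "\<And>x. \<bar>\<eta> x\<bar> \<le> B" "\<And>x. norm x > R \<Longrightarrow> \<eta> x = 0"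
  shows "integrable lborel (\<lambda>x. \<eta> x *\<^sub>R f x)"
proof (rule Bochner_Integration.integrable_bound)
  show "integrable lborel (\<lambda>x. B *\<^sub>R (indicator (cball 0 R) x *\<^sub>R f x))"
    using f unfolding loc_int_def by (intro integrable_scaleR_right) auto
  have [measurable]: "f \<in> borel_measurable borel" using f by (rule loc_int_measurable)
  show "(\<lambda>x. \<eta> x *\<^sub>R f x) \<in> borel_measurable lborel" by measurable
  have "norm (\<eta> x *\<^sub>R f x) \<le> norm (B *\<^sub>R (indicator (cball 0 R) x *\<^sub>R f x))" for x
    using b(1)[of x] b(2)[of x] by (cases "norm x > R") (auto intro!: mult_right_mono)
  then show "AE x in lborel. norm (\<eta> x *\<^sub>R f x) \<le> norm (B *\<^sub>R (indicator (cball 0 R) x *\<^sub>R f x))" by simp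
qed

section \<open>Convolution with test functions\<close>

definition conv :: "('a::euclidean_space \<Rightarrow> real) \<Rightarrow> ('a \<Rightarrow> 'b::euclidean_space) \<Rightarrow> 'a \<Rightarrow> 'b" where
  "conv \<eta> f x = (\<integral>y. \<eta> (x - y) *\<^sub>R f y \<partial>lborel)"

lemma conv_integrable:
  fixes f :: "'a::euclidean_space \<Rightarrow> 'b::euclidean_space" and \<eta> :: "'a \<Rightarrow> real"
  assumes f: "loc_int f" and \<eta>: "continuous_on UNIV \<eta>" "\<And>x. norm x > R \<Longrightarrow> \<eta> x = 0"
  shows "integrable lborel (\<lambda>y. \<eta> (x - y) *\<^sub>R f y)"
proof -
  obtain B where "\<And>x. norm (\<eta> x) \<le> B" using continuous_compact_support_bounded[OF \<eta>] by metis
  moreover have "(\<lambda>y. \<eta> (x - y)) \<in> borel_measurable borel"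
    by (intro borel_measurable_continuous_onI continuous_on_compose2[OF \<eta>(1)] continuous_intros) auto
  moreover have "\<eta> (x - y) = 0" if "norm y > R + norm x" for y
    using that norm_triangle_ineq2[of y x] by (intro \<eta>(2)) (simp add: norm_minus_commute)
  ultimately show ?thesis
    by (intro loc_int_mult_integrable[OF f]) auto
qed

lemma conv_grad_integrable:
  fixes f :: "'a::euclidean_space \<Rightarrow> real"
  assumes f: "loc_int f" and \<eta>: "\<eta> \<in> test_functions"
  shows "integrable lborel (\<lambda>y. f y *\<^sub>R grad \<eta> (x - y))"
proof -
  obtain R where R: "\<And>x. norm x > R \<Longrightarrow> grad \<eta> x = 0"
    using test_functions_obtain[OF \<eta>] by metis
  have "integrable lborel (\<lambda>y. (grad \<eta> (x - y) \<bullet> b) *\<^sub>R f y)" if "b \<in> Basis" for b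
    by (rule conv_integrable[OF f, where R=R])
       (auto intro!: continuous_intros smooth_grad_continuous test_functions_smooth \<eta> simp: R)
  then have "integrable lborel (\<lambda>y. \<Sum>b\<in>Basis. ((grad \<eta> (x - y) \<bullet> b) *\<^sub>R f y) *\<^sub>R b)"
    by (intro Bochner_Integration.integrable_sum integrable_scaleR_left)
  also have "(\<lambda>y. \<Sum>b\<in>Basis. ((grad \<eta> (x - y) \<bullet> b) *\<^sub>R f y) *\<^sub>R b) = (\<lambda>y. f y *\<^sub>R grad \<eta> (x - y))"
  proof
    fix y
    have "(\<Sum>b\<in>Basis. ((grad \<eta> (x - y) \<bullet> b) *\<^sub>R f y) *\<^sub>R b) = f y *\<^sub>R (\<Sum>b\<in>Basis. (grad \<eta> (x - y) \<bullet> b) *\<^sub>R b)"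
      by (simp add: scaleR_sum_right mult.commute)
    then show "(\<Sum>b\<in>Basis. ((grad \<eta> (x - y) \<bullet> b) *\<^sub>R f y) *\<^sub>R b) = f y *\<^sub>R grad \<eta> (x - y)"
      by (simp add: euclidean_representation)
  qed
  finally show ?thesis .
  qed

text \<open>Differentiation under the integral. For increments \<open>h\<close> of norm below 1 all
  integrands live on the ball of radius \<open>R + 1 + norm x\<close>; with \<open>m\<close> the
  mass of \<open>f\<close> there, a uniform remainder \<open>e / (m + 1) * norm h\<close> of
  \<open>\<eta>\<close> integrates to at most \<open>e * norm h\<close>.\<close>

lemma conv_has_derivative:
  fixes f :: "'a::euclidean_space \<Rightarrow> real"
  assumes f: "loc_int f" and \<eta>: "\<eta> \<in> test_functions"
  shows "(conv \<eta> f has_derivative (\<lambda>h. (\<integral>y. f y *\<^sub>R grad \<eta> (x - y) \<partial>lborel) \<bullet> h)) (at x)"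
  unfolding has_derivative_at_alt
proof (intro conjI allI impI)
  show "bounded_linear (\<lambda>h. (\<integral>y. f y *\<^sub>R grad \<eta> (x - y) \<partial>lborel) \<bullet> h)" by (rule bounded_linear_inner_right)
  fix e :: real assume e: "e > 0"
  obtain R where R: "R > 0" "\<And>x. norm x > R \<Longrightarrow> \<eta> x = 0" "\<And>x. norm x > R \<Longrightarrow> grad \<eta> x = 0"
    using test_functions_obtain[OF \<eta>] by metis
  have [measurable]: "f \<in> borel_measurable borel" using f by (rule loc_int_measurable)
  note sm = test_functions_smooth[OF \<eta>]
  define m where "m = (\<integral>y. norm (indicator (cball 0 (R + 1 + norm x)) y *\<^sub>R f y) \<partial>lborel)"
  have m: "m \<ge> 0" by (simp add: m_def)
  have iG: "integrable lborel (\<lambda>y. f y *\<^sub>R grad \<eta> (x - y))" by (rule conv_grad_integrable[OF f \<eta>])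
  have \<epsilon>: "e / (m + 1) > 0" using e m by simp
  obtain d where d: "d > 0" "\<And>x h. norm h < d \<Longrightarrow> \<bar>\<eta> (x + h) - \<eta> x - grad \<eta> x \<bullet> h\<bar> \<le> e / (m + 1) * norm h"
    using uniform_differentiability[of \<eta> "grad \<eta>" R, OF smooth_has_derivative[OF sm] smooth_grad_continuous[OF sm] R(3) \<epsilon>] by metis
  show "\<exists>d>0. \<forall>z. norm (z - x) < d \<longrightarrow> norm (conv \<eta> f z - conv \<eta> f x - (\<integral>y. f y *\<^sub>R grad \<eta> (x - y) \<partial>lborel) \<bullet> (z - x)) \<le> e * norm (z - x)"
  proof (intro exI[of _ "min d 1"] conjI allI impI)
    fix z assume z: "norm (z - x) < min d 1"
    define h where "h = z - x"
    have int: "integrable lborel (\<lambda>y. \<eta> (t - y) *\<^sub>R f y)" for t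
      using conv_integrable[OF f smooth_continuous[OF sm] R(2)] .
    have "conv \<eta> f z - conv \<eta> f x - (\<integral>y. f y *\<^sub>R grad \<eta> (x - y) \<partial>lborel) \<bullet> (z - x)
      = (\<integral>y. (\<eta> (z - y) *\<^sub>R f y - \<eta> (x - y) *\<^sub>R f y) - (f y *\<^sub>R grad \<eta> (x - y)) \<bullet> h \<partial>lborel)"
    proof -
      have "(\<integral>y. f y *\<^sub>R grad \<eta> (x - y) \<partial>lborel) \<bullet> h = (\<integral>y. (f y *\<^sub>R grad \<eta> (x - y)) \<bullet> h \<partial>lborel)"
        by (rule integral_inner_left[symmetric]) (rule iG)
      then show ?thesis
        unfolding conv_def h_def[symmetric]
        using int Bochner_Integration.integral_diff[OF Bochner_Integration.integrable_diff[OF int int] integrable_inner_left[OF iG]]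
        by simp
    qed
    also have "norm \<dots> \<le> (\<integral>y. e / (m + 1) * norm h * norm (indicator (cball 0 (R + 1 + norm x)) y *\<^sub>R f y) \<partial>lborel)"
    proof (rule Bochner_Integration.integral_norm_bound_integral)
      show "integrable lborel (\<lambda>y. (\<eta> (z - y) *\<^sub>R f y - \<eta> (x - y) *\<^sub>R f y) - (f y *\<^sub>R grad \<eta> (x - y)) \<bullet> h)"
        using int iG by (intro Bochner_Integration.integrable_diff integrable_inner_left)
      show "integrable lborel (\<lambda>y. e / (m + 1) * norm h * norm (indicator (cball 0 (R + 1 + norm x)) y *\<^sub>R f y))"
        using f unfolding loc_int_def by (intro integrable_mult_right integrable_norm) auto
      fix y
      have eq: "\<eta> (z - y) *\<^sub>R f y - \<eta> (x - y) *\<^sub>R f y - (f y *\<^sub>R grad \<eta> (x - y)) \<bullet> h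
          = (\<eta> ((x - y) + h) - \<eta> (x - y) - grad \<eta> (x - y) \<bullet> h) * f y"
        by (simp add: h_def algebra_simps)
      show "norm (\<eta> (z - y) *\<^sub>R f y - \<eta> (x - y) *\<^sub>R f y - (f y *\<^sub>R grad \<eta> (x - y)) \<bullet> h)
        \<le> e / (m + 1) * norm h * norm (indicator (cball 0 (R + 1 + norm x)) y *\<^sub>R f y)"
      proof (cases "norm y > R + 1 + norm x")
        case True
        have "norm (x - y) > R" using True norm_triangle_ineq2[of y x] by (simp add: norm_minus_commute)
        moreover have "norm (z - y) > R"
          using True z norm_triangle_ineq2[of y z] norm_triangle_ineq2[of z x] by (simp add: norm_minus_commute)
        ultimately show ?thesis using R e m by simp
      next
        case False
        then show ?thesis
          using mult_right_mono[OF d(2)[of h "x - y"], of "\<bar>f y\<bar>"] z unfolding eq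
          by (simp add: abs_mult h_def)
      qed
    qed
    also have "\<dots> = e / (m + 1) * norm h * m" by (simp add: m_def)
    also have "\<dots> \<le> e * norm h" using e m by (simp add: field_simps mult_left_mono)
    finally show "norm (conv \<eta> f z - conv \<eta> f x - (\<integral>y. f y *\<^sub>R grad \<eta> (x - y) \<partial>lborel) \<bullet> (z - x)) \<le> e * norm (z - x)"
      by (simp add: h_def)
  qed (use d in auto)
qed

lemma conv_partial_deriv:
  fixes f :: "'a::euclidean_space \<Rightarrow> real"
  assumes f: "loc_int f" and \<eta>: "\<eta> \<in> test_functions" and b: "b \<in> Basis"
  shows "partial_deriv b (conv \<eta> f) x = conv (\<lambda>x. partial_deriv b \<eta> x) f x"
proof -
  obtain R where R: "R > 0" "\<And>x. norm x > R \<Longrightarrow> \<eta> x = 0" "\<And>x. norm x > R \<Longrightarrow> grad \<eta> x = 0"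
    using test_functions_obtain[OF \<eta>] by metis
  note sm = test_functions_smooth[OF \<eta>]
  have iG: "integrable lborel (\<lambda>y. f y *\<^sub>R grad \<eta> (x - y))" by (rule conv_grad_integrable[OF f \<eta>])
  have "partial_deriv b (conv \<eta> f) x = (\<integral>y. f y *\<^sub>R grad \<eta> (x - y) \<partial>lborel) \<bullet> b"
    by (rule grad_eqI(2)[OF conv_has_derivative[OF f \<eta>] b])
  also have "\<dots> = (\<integral>y. f y * (grad \<eta> (x - y) \<bullet> b) \<partial>lborel)"
    using iG by (subst integral_inner_left[symmetric]) auto
  finally show ?thesis using b by (simp add: conv_def grad_inner_Basis mult.commute)
qed

text \<open>Derivatives of a convolution fall on the kernel, so the convolutions of \<open>f\<close>
  with all test functions form a class closed under partial derivatives.\<close>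

lemma conv_smooth:
  fixes f :: "'a::euclidean_space \<Rightarrow> real"
  assumes f: "loc_int f" and \<eta>: "\<eta> \<in> test_functions"
  shows "smooth (conv \<eta> f)"
proof (rule smooth_coinduct[of _ "(\<lambda>\<eta>. conv \<eta> f) ` test_functions"])
  show "conv \<eta> f \<in> (\<lambda>\<eta>. conv \<eta> f) ` test_functions" using \<eta> by auto
next
  fix v :: "'a \<Rightarrow> real" and x assume "v \<in> (\<lambda>\<eta>. conv \<eta> f) ` test_functions"
  then show "v differentiable (at x)"
    using conv_has_derivative[OF f] unfolding differentiable_def by blast
next
  fix v :: "'a \<Rightarrow> real" and b :: 'a assume "v \<in> (\<lambda>\<eta>. conv \<eta> f) ` test_functions" and b: "b \<in> Basis"
  then obtain \<eta> where \<eta>: "v = conv \<eta> f" "\<eta> \<in> test_functions" by blast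
  then have "(\<lambda>x. partial_deriv b v x) = conv (\<lambda>x. partial_deriv b \<eta> x) f"
    using conv_partial_deriv[OF f \<eta>(2) b] by auto
  then show "(\<lambda>x. partial_deriv b v x) \<in> (\<lambda>\<eta>. conv \<eta> f) ` test_functions"
    using test_functions_partial[OF \<eta>(2) b] by auto
qed

definition weak_gradient :: "('a::euclidean_space \<Rightarrow> real) \<Rightarrow> ('a \<Rightarrow> 'a) \<Rightarrow> bool" where
  "weak_gradient u g \<longleftrightarrow> loc_int u \<and> loc_int g \<and>
     (\<forall>v\<in>test_functions. \<forall>b\<in>Basis.
        (\<integral>x. u x * partial_deriv b v x \<partial>lborel) = - (\<integral>x. (g x \<bullet> b) * v x \<partial>lborel))"

lemma conv_inner:
  fixes g :: "'a::euclidean_space \<Rightarrow> 'b::euclidean_space"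
  assumes g: "loc_int g" and \<eta>: "\<eta> \<in> test_functions"
  shows "conv \<eta> g x \<bullet> b = (\<integral>y. \<eta> (x - y) * (g y \<bullet> b) \<partial>lborel)"
proof -
  obtain R where R: "\<And>x. norm x > R \<Longrightarrow> \<eta> x = 0"
    using test_functions_obtain[OF \<eta>] by metis
  show ?thesis unfolding conv_def
    using conv_integrable[OF g smooth_continuous[OF test_functions_smooth[OF \<eta>]] R, where x=x]
    by (subst integral_inner_left[symmetric]) auto
qed

text \<open>The definition of the weak gradient is tested with
  \<open>y \<mapsto> \<eta> (x - y)\<close>; the reflection produces a second minus sign, which
  cancels the one from integration by parts.\<close>

lemma weak_gradient_conv:
  assumes ug: "weak_gradient u g" and \<eta>: "\<eta> \<in> test_functions"
  shows "grad (conv \<eta> u) x = conv \<eta> g x"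
proof (rule euclidean_eqI)
  fix b :: 'a assume b: "b \<in> Basis"
  have u: "loc_int u" and g: "loc_int g" using ug by (auto simp: weak_gradient_def)
  define v where "v y = \<eta> ((-1) *\<^sub>R y + x)" for y
  have v: "v \<in> test_functions" unfolding v_def by (intro test_functions_affine \<eta>) auto
  have gv: "partial_deriv b v y = - partial_deriv b \<eta> (x - y)" for y
    using grad_affine[OF test_functions_smooth[OF \<eta>], of "-1" x y] b
    by (simp add: v_def[abs_def] flip: grad_inner_Basis)
  have "grad (conv \<eta> u) x \<bullet> b = (\<integral>y. partial_deriv b \<eta> (x - y) * u y \<partial>lborel)"
    using conv_partial_deriv[OF u \<eta> b] b by (simp add: grad_inner_Basis conv_def)
  also have "\<dots> = - (\<integral>y. u y * partial_deriv b v y \<partial>lborel)"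
    by (simp add: gv mult.commute)
  also have "\<dots> = (\<integral>y. (g y \<bullet> b) * v y \<partial>lborel)"
    using ug v b by (simp add: weak_gradient_def)
  also have "\<dots> = conv \<eta> g x \<bullet> b"
    using conv_inner[OF g \<eta>] by (simp add: v_def mult.commute)
  finally show "grad (conv \<eta> u) x \<bullet> b = conv \<eta> g x \<bullet> b" .
qed

section \<open>Mollifiers and smooth approximation in \<open>L^p\<close>\<close>

definition is_mollifier :: "real \<Rightarrow> ('a::euclidean_space \<Rightarrow> real) \<Rightarrow> bool" where
  "is_mollifier r \<eta> \<longleftrightarrow> \<eta> \<in> test_functions \<and> (\<forall>x. 0 \<le> \<eta> x) \<and> (\<forall>x. norm x \<ge> r \<longrightarrow> \<eta> x = 0) \<and>
     integrable lborel \<eta> \<and> (\<integral>x. \<eta> x \<partial>lborel) = 1"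

lemma test_function_integrable:
  assumes "v \<in> test_functions" shows "integrable lborel v"
proof -
  obtain R where R: "\<And>x. norm x > R \<Longrightarrow> v x = 0"
    using test_functions_obtain[OF assms] by metis
  have c: "continuous_on UNIV v" by (rule smooth_continuous[OF test_functions_smooth[OF assms]])
  obtain B where B: "\<And>x. norm (v x) \<le> B" using continuous_compact_support_bounded[OF c R] by metis
  have [measurable]: "v \<in> borel_measurable borel" using c by (rule borel_measurable_continuous_onI)
  have "loc_int (\<lambda>x::'a. 1::real)" by (simp add: loc_int_def)
  have "integrable lborel (\<lambda>x. v x *\<^sub>R (1::real))"
    by (rule loc_int_mult_integrable[OF \<open>loc_int (\<lambda>x. 1)\<close> _ _ R, where B=B]) (use B in auto)
  then show ?thesis by simp
qed

lemma mollifier_exists: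
  assumes "0 < r"
  shows "\<exists>\<eta>::'a::euclidean_space \<Rightarrow> real. is_mollifier r \<eta>"
proof -
  define I where "I = (\<integral>x. bump x \<partial>(lborel :: 'a measure))"
  have int: "integrable lborel (bump :: 'a \<Rightarrow> real)" by (rule test_function_integrable[OF bump_test])
  have [measurable]: "(bump :: 'a \<Rightarrow> real) \<in> borel_measurable borel"
    using int by auto
  have "I > 0"
  proof -
    have "I \<noteq> 0"
    proof
      assume "I = 0"
      then have ae: "AE x::'a in lborel. bump x = 0"
        using int by (subst (asm) I_def, subst (asm) integral_nonneg_eq_0_iff_AE) (auto simp: bump_nonneg)
      have "bump x > 0" if "norm x < 1" for x :: 'a
        using that power_strict_mono[of "norm x" 1 2] by (auto simp: bump_def flat_def power2_norm_eq_inner)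
      then have "x \<notin> ball 0 1" if "bump x = 0" for x :: 'a using that by (metis mem_ball_0 less_irrefl)
      with ae have "AE x::'a in lborel. x \<notin> ball 0 1" by (auto elim!: eventually_mono)
      then have "emeasure lborel (ball (0::'a) 1) = 0"
        by (subst (asm) AE_iff_measurable[of "ball 0 1"]) auto
      then show False using content_ball_pos[of 1 "0::'a"] by (simp add: measure_def)
    qed
    moreover have "I \<ge> 0" unfolding I_def by (intro integral_nonneg_AE) (auto simp: bump_nonneg)
    ultimately show ?thesis by simp
  qed
  define C where "C = 1 / (I * r ^ DIM('a))"
  define \<eta> where "\<eta> x = C * bump ((1 / r) *\<^sub>R x + 0)" for x :: 'a
  have C: "C > 0" using \<open>I > 0\<close> assms by (simp add: C_def)
  have t: "(\<lambda>x. bump ((1 / r) *\<^sub>R x + (0::'a))) \<in> test_functions"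
    using assms by (intro test_functions_affine bump_test) auto
  have t': "\<eta> \<in> test_functions"
    using test_functions_mult[OF t smooth_const[of C]] by (simp add: \<eta>_def[abs_def] mult.commute)
  have "(\<integral>x. \<eta> x \<partial>lborel) = C * (\<integral>x. bump ((1 / r) *\<^sub>R x + (0::'a)) \<partial>lborel)"
    by (simp add: \<eta>_def)
  also have "(\<integral>x. bump ((1 / r) *\<^sub>R x + (0::'a)) \<partial>lborel) = r ^ DIM('a) * I"
    using assms by (subst lborel_integral_affine) (auto simp: I_def power_one_over)
  finally have "(\<integral>x. \<eta> x \<partial>lborel) = 1" using \<open>I > 0\<close> assms by (simp add: C_def)
  moreover have "\<eta> x = 0" if "norm x \<ge> r" for x
    using that assms by (auto simp: \<eta>_def intro!: bump_eq_0)
  ultimately have "is_mollifier r \<eta>"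
    using t' test_function_integrable[OF t'] C by (auto simp: is_mollifier_def \<eta>_def bump_nonneg)
  then show ?thesis by blast
qed

lemma conv_alt:
  fixes f :: "'a::euclidean_space \<Rightarrow> 'b::euclidean_space" and \<eta> :: "'a \<Rightarrow> real"
  assumes f: "loc_int f" and \<eta>: "\<eta> \<in> test_functions"
  shows "conv \<eta> f x = (\<integral>y. \<eta> y *\<^sub>R f (x - y) \<partial>lborel)"
    and "integrable lborel (\<lambda>y. \<eta> y *\<^sub>R f (x - y))"
proof -
  have [measurable]: "f \<in> borel_measurable borel" using f by (rule loc_int_measurable)
  have [measurable]: "\<eta> \<in> borel_measurable borel"
    by (intro borel_measurable_continuous_onI smooth_continuous test_functions_smooth \<eta>)
  have m: "(\<lambda>y. \<eta> (x - y) *\<^sub>R f y) \<in> borel_measurable borel" by measurable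
  obtain R where R: "\<And>x. norm x > R \<Longrightarrow> \<eta> x = 0"
    using test_functions_obtain[OF \<eta>] by metis
  have i: "integrable lborel (\<lambda>y. \<eta> (x - y) *\<^sub>R f y)"
    by (rule conv_integrable[OF f smooth_continuous[OF test_functions_smooth[OF \<eta>]] R])
  show "conv \<eta> f x = (\<integral>y. \<eta> y *\<^sub>R f (x - y) \<partial>lborel)"
    using lborel_integral_affine(1)[OF m, of "-1" x] by (simp add: conv_def)
  show "integrable lborel (\<lambda>y. \<eta> y *\<^sub>R f (x - y))"
    using lborel_integral_affine(2)[OF m _ i, of "-1" x] by simp
qed

lemma conv_measurable:
  fixes f :: "'a::euclidean_space \<Rightarrow> 'b::euclidean_space" and \<eta> :: "'a \<Rightarrow> real"
  assumes f: "loc_int f" and \<eta>: "\<eta> \<in> test_functions"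
  shows "conv \<eta> f \<in> borel_measurable borel"
proof -
  have [measurable]: "f \<in> borel_measurable borel" using f by (rule loc_int_measurable)
  have [measurable]: "\<eta> \<in> borel_measurable borel"
    by (intro borel_measurable_continuous_onI smooth_continuous test_functions_smooth \<eta>)
  have "(\<lambda>x. \<integral>y. \<eta> (x - y) *\<^sub>R f y \<partial>lborel) \<in> borel_measurable lborel"
    by (intro sigma_finite_measure.borel_measurable_lebesgue_integral sigma_finite_lborel) measurable
  then show ?thesis by (simp add: conv_def[abs_def])
qed

text \<open>\<open>conv \<eta> f x - f x\<close> is the average of \<open>f (x - y) - f x\<close>
  over the density \<open>\<eta>\<close>; Jensen and Tonelli bound it by the worst
  translation.\<close>

lemma pow_int_conv_diff:
  fixes f :: "'a::euclidean_space \<Rightarrow> 'b::euclidean_space" and \<eta> :: "'a \<Rightarrow> real"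
  assumes f: "loc_int f" and p: "1 \<le> p" and \<eta>: "is_mollifier r \<eta>"
    and C: "\<And>y. norm y < r \<Longrightarrow> pow_int p (\<lambda>x. f (x - y) - f x) \<le> C"
  shows "pow_int p (\<lambda>x. conv \<eta> f x - f x) \<le> C"
proof -
  have t: "\<eta> \<in> test_functions" and \<eta>1: "(\<integral>x. \<eta> x \<partial>lborel) = 1" "\<And>x. 0 \<le> \<eta> x" "\<And>x. norm x \<ge> r \<Longrightarrow> \<eta> x = 0"
    and i\<eta>: "integrable lborel \<eta>"
    using \<eta> by (auto simp: is_mollifier_def)
  have [measurable]: "f \<in> borel_measurable borel" using f by (rule loc_int_measurable)
  have [measurable]: "\<eta> \<in> borel_measurable borel"
    by (intro borel_measurable_continuous_onI smooth_continuous test_functions_smooth t)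
  have eq: "conv \<eta> f x - f x = (\<integral>y. \<eta> y *\<^sub>R (f (x - y) - f x) \<partial>lborel)" for x
    using conv_alt[OF f t, of x] i\<eta> \<eta>1(1) by (simp add: scaleR_diff_right)
  have "pow_int p (\<lambda>x. conv \<eta> f x - f x) \<le>
      (\<integral>\<^sup>+x. \<integral>\<^sup>+y. ennreal (\<eta> y * norm (f (x - y) - f x) powr p) \<partial>lborel \<partial>lborel)"
    unfolding pow_int_def eq
    by (intro nn_integral_mono weighted_jensen) (use \<eta>1 i\<eta> p in auto)
  also have "\<dots> = (\<integral>\<^sup>+y. \<integral>\<^sup>+x. ennreal (\<eta> y * norm (f (x - y) - f x) powr p) \<partial>lborel \<partial>lborel)"
    by (rule lborel_pair.Fubini') measurable
  also have "\<dots> = (\<integral>\<^sup>+y. ennreal (\<eta> y) * pow_int p (\<lambda>x. f (x - y) - f x) \<partial>lborel)"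
    using \<eta>1 by (simp add: pow_int_def ennreal_mult nn_integral_cmult)
  also have "\<dots> \<le> (\<integral>\<^sup>+y. ennreal (\<eta> y) * C \<partial>lborel)"
  proof (rule nn_integral_mono)
    fix y show "ennreal (\<eta> y) * pow_int p (\<lambda>x. f (x - y) - f x) \<le> ennreal (\<eta> y) * C"
      using C[of y] \<eta>1(3)[of y] by (cases "norm y < r") (auto intro: mult_left_mono)
  qed
  also have "\<dots> = C"
    using i\<eta> \<eta>1 by (simp add: nn_integral_multc nn_integral_eq_integral)
  finally show ?thesis .
qed

lemma pow_int_conv_mollifier:
  fixes f :: "'a::euclidean_space \<Rightarrow> 'b::euclidean_space"
  assumes f [measurable]: "f \<in> borel_measurable borel" and p: "1 \<le> p" and fin: "pow_int p f < \<infinity>"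
    and \<eta>: "\<And>n. is_mollifier (1 / real (Suc n)) (\<eta> n)"
  shows "(\<lambda>n. pow_int p (\<lambda>x. conv (\<eta> n) f x - f x)) \<longlonglongrightarrow> 0"
proof (rule ennreal_tendsto_0I)
  fix e :: real assume "0 < e"
  from pow_int_affine_continuous[OF f p fin this] obtain d where
    d: "0 < d" "\<And>a c. norm a < d \<Longrightarrow> \<bar>c - 1\<bar> < d \<Longrightarrow> pow_int p (\<lambda>x. f (c *\<^sub>R x + a) - f x) \<le> ennreal e" by metis
  have "eventually (\<lambda>n. 1 / real (Suc n) < d) sequentially"
    using order_tendstoD(2)[OF LIMSEQ_inverse_real_of_nat d(1)] by (simp add: inverse_eq_divide)
  then show "eventually (\<lambda>n. pow_int p (\<lambda>x. conv (\<eta> n) f x - f x) \<le> ennreal e) sequentially"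
  proof eventually_elim
    case (elim n)
    show ?case
    proof (rule pow_int_conv_diff[OF loc_intI[OF f p fin] p \<eta>])
      fix y :: 'a assume "norm y < 1 / real (Suc n)"
      then show "pow_int p (\<lambda>x. f (x - y) - f x) \<le> ennreal e"
        using d(1) d(2)[of "- y" 1] elim by simp
    qed
  qed
qed

lemma pow_int_AE_subseq:
  fixes f :: "nat \<Rightarrow> 'a::euclidean_space \<Rightarrow> 'b::euclidean_space"
  assumes [measurable]: "\<And>n. f n \<in> borel_measurable borel" and p: "1 \<le> p"
    and lim: "(\<lambda>n. pow_int p (f n)) \<longlonglongrightarrow> 0"
  obtains r :: "nat \<Rightarrow> nat" where "strict_mono r" "AE x in lborel. (\<lambda>n. f (r n) x) \<longlonglongrightarrow> 0"
proof -
  have "eventually (\<lambda>n. pow_int p (f n) < \<infinity>) sequentially" using order_tendstoD(2)[OF lim, of \<infinity>] by simp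
  \<comment> \<open>Finitely many terms may be infinite; dropping them makes the real-valued
    \<open>L^1\<close> subsequence theorem applicable to the p-th powers.\<close>
  then obtain n0 where n0: "\<And>n. n \<ge> n0 \<Longrightarrow> pow_int p (f n) < \<infinity>" by (auto simp: eventually_sequentially)
  have i: "integrable lborel (\<lambda>x. norm (f (n + n0) x) powr p)" for n
    using n0[of "n + n0"] by (subst pow_int_finite_iff[symmetric]) auto
  have "(\<lambda>n. pow_int p (f (n + n0))) \<longlonglongrightarrow> 0" using LIMSEQ_ignore_initial_segment[OF lim] .
  then have "(\<lambda>n. enn2real (ennreal (\<integral>x. norm (f (n + n0) x) powr p \<partial>lborel))) \<longlonglongrightarrow> enn2real 0"
    using i by (intro tendsto_enn2real) (auto simp: pow_int_eq_integral)
  then have "(\<lambda>n. \<integral>x. norm (norm (f (n + n0) x) powr p) \<partial>lborel) \<longlonglongrightarrow> 0"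
    by simp
  from tendsto_L1_AE_subseq[OF i this] obtain r where r: "strict_mono r"
    "AE x in lborel. (\<lambda>n. norm (f (r n + n0) x) powr p) \<longlonglongrightarrow> 0" by blast
  have "AE x in lborel. (\<lambda>n. f (r n + n0) x) \<longlonglongrightarrow> 0"
    using r(2)
  proof eventually_elim
    case (elim x)
    from tendsto_powr'[OF elim tendsto_const, of "1 / p"] p
    have "(\<lambda>n. norm (f (r n + n0) x)) \<longlonglongrightarrow> 0" by (simp add: powr_powr)
    then show ?case by (rule tendsto_norm_zero_cancel)
  qed
  moreover have "strict_mono (\<lambda>n. r n + n0)" using r(1) by (auto simp: strict_mono_def)
  ultimately show ?thesis by (intro that)
qed

text \<open>Of \<open>w n\<close> itself only convergence almost everywhere is recorded, because the
  limits below combine it with uniform bounds or Fatou's lemma. The gradients converge in both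
  senses: the \<open>L^p\<close> limit serves the duality with the flux, the pointwise one Fatou's
  lemma.\<close>

definition smooth_approx :: "real \<Rightarrow> (nat \<Rightarrow> 'a::euclidean_space \<Rightarrow> real) \<Rightarrow> ('a \<Rightarrow> real) \<Rightarrow> ('a \<Rightarrow> 'a) \<Rightarrow> bool" where
  "smooth_approx p w u g \<longleftrightarrow> (\<forall>n. smooth (w n)) \<and> (AE x in lborel. (\<lambda>n. w n x) \<longlonglongrightarrow> u x) \<and>
     (AE x in lborel. (\<lambda>n. grad (w n) x) \<longlonglongrightarrow> g x) \<and>
     (\<lambda>n. pow_int p (\<lambda>x. grad (w n) x - g x)) \<longlonglongrightarrow> 0"

lemma smooth_measurable: "smooth v \<Longrightarrow> v \<in> borel_measurable borel"
  and smooth_grad_measurable: "smooth v \<Longrightarrow> grad v \<in> borel_measurable borel"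
  by (intro borel_measurable_continuous_onI smooth_continuous smooth_grad_continuous; assumption)+

text \<open>Mollification, followed by two successive subsequences. A sup bound survives because the
  kernel is a probability density; this later keeps the approximants of a bounded solution
  bounded.\<close>

lemma weak_gradient_approx:
  fixes u :: "'a::euclidean_space \<Rightarrow> real"
  assumes ug: "weak_gradient u g" and p: "1 \<le> p"
    and fu: "pow_int p u < \<infinity>" and fg: "pow_int p g < \<infinity>"
  obtains w where "smooth_approx p w u g" "\<And>M. (\<forall>x. \<bar>u x\<bar> \<le> M) \<Longrightarrow> (\<forall>n x. \<bar>w n x\<bar> \<le> M)"
proof -
  have lu: "loc_int u" and lg: "loc_int g" using ug by (auto simp: weak_gradient_def)
  note [measurable] = loc_int_measurable[OF lu] loc_int_measurable[OF lg]
  have "\<forall>n. \<exists>\<eta>::'a \<Rightarrow> real. is_mollifier (1 / real (Suc n)) \<eta>" by (intro allI mollifier_exists) simp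
  then obtain \<eta> :: "nat \<Rightarrow> 'a \<Rightarrow> real" where \<eta>: "\<And>n. is_mollifier (1 / real (Suc n)) (\<eta> n)" by metis
  have t: "\<eta> n \<in> test_functions" for n using \<eta> by (auto simp: is_mollifier_def)
  have sm: "smooth (conv (\<eta> n) u)" for n by (rule conv_smooth[OF lu t])
  have [measurable]: "conv (\<eta> n) u \<in> borel_measurable borel" "conv (\<eta> n) g \<in> borel_measurable borel" for n
    by (intro conv_measurable lu lg t)+
  have lim1: "(\<lambda>n. pow_int p (\<lambda>x. conv (\<eta> n) u x - u x)) \<longlonglongrightarrow> 0"
    by (rule pow_int_conv_mollifier[OF _ p fu \<eta>]) simp
  have lim2: "(\<lambda>n. pow_int p (\<lambda>x. conv (\<eta> n) g x - g x)) \<longlonglongrightarrow> 0"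
    by (rule pow_int_conv_mollifier[OF _ p fg \<eta>]) simp
  obtain r where r: "strict_mono r" "AE x in lborel. (\<lambda>n. conv (\<eta> (r n)) u x - u x) \<longlonglongrightarrow> 0"
    using pow_int_AE_subseq[OF _ p lim1] by auto
  have lim3: "(\<lambda>n. pow_int p (\<lambda>x. conv (\<eta> (r n)) g x - g x)) \<longlonglongrightarrow> 0"
    using LIMSEQ_subseq_LIMSEQ[OF lim2 r(1)] by (simp add: o_def)
  obtain r' where r': "strict_mono r'" "AE x in lborel. (\<lambda>n. conv (\<eta> (r (r' n))) g x - g x) \<longlonglongrightarrow> 0"
    using pow_int_AE_subseq[OF _ p lim3] by auto
  have lim4: "(\<lambda>n. pow_int p (\<lambda>x. conv (\<eta> (r (r' n))) g x - g x)) \<longlonglongrightarrow> 0"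
    using LIMSEQ_subseq_LIMSEQ[OF lim3 r'(1)] by (simp add: o_def)
  define w where "w n = conv (\<eta> (r (r' n))) u" for n
  have gw: "grad (w n) x = conv (\<eta> (r (r' n))) g x" for n x
    unfolding w_def by (rule weak_gradient_conv[OF ug t])
  have "AE x in lborel. (\<lambda>n. w n x) \<longlonglongrightarrow> u x" using r(2)
  proof eventually_elim
    case (elim x)
    from LIMSEQ_subseq_LIMSEQ[OF elim r'(1)] show ?case
      by (simp add: o_def w_def LIM_zero_iff)
  qed
  moreover have "AE x in lborel. (\<lambda>n. grad (w n) x) \<longlonglongrightarrow> g x" using r'(2)
    by eventually_elim (simp add: gw LIM_zero_iff)
  ultimately have "smooth_approx p w u g"
    using sm lim4 unfolding smooth_approx_def by (simp only: gw) (simp add: w_def)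
  moreover have "\<forall>n x. \<bar>w n x\<bar> \<le> M" if M: "\<forall>x. \<bar>u x\<bar> \<le> M" for M
  proof (intro allI)
    fix n x
    let ?\<eta> = "\<eta> (r (r' n))"
    have \<eta>1: "integrable lborel ?\<eta>" "(\<integral>x. ?\<eta> x \<partial>lborel) = 1" "\<And>x. 0 \<le> ?\<eta> x"
      using \<eta>[of "r (r' n)"] by (auto simp: is_mollifier_def)
    have "norm (w n x) \<le> (\<integral>y. ?\<eta> y * M \<partial>lborel)"
      unfolding w_def conv_alt(1)[OF lu t]
      by (rule Bochner_Integration.integral_norm_bound_integral[OF conv_alt(2)[OF lu t]])
         (use \<eta>1 M in \<open>auto simp: abs_mult intro!: mult_left_mono\<close>)
    then show "\<bar>w n x\<bar> \<le> M" using \<eta>1 by simp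
  qed
  ultimately show ?thesis by (intro that)
qed

section \<open>Smooth approximation and difference quotients\<close>

lemma cball_sets_borel [measurable]: "cball (a::'a::euclidean_space) r \<in> sets borel"
  by simp

lemma AE_lborel_affine:
  fixes a :: "'a::euclidean_space"
  assumes "AE x in lborel. P x" "c \<noteq> 0"
  shows "AE x in lborel. P (c *\<^sub>R x + a)"
proof -
  obtain N where N: "{x. \<not> P x} \<subseteq> N" "N \<in> null_sets lborel"
    using assms(1) by (auto simp: eventually_ae_filter)
  have "(\<integral>\<^sup>+x. indicator N (c *\<^sub>R x + a) \<partial>lborel) = 0"
    using N assms(2) nn_integral_indicator[of N "lborel :: 'a measure"]
    by (subst nn_integral_lborel_affine) (auto simp: null_sets_def)
  then have "AE x in lborel. indicator N (c *\<^sub>R x + a) = (0::ennreal)"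
    using N by (subst (asm) nn_integral_0_iff_AE) auto
  then show ?thesis
    by eventually_elim (use N in \<open>auto simp: indicator_def split: if_splits\<close>)
qed

text \<open>The bound \<open>C n\<close> may vary with \<open>n\<close>, so that inequalities for
  smooth functions whose right sides contain the approximation error pass to the limit.\<close>

lemma pow_int_Fatou:
  fixes F :: "nat \<Rightarrow> 'a::euclidean_space \<Rightarrow> 'b::euclidean_space"
  assumes [measurable]: "\<And>n. F n \<in> borel_measurable borel" and p: "0 < p"
    and lim: "AE x in lborel. (\<lambda>n. F n x) \<longlonglongrightarrow> f x"
    and C: "\<And>n. pow_int p (F n) \<le> C n" "C \<longlonglongrightarrow> D"
  shows "pow_int p f \<le> D"
proof -
  have "pow_int p f = (\<integral>\<^sup>+x. liminf (\<lambda>n. ennreal (norm (F n x) powr p)) \<partial>lborel)"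
    unfolding pow_int_def
  proof (rule nn_integral_cong_AE)
    show "AE x in lborel. ennreal (norm (f x) powr p) = liminf (\<lambda>n. ennreal (norm (F n x) powr p))"
      using lim
    proof eventually_elim
      case (elim x)
      have "(\<lambda>n. ennreal (norm (F n x) powr p)) \<longlonglongrightarrow> ennreal (norm (f x) powr p)"
        using tendsto_powr'[OF tendsto_norm[OF elim] tendsto_const, of p] p by (intro tendsto_ennrealI) auto
      from lim_imp_Liminf[OF sequentially_bot this] show ?case by simp
    qed
  qed
  also have "\<dots> \<le> liminf (\<lambda>n. \<integral>\<^sup>+x. ennreal (norm (F n x) powr p) \<partial>lborel)"
    by (rule nn_integral_liminf) measurable
  also have "\<dots> \<le> liminf C"
    by (rule Liminf_mono) (use C(1) in \<open>auto simp: pow_int_def\<close>)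
  also have "\<dots> = D" using C(2) by (simp add: lim_imp_Liminf)
  finally show ?thesis .
qed

lemma pow_int_dominated_convergence:
  fixes F :: "nat \<Rightarrow> 'a::euclidean_space \<Rightarrow> 'b::euclidean_space" and G :: "'a \<Rightarrow> 'c::euclidean_space"
  assumes [measurable]: "\<And>n. F n \<in> borel_measurable borel" "G \<in> borel_measurable borel" and p: "0 < p"
    and lim: "AE x in lborel. (\<lambda>n. F n x) \<longlonglongrightarrow> 0"
    and le: "\<And>n x. norm (F n x) \<le> norm (G x)" and fin: "pow_int p G < \<infinity>"
  shows "(\<lambda>n. pow_int p (F n)) \<longlonglongrightarrow> 0"
proof -
  have "(\<lambda>n. \<integral>\<^sup>+x. ennreal (norm (F n x) powr p) \<partial>lborel) \<longlonglongrightarrow> (\<integral>\<^sup>+x. 0 \<partial>(lborel :: 'a measure))"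
  proof (rule nn_integral_dominated_convergence[where w = "\<lambda>x. ennreal (norm (G x) powr p)"])
    show "AE x in lborel. (\<lambda>n. ennreal (norm (F n x) powr p)) \<longlonglongrightarrow> 0"
      using lim
    proof eventually_elim
      case (elim x)
      have "(\<lambda>n. norm (F n x) powr p) \<longlonglongrightarrow> 0"
        using tendsto_powr'[OF tendsto_norm[OF elim] tendsto_const, of p] p by simp
      from tendsto_ennrealI[OF this] show ?case by simp
    qed
    show "AE x in lborel. ennreal (norm (F n x) powr p) \<le> ennreal (norm (G x) powr p)" for n
      using le p by (intro AE_I2 ennreal_leI powr_mono2) auto
  qed (use fin in \<open>auto simp: pow_int_def\<close>)
  then show ?thesis by (simp add: pow_int_def)
qed

lemma pow_int_tendsto_0_squeeze:
  assumes "\<And>n. pow_int p (F n) \<le> ennreal C * (A n + B n)" "A \<longlonglongrightarrow> 0" "B \<longlonglongrightarrow> 0"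
  shows "(\<lambda>n. pow_int p (F n)) \<longlonglongrightarrow> 0"
proof (rule tendsto_sandwich[OF _ _ tendsto_const])
  have "(\<lambda>n. ennreal C * (A n + B n)) \<longlonglongrightarrow> ennreal C * (0 + 0)"
    by (intro tendsto_add assms(2,3) ennreal_tendsto_cmult) auto
  then show "(\<lambda>n. ennreal C * (A n + B n)) \<longlonglongrightarrow> 0" by simp
qed (use assms(1) in auto)

text \<open>A substitute for Hoelder's inequality: the free parameter \<open>d\<close> makes the
  first term small, after which the second is controlled by convergence.\<close>

lemma young_powr:
  fixes a b p d :: real
  assumes "0 \<le> a" "0 \<le> b" "1 < p" "0 < d"
  shows "a * b \<le> d powr (p / (p - 1)) * a powr (p / (p - 1)) + (1 / d) powr p * b powr p"
proof -
  let ?q = "p / (p - 1)"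
  have q: "?q > 1" "1 / ?q + 1 / p = 1" using assms by (auto simp: field_simps)
  have "a * b = (d * a) * (b / d)" using assms by simp
  also have "\<dots> \<le> (d * a) powr ?q / ?q + (b / d) powr p / p"
    by (rule Youngs_inequality[OF q(1) assms(3) q(2)]) (use assms in auto)
  also have "\<dots> \<le> (d * a) powr ?q + (b / d) powr p"
  proof (rule add_mono)
    show "(d * a) powr ?q / ?q \<le> (d * a) powr ?q"
      using divide_left_mono[of 1 ?q "(d * a) powr ?q"] q by simp
    show "(b / d) powr p / p \<le> (b / d) powr p"
      using divide_left_mono[of 1 p "(b / d) powr p"] assms by simp
  qed
  also have "\<dots> = d powr ?q * a powr ?q + (1 / d) powr p * b powr p"
    using assms powr_mult[of "1 / d" b p] by (simp add: powr_mult)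
  finally show ?thesis .
qed

lemma pow_int_holder_integrable:
  fixes H F :: "'a::euclidean_space \<Rightarrow> 'b::euclidean_space"
  assumes [measurable]: "H \<in> borel_measurable borel" "F \<in> borel_measurable borel" and p: "1 < p"
    and "pow_int (p / (p - 1)) H < \<infinity>" "pow_int p F < \<infinity>"
  shows "integrable lborel (\<lambda>x. norm (H x) * norm (F x))" "integrable lborel (\<lambda>x. H x \<bullet> F x)"
proof -
  have i: "integrable lborel (\<lambda>x. norm (H x) powr (p / (p - 1)))" "integrable lborel (\<lambda>x. norm (F x) powr p)"
    using assms(4,5) pow_int_finite_iff[of H] pow_int_finite_iff[of F] by auto
  show *: "integrable lborel (\<lambda>x. norm (H x) * norm (F x))"
  proof (rule Bochner_Integration.integrable_bound[OF Bochner_Integration.integrable_add[OF i]])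
    show "AE x in lborel. norm (norm (H x) * norm (F x)) \<le> norm (norm (H x) powr (p / (p - 1)) + norm (F x) powr p)"
      using young_powr[of "norm (H _)" "norm (F _)" p 1] p by (auto simp: abs_mult)
  qed measurable
  show "integrable lborel (\<lambda>x. H x \<bullet> F x)"
    by (rule Bochner_Integration.integrable_bound[OF *]) (auto simp: Cauchy_Schwarz_ineq2)
qed

lemma pow_int_holder_tendsto:
  fixes F :: "nat \<Rightarrow> 'a::euclidean_space \<Rightarrow> 'b::euclidean_space"
  assumes [measurable]: "H \<in> borel_measurable borel" "\<And>n. F n \<in> borel_measurable borel" "f \<in> borel_measurable borel"
    and p: "1 < p" and H: "pow_int (p / (p - 1)) H < \<infinity>" and f: "pow_int p f < \<infinity>"
    and lim: "(\<lambda>n. pow_int p (\<lambda>x. F n x - f x)) \<longlonglongrightarrow> 0"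
  shows "(\<lambda>n. \<integral>x. H x \<bullet> F n x \<partial>lborel) \<longlonglongrightarrow> (\<integral>x. H x \<bullet> f x \<partial>lborel)"
proof (rule tendstoI)
  fix e :: real assume e: "0 < e"
  let ?q = "p / (p - 1)"
  define I where "I = (\<integral>x. norm (H x) powr ?q \<partial>lborel)"
  have iH: "integrable lborel (\<lambda>x. norm (H x) powr ?q)" using H pow_int_finite_iff[of H] by auto
  have I: "I \<ge> 0" by (simp add: I_def)
  \<comment> \<open>First \<open>d\<close> puts the part of \<open>H\<close> below
    \<open>e / 2\<close>, then \<open>c\<close> does so for the part of \<open>F n - f\<close>; the
    \<open>+ 1\<close> guards against \<open>I = 0\<close>.\<close>
  define d where "d = (e / 2 / (I + 1)) powr (1 / ?q)"
  have d: "d > 0" using e I by (simp add: d_def)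
  have dI: "d powr ?q * I \<le> e / 2"
    using e I p by (simp add: d_def powr_powr field_simps)
  define c where "c = e / 2 / (1 / d) powr p"
  have c: "c > 0" using e d by (simp add: c_def)
  have "eventually (\<lambda>n. pow_int p (\<lambda>x. F n x - f x) < ennreal c) sequentially"
    using order_tendstoD(2)[OF lim, of "ennreal c"] c by simp
  then show "eventually (\<lambda>n. dist (\<integral>x. H x \<bullet> F n x \<partial>lborel) (\<integral>x. H x \<bullet> f x \<partial>lborel) < e) sequentially"
  proof eventually_elim
    case (elim n)
    then have fin: "pow_int p (\<lambda>x. F n x - f x) < \<infinity>" using less_top order.strict_trans by fastforce
    have iF: "integrable lborel (\<lambda>x. norm (F n x - f x) powr p)"
      using fin pow_int_finite_iff[of "\<lambda>x. F n x - f x"] by auto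
    have Fc: "(\<integral>x. norm (F n x - f x) powr p \<partial>lborel) < c"
      using elim c unfolding pow_int_eq_integral[OF iF] by (simp add: ennreal_less_iff)
    note i1 = pow_int_holder_integrable[OF _ _ p H f]
    note i2 = pow_int_holder_integrable[OF _ _ p H fin]
    have "(\<integral>x. H x \<bullet> F n x \<partial>lborel) = (\<integral>x. H x \<bullet> (F n x - f x) + H x \<bullet> f x \<partial>lborel)"
      by (simp add: inner_diff_right)
    also have "\<dots> = (\<integral>x. H x \<bullet> (F n x - f x) \<partial>lborel) + (\<integral>x. H x \<bullet> f x \<partial>lborel)"
      using i1 i2 by (intro Bochner_Integration.integral_add) auto
    finally have "dist (\<integral>x. H x \<bullet> F n x \<partial>lborel) (\<integral>x. H x \<bullet> f x \<partial>lborel) = norm (\<integral>x. H x \<bullet> (F n x - f x) \<partial>lborel)"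
      by (simp add: dist_norm)
    also have "\<dots> \<le> (\<integral>x. d powr ?q * norm (H x) powr ?q + (1 / d) powr p * norm (F n x - f x) powr p \<partial>lborel)"
    proof (rule Bochner_Integration.integral_norm_bound_integral)
      fix x
      have "norm (H x \<bullet> (F n x - f x)) \<le> norm (H x) * norm (F n x - f x)" by (simp add: Cauchy_Schwarz_ineq2)
      also have "\<dots> \<le> d powr ?q * norm (H x) powr ?q + (1 / d) powr p * norm (F n x - f x) powr p"
        by (rule young_powr) (use p d in auto)
      finally show "norm (H x \<bullet> (F n x - f x)) \<le> d powr ?q * norm (H x) powr ?q + (1 / d) powr p * norm (F n x - f x) powr p" .
    qed (use i2 iH iF in \<open>auto intro!: Bochner_Integration.integrable_add integrable_mult_right\<close>)
    also have "\<dots> = d powr ?q * I + (1 / d) powr p * (\<integral>x. norm (F n x - f x) powr p \<partial>lborel)"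
      using iH iF by (simp add: I_def)
    also have "\<dots> < e / 2 + (1 / d) powr p * c"
      using dI Fc d by (intro add_le_less_mono mult_strict_left_mono) auto
    also have "\<dots> = e" using d by (simp add: c_def)
    finally show ?case .
  qed
qed

section \<open>Translations and dilations of Sobolev functions\<close>

lemma smooth_path_integral:
  assumes w: "smooth w"
  shows "w (x + h) - w x = (\<integral>t. indicator {0..1} t *\<^sub>R (grad w (x + t *\<^sub>R h) \<bullet> h) \<partial>lborel)"
proof -
  have "((\<lambda>t. w (x + t *\<^sub>R h)) has_vector_derivative grad w (x + t *\<^sub>R h) \<bullet> h) (at t within {0..1})" for t
  proof -
    have "((\<lambda>t. x + t *\<^sub>R h) has_derivative (\<lambda>s. s *\<^sub>R h)) (at t)"
      by (auto intro!: derivative_eq_intros)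
    from has_derivative_compose[OF this smooth_has_derivative[OF w]]
    show ?thesis by (auto simp: has_vector_derivative_def intro: has_derivative_at_withinI)
  qed
  moreover have "continuous_on {0..1} (\<lambda>t. grad w (x + t *\<^sub>R h) \<bullet> h)"
    by (intro continuous_intros continuous_on_compose2[OF smooth_grad_continuous[OF w, of UNIV]]) auto
  ultimately show ?thesis
    using integral_FTC_atLeastAtMost[of 0 1 "\<lambda>t. w (x + t *\<^sub>R h)"] by simp
qed

text \<open>Jensen's inequality for the fundamental theorem along the segment. The vector
  \<open>c\<close> serves two uses: \<open>c = 0\<close> for plain translations,
  \<open>c = grad w x\<close> for the first-order remainder of a dilation.\<close>

lemma smooth_path_bound:
  assumes w: "smooth w" and p: "1 \<le> p"
  shows "ennreal (\<bar>w (x + h) - w x - c \<bullet> h\<bar> powr p)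
     \<le> (\<integral>\<^sup>+t. ennreal (indicator {0..1} t * (norm (grad w (x + t *\<^sub>R h) - c) * norm h) powr p) \<partial>lborel)"
proof -
  note [measurable] = smooth_grad_measurable[OF w]
  have cont: "continuous_on {0..1} (\<lambda>t. grad w (x + t *\<^sub>R h) \<bullet> h)"
    by (intro continuous_intros continuous_on_compose2[OF smooth_grad_continuous[OF w, of UNIV]]) auto
  have i: "integrable lborel (\<lambda>t. indicator {0..1} t *\<^sub>R (grad w (x + t *\<^sub>R h) \<bullet> h))"
    using borel_integrable_compact[OF compact_Icc cont] .
  have i2: "integrable lborel (\<lambda>t::real. indicator {0..1} t * (c \<bullet> h))"
    by (intro integrable_mult_left integrable_real_indicator) auto
  have "w (x + h) - w x - c \<bullet> h = (\<integral>t. indicator {0..1} t *\<^sub>R (grad w (x + t *\<^sub>R h) \<bullet> h) \<partial>lborel) - (\<integral>t. indicator {0..1::real} t * (c \<bullet> h) \<partial>lborel)"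
    by (subst smooth_path_integral[OF w]) simp
  also have "\<dots> = (\<integral>t. indicator {0..1} t *\<^sub>R ((grad w (x + t *\<^sub>R h) - c) \<bullet> h) \<partial>lborel)"
    using i i2 by (subst Bochner_Integration.integral_diff[symmetric]) (auto simp: inner_diff_left algebra_simps)
  finally have "ennreal (\<bar>w (x + h) - w x - c \<bullet> h\<bar> powr p) \<le>
      (\<integral>\<^sup>+t. ennreal (indicator {0..1} t * norm ((grad w (x + t *\<^sub>R h) - c) \<bullet> h) powr p) \<partial>lborel)"
    using weighted_jensen[of "\<lambda>t. (grad w (x + t *\<^sub>R h) - c) \<bullet> h" lborel "indicator {0..1}" p] p by simp
  also have "\<dots> \<le> (\<integral>\<^sup>+t. ennreal (indicator {0..1} t * (norm (grad w (x + t *\<^sub>R h) - c) * norm h) powr p) \<partial>lborel)"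
    using p by (intro nn_integral_mono ennreal_leI mult_left_mono powr_mono2) (auto simp: Cauchy_Schwarz_ineq2)
  finally show ?thesis .
qed

text \<open>After Tonelli, each shift by \<open>t *\<^sub>R h\<close> is removed by translation
  invariance.\<close>

lemma pow_int_translate_smooth:
  fixes w :: "'a::euclidean_space \<Rightarrow> real"
  assumes w: "smooth w" and p: "1 \<le> p"
  shows "pow_int p (\<lambda>x. w (x + h) - w x) \<le> ennreal (norm h powr p) * pow_int p (grad w)"
proof -
  note [measurable] = smooth_grad_measurable[OF w]
  have "pow_int p (\<lambda>x. w (x + h) - w x) \<le>
    (\<integral>\<^sup>+x. \<integral>\<^sup>+t. ennreal (indicator {0..1} t * (norm (grad w (x + t *\<^sub>R h)) * norm h) powr p) \<partial>lborel \<partial>lborel)"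
    unfolding pow_int_def using smooth_path_bound[OF w p, of _ h 0] by (intro nn_integral_mono) simp
  also have "\<dots> = (\<integral>\<^sup>+t. \<integral>\<^sup>+x. ennreal (indicator {0..1} t * (norm (grad w (x + t *\<^sub>R h)) * norm h) powr p) \<partial>lborel \<partial>lborel)"
    by (rule lborel_pair.Fubini') measurable
  also have "\<dots> = (\<integral>\<^sup>+t. indicator {0..1::real} t * (ennreal (norm h powr p) * pow_int p (grad w)) \<partial>lborel)"
  proof (rule nn_integral_cong)
    fix t :: real
    have "(\<integral>\<^sup>+x. ennreal (indicator {0..1} t * (norm (grad w (x + t *\<^sub>R h)) * norm h) powr p) \<partial>lborel)
      = (\<integral>\<^sup>+x. (indicator {0..1} t * ennreal (norm h powr p)) * ennreal (norm (grad w (1 *\<^sub>R x + t *\<^sub>R h)) powr p) \<partial>lborel)"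
      by (intro nn_integral_cong) (auto simp: indicator_def powr_mult ennreal_mult mult.commute)
    also have "\<dots> = (indicator {0..1} t * ennreal (norm h powr p)) * pow_int p (\<lambda>x. grad w (1 *\<^sub>R x + t *\<^sub>R h))"
      unfolding pow_int_def by (rule nn_integral_cmult) measurable
    also have "pow_int p (\<lambda>x. grad w (1 *\<^sub>R x + t *\<^sub>R h)) = pow_int p (grad w)"
      by (subst pow_int_affine) auto
    finally show "(\<integral>\<^sup>+x. ennreal (indicator {0..1} t * (norm (grad w (x + t *\<^sub>R h)) * norm h) powr p) \<partial>lborel)
      = indicator {0..1} t * (ennreal (norm h powr p) * pow_int p (grad w))" by (simp add: mult.assoc)
  qed
  also have "\<dots> = ennreal (norm h powr p) * pow_int p (grad w)"
    by (subst nn_integral_multc) auto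
  finally show ?thesis .
qed

lemma pow_int_translate:
  fixes u :: "'a::euclidean_space \<Rightarrow> real"
  assumes w: "smooth_approx p w u g" and p: "1 \<le> p" and [measurable]: "g \<in> borel_measurable borel"
  shows "pow_int p (\<lambda>x. u (x + h) - u x) \<le> ennreal (norm h powr p * 2 powr p) * pow_int p g"
proof -
  have s: "smooth (w n)" for n using w by (simp add: smooth_approx_def)
  note [measurable] = smooth_measurable[OF s] smooth_grad_measurable[OF s]
  have ae: "AE x in lborel. (\<lambda>n. w n x) \<longlonglongrightarrow> u x" using w by (simp add: smooth_approx_def)
  have "AE x in lborel. (\<lambda>n. w n (1 *\<^sub>R x + h)) \<longlonglongrightarrow> u (1 *\<^sub>R x + h)"
    by (rule AE_lborel_affine[OF ae]) simp
  with ae have lim: "AE x in lborel. (\<lambda>n. w n (x + h) - w n x) \<longlonglongrightarrow> u (x + h) - u x"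
    by eventually_elim (auto intro: tendsto_diff)
  show ?thesis
  proof (rule pow_int_Fatou[OF _ _ lim])
    fix n
    have "pow_int p (grad (w n)) = pow_int p (\<lambda>x. (grad (w n) x - g x) + g x)" by simp
    also have "\<dots> \<le> ennreal (2 powr p) * (pow_int p (\<lambda>x. grad (w n) x - g x) + pow_int p g)"
      by (rule pow_int_add) (use p in auto)
    finally have "ennreal (norm h powr p) * pow_int p (grad (w n))
      \<le> ennreal (norm h powr p) * (ennreal (2 powr p) * (pow_int p (\<lambda>x. grad (w n) x - g x) + pow_int p g))"
      by (rule mult_left_mono) simp
    also have "\<dots> = ennreal (norm h powr p * 2 powr p) * (pow_int p (\<lambda>x. grad (w n) x - g x) + pow_int p g)"
      by (simp add: ennreal_mult mult.assoc)
    finally show "pow_int p (\<lambda>x. w n (x + h) - w n x)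
       \<le> ennreal (norm h powr p * 2 powr p) * (pow_int p (\<lambda>x. grad (w n) x - g x) + pow_int p g)"
      using pow_int_translate_smooth[OF s p, of n h] by (rule order_trans[rotated])
  next
    have "(\<lambda>n. pow_int p (\<lambda>x. grad (w n) x - g x)) \<longlonglongrightarrow> 0" using w by (simp add: smooth_approx_def)
    then have "(\<lambda>n. ennreal (norm h powr p * 2 powr p) * (pow_int p (\<lambda>x. grad (w n) x - g x) + pow_int p g))
       \<longlonglongrightarrow> ennreal (norm h powr p * 2 powr p) * (0 + pow_int p g)"
      by (intro ennreal_tendsto_cmult tendsto_add tendsto_const) auto
    then show "(\<lambda>n. ennreal (norm h powr p * 2 powr p) * (pow_int p (\<lambda>x. grad (w n) x - g x) + pow_int p g))
       \<longlonglongrightarrow> ennreal (norm h powr p * 2 powr p) * pow_int p g" by simp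
  qed (use p in auto)
qed

text \<open>A dilation moves \<open>x\<close> by \<open>\<tau> *\<^sub>R x\<close>, whence the
  factor \<open>|\<tau>| * R\<close> on the ball; the hypothesis on \<open>C\<close> covers the
  gradients at all intermediate dilations of the segment.\<close>

lemma pow_int_dilate_smooth:
  fixes w :: "'a::euclidean_space \<Rightarrow> real"
  assumes w: "smooth w" and p: "1 \<le> p" and R: "0 \<le> R"
    and C: "\<And>s. \<bar>s\<bar> \<le> \<bar>\<tau>\<bar> \<Longrightarrow> pow_int p (\<lambda>x. grad w ((1 + s) *\<^sub>R x) - grad w x) \<le> C"
  shows "pow_int p (\<lambda>x. indicator (cball 0 R) x * (w ((1 + \<tau>) *\<^sub>R x) - w x - \<tau> * (grad w x \<bullet> x)))
     \<le> ennreal ((\<bar>\<tau>\<bar> * R) powr p) * C"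
proof -
  note [measurable] = smooth_grad_measurable[OF w]
  let ?K = "(\<bar>\<tau>\<bar> * R) powr p"
  let ?G = "\<lambda>t x. grad w ((1 + t * \<tau>) *\<^sub>R x) - grad w x"
  have "pow_int p (\<lambda>x. indicator (cball 0 R) x * (w ((1 + \<tau>) *\<^sub>R x) - w x - \<tau> * (grad w x \<bullet> x)))
    \<le> (\<integral>\<^sup>+x. \<integral>\<^sup>+t. ennreal (indicator {0..1} t * (?K * norm (?G t x) powr p)) \<partial>lborel \<partial>lborel)"
    unfolding pow_int_def
  proof (rule nn_integral_mono)
    fix x :: 'a
    show "ennreal (norm (indicator (cball 0 R) x * (w ((1 + \<tau>) *\<^sub>R x) - w x - \<tau> * (grad w x \<bullet> x))) powr p)
      \<le> (\<integral>\<^sup>+t. ennreal (indicator {0..1} t * (?K * norm (?G t x) powr p)) \<partial>lborel)"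
    proof (cases "x \<in> cball 0 R")
      case True
      then have nx: "norm x \<le> R" by simp
      have "ennreal (norm (indicator (cball 0 R) x * (w ((1 + \<tau>) *\<^sub>R x) - w x - \<tau> * (grad w x \<bullet> x))) powr p)
        = ennreal (\<bar>w (x + \<tau> *\<^sub>R x) - w x - grad w x \<bullet> (\<tau> *\<^sub>R x)\<bar> powr p)"
        using True by (simp add: algebra_simps)
      also have "\<dots> \<le> (\<integral>\<^sup>+t. ennreal (indicator {0..1} t * (norm (grad w (x + t *\<^sub>R (\<tau> *\<^sub>R x)) - grad w x) * norm (\<tau> *\<^sub>R x)) powr p) \<partial>lborel)"
        by (rule smooth_path_bound[OF w p])
      also have "\<dots> \<le> (\<integral>\<^sup>+t. ennreal (indicator {0..1} t * (?K * norm (?G t x) powr p)) \<partial>lborel)"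
      proof (intro nn_integral_mono ennreal_leI mult_left_mono)
        fix t
        have "(norm (grad w (x + t *\<^sub>R (\<tau> *\<^sub>R x)) - grad w x) * norm (\<tau> *\<^sub>R x)) powr p
          \<le> (norm (grad w (x + t *\<^sub>R (\<tau> *\<^sub>R x)) - grad w x) * (\<bar>\<tau>\<bar> * R)) powr p"
          using p nx by (intro powr_mono2 mult_left_mono) (auto intro: mult_left_mono)
        also have "\<dots> = ?K * norm (?G t x) powr p"
          using R by (simp add: powr_mult algebra_simps)
        finally show "(norm (grad w (x + t *\<^sub>R (\<tau> *\<^sub>R x)) - grad w x) * norm (\<tau> *\<^sub>R x)) powr p
          \<le> ?K * norm (?G t x) powr p" .
      qed auto
      finally show ?thesis .
    qed auto
  qed
  also have "\<dots> = (\<integral>\<^sup>+t. \<integral>\<^sup>+x. ennreal (indicator {0..1} t * (?K * norm (?G t x) powr p)) \<partial>lborel \<partial>lborel)"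
    by (rule lborel_pair.Fubini') measurable
  also have "\<dots> \<le> (\<integral>\<^sup>+t. indicator {0..1::real} t * (ennreal ?K * C) \<partial>lborel)"
  proof (rule nn_integral_mono)
    fix t :: real
    show "(\<integral>\<^sup>+x. ennreal (indicator {0..1} t * (?K * norm (?G t x) powr p)) \<partial>lborel) \<le> indicator {0..1} t * (ennreal ?K * C)"
    proof (cases "t \<in> {0..1}")
      case True
      then have "\<bar>t * \<tau>\<bar> \<le> \<bar>\<tau>\<bar>" using mult_right_mono[of t 1 "\<bar>\<tau>\<bar>"] by (simp add: abs_mult)
      from C[OF this] have "ennreal ?K * pow_int p (?G t) \<le> ennreal ?K * C" by (rule mult_left_mono) simp
      moreover have "(\<integral>\<^sup>+x. ennreal (?K * norm (?G t x) powr p) \<partial>lborel) = ennreal ?K * pow_int p (?G t)"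
        unfolding pow_int_def by (simp add: ennreal_mult nn_integral_cmult)
      ultimately show ?thesis using True by simp
    qed auto
  qed
  also have "\<dots> = ennreal ?K * C" by (subst nn_integral_multc) auto
  finally show ?thesis .
qed

lemma pow_int_dilate:
  fixes u :: "'a::euclidean_space \<Rightarrow> real"
  assumes w: "smooth_approx p w u g" and p: "1 \<le> p" and R: "0 \<le> R" and [measurable]: "g \<in> borel_measurable borel"
    and \<tau>: "\<bar>\<tau>\<bar> \<le> 1 / 2"
    and C: "\<And>s. \<bar>s\<bar> \<le> \<bar>\<tau>\<bar> \<Longrightarrow> pow_int p (\<lambda>x. g ((1 + s) *\<^sub>R x) - g x) \<le> C"
  shows "pow_int p (\<lambda>x. indicator (cball 0 R) x * (u ((1 + \<tau>) *\<^sub>R x) - u x - \<tau> * (g x \<bullet> x)))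
     \<le> ennreal ((\<bar>\<tau>\<bar> * R) powr p) * (ennreal (2 powr p) * C)"
proof -
  have s: "smooth (w n)" for n using w by (simp add: smooth_approx_def)
  note [measurable] = smooth_measurable[OF s] smooth_grad_measurable[OF s]
  have ae: "AE x in lborel. (\<lambda>n. w n x) \<longlonglongrightarrow> u x" "AE x in lborel. (\<lambda>n. grad (w n) x) \<longlonglongrightarrow> g x"
    using w by (auto simp: smooth_approx_def)
  have "AE x in lborel. (\<lambda>n. w n ((1 + \<tau>) *\<^sub>R x + 0)) \<longlonglongrightarrow> u ((1 + \<tau>) *\<^sub>R x + 0)"
    by (rule AE_lborel_affine[OF ae(1)]) (use \<tau> in auto)
  with ae have lim: "AE x in lborel. (\<lambda>n. indicator (cball 0 R) x * (w n ((1 + \<tau>) *\<^sub>R x) - w n x - \<tau> * (grad (w n) x \<bullet> x)))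
     \<longlonglongrightarrow> indicator (cball 0 R) x * (u ((1 + \<tau>) *\<^sub>R x) - u x - \<tau> * (g x \<bullet> x))"
    by eventually_elim (auto intro!: tendsto_intros)
  define \<delta> where "\<delta> n = pow_int p (\<lambda>x. grad (w n) x - g x)" for n
  let ?N = "ennreal (2 ^ DIM('a))"
  \<comment> \<open>Comparing \<open>grad (w n)\<close> at \<open>(1 + s) *\<^sub>R x\<close> and at
    \<open>x\<close> costs the mismatch of \<open>g\<close> plus one approximation error at each
    point, the first of them times the Jacobian bound \<open>?N\<close>, valid as
    \<open>1 + s \<ge> 1 / 2\<close>.\<close>
  let ?D = "\<lambda>n. ennreal ((\<bar>\<tau>\<bar> * R) powr p) * (ennreal (2 powr p) * (C + ennreal (2 powr p) * (?N * \<delta> n + \<delta> n)))"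
  show ?thesis
  proof (rule pow_int_Fatou[OF _ _ lim, where C = ?D])
    fix n
    show "pow_int p (\<lambda>x. indicator (cball 0 R) x * (w n ((1 + \<tau>) *\<^sub>R x) - w n x - \<tau> * (grad (w n) x \<bullet> x))) \<le> ?D n"
    proof (rule pow_int_dilate_smooth[OF s p R])
      fix s :: real assume s: "\<bar>s\<bar> \<le> \<bar>\<tau>\<bar>"
      have c: "1 / 2 \<le> 1 + s" using s \<tau> by linarith
      have "pow_int p (\<lambda>x. grad (w n) ((1 + s) *\<^sub>R x + 0) - g ((1 + s) *\<^sub>R x + 0))
         = ennreal (1 / \<bar>1 + s\<bar> ^ DIM('a)) * \<delta> n"
        unfolding \<delta>_def by (rule pow_int_affine[of "\<lambda>x. grad (w n) x - g x"]) (use c in auto)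
      also have "\<dots> \<le> ?N * \<delta> n"
      proof (intro mult_right_mono ennreal_leI)
        have "1 / \<bar>1 + s\<bar> ^ DIM('a) = (1 / \<bar>1 + s\<bar>) ^ DIM('a)" by (simp add: power_one_over)
        also have "\<dots> \<le> 2 ^ DIM('a)" using c by (intro power_mono) (auto simp: field_simps)
        finally show "1 / \<bar>1 + s\<bar> ^ DIM('a) \<le> 2 ^ DIM('a)" .
      qed auto
      finally have 1: "pow_int p (\<lambda>x. grad (w n) ((1 + s) *\<^sub>R x) - g ((1 + s) *\<^sub>R x)) \<le> ?N * \<delta> n" by simp
      have "pow_int p (\<lambda>x. grad (w n) ((1 + s) *\<^sub>R x) - grad (w n) x)
        = pow_int p (\<lambda>x. (g ((1 + s) *\<^sub>R x) - g x) + ((grad (w n) ((1 + s) *\<^sub>R x) - g ((1 + s) *\<^sub>R x)) - (grad (w n) x - g x)))"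
        by simp
      also have "\<dots> \<le> ennreal (2 powr p) * (pow_int p (\<lambda>x. g ((1 + s) *\<^sub>R x) - g x) +
         pow_int p (\<lambda>x. (grad (w n) ((1 + s) *\<^sub>R x) - g ((1 + s) *\<^sub>R x)) - (grad (w n) x - g x)))"
        by (rule pow_int_add) (use p in auto)
      also have "\<dots> \<le> ennreal (2 powr p) * (C + ennreal (2 powr p) *
         (pow_int p (\<lambda>x. grad (w n) ((1 + s) *\<^sub>R x) - g ((1 + s) *\<^sub>R x)) + \<delta> n))"
        unfolding \<delta>_def
        by (intro mult_left_mono add_mono C s pow_int_diff) (use p in auto)
      also have "\<dots> \<le> ennreal (2 powr p) * (C + ennreal (2 powr p) * (?N * \<delta> n + \<delta> n))"
        by (intro mult_left_mono add_mono 1 order_refl) auto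
      finally show "pow_int p (\<lambda>x. grad (w n) ((1 + s) *\<^sub>R x) - grad (w n) x)
        \<le> ennreal (2 powr p) * (C + ennreal (2 powr p) * (?N * \<delta> n + \<delta> n))" .
    qed
  next
    have "\<delta> \<longlonglongrightarrow> 0" using w unfolding smooth_approx_def \<delta>_def by simp
    then have "?D \<longlonglongrightarrow> ennreal ((\<bar>\<tau>\<bar> * R) powr p) * (ennreal (2 powr p) * (C + ennreal (2 powr p) * (?N * 0 + 0)))"
      by (intro ennreal_tendsto_cmult tendsto_add tendsto_const) auto
    then show "?D \<longlonglongrightarrow> ennreal ((\<bar>\<tau>\<bar> * R) powr p) * (ennreal (2 powr p) * C)" by simp
  qed (use p in auto)
qed

text \<open>The factor \<open>|\<tau>| powr p\<close> in \<open>pow_int_dilate\<close> cancels on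
  division, leaving the oscillation of \<open>g\<close> under small dilations, which tends to 0 in
  \<open>L^p\<close>.\<close>

lemma difference_quotient_tendsto:
  fixes u :: "'a::euclidean_space \<Rightarrow> real"
  assumes w: "smooth_approx p w u g" and p: "1 \<le> p" and R: "0 \<le> R"
    and [measurable]: "g \<in> borel_measurable borel" "u \<in> borel_measurable borel" and fin: "pow_int p g < \<infinity>"
    and \<tau>: "\<tau> \<longlonglongrightarrow> 0" "\<And>n. \<tau> n \<noteq> 0"
  shows "(\<lambda>n. pow_int p (\<lambda>x. indicator (cball 0 R) x * ((u ((1 + \<tau> n) *\<^sub>R x) - u x) / \<tau> n)
      - indicator (cball 0 R) x * (g x \<bullet> x))) \<longlonglongrightarrow> 0"
proof (rule ennreal_tendsto_0I)
  fix e :: real assume e: "0 < e"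
  define C where "C = e / ((R + 1) powr p * 2 powr p)"
  have "C > 0" using e R by (simp add: C_def)
  from pow_int_affine_continuous[OF _ p fin this] obtain d where
    d: "0 < d" "\<And>a c. norm a < d \<Longrightarrow> \<bar>c - 1\<bar> < d \<Longrightarrow> pow_int p (\<lambda>x. g (c *\<^sub>R x + a) - g x) \<le> ennreal C" by auto
  have "eventually (\<lambda>n. \<bar>\<tau> n\<bar> < min d (1/2)) sequentially"
    using order_tendstoD(2)[OF tendsto_rabs_zero[OF \<tau>(1)], of "min d (1/2)"] d by simp
  then show "eventually (\<lambda>n. pow_int p (\<lambda>x. indicator (cball 0 R) x * ((u ((1 + \<tau> n) *\<^sub>R x) - u x) / \<tau> n)
      - indicator (cball 0 R) x * (g x \<bullet> x)) \<le> ennreal e) sequentially"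
  proof eventually_elim
    case (elim n)
    let ?F = "\<lambda>x. indicator (cball 0 R) x * (u ((1 + \<tau> n) *\<^sub>R x) - u x - \<tau> n * (g x \<bullet> x))"
    have F: "pow_int p ?F \<le> ennreal ((\<bar>\<tau> n\<bar> * R) powr p) * (ennreal (2 powr p) * ennreal C)"
    proof (rule pow_int_dilate[OF w p R])
      fix s assume "\<bar>s\<bar> \<le> \<bar>\<tau> n\<bar>"
      then show "pow_int p (\<lambda>x. g ((1 + s) *\<^sub>R x) - g x) \<le> ennreal C"
        using d(2)[of 0 "1 + s"] d(1) elim by simp
    qed (use elim in auto)
    have "pow_int p (\<lambda>x. indicator (cball 0 R) x * ((u ((1 + \<tau> n) *\<^sub>R x) - u x) / \<tau> n)
      - indicator (cball 0 R) x * (g x \<bullet> x)) = pow_int p (\<lambda>x. (1 / \<tau> n) *\<^sub>R ?F x)"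
      using \<tau>(2)[of n] by (intro arg_cong[where f = "pow_int p"] ext) (simp add: field_simps)
    also have "\<dots> = ennreal (\<bar>1 / \<tau> n\<bar> powr p) * pow_int p ?F"
      by (rule pow_int_cmult) (use p in \<open>auto intro!: borel_measurable_times borel_measurable_indicator\<close>)
    also have "\<dots> \<le> ennreal (\<bar>1 / \<tau> n\<bar> powr p) * (ennreal ((\<bar>\<tau> n\<bar> * R) powr p) * (ennreal (2 powr p) * ennreal C))"
      by (intro mult_left_mono F) simp
    also have "\<dots> = ennreal (\<bar>1 / \<tau> n\<bar> powr p * (\<bar>\<tau> n\<bar> * R) powr p * 2 powr p * C)"
      using \<open>C > 0\<close> by (simp add: ennreal_mult mult.assoc)
    also have "\<bar>1 / \<tau> n\<bar> powr p * (\<bar>\<tau> n\<bar> * R) powr p = R powr p"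
      using \<tau>(2)[of n] R by (simp add: powr_mult[symmetric])
    also have "R powr p * 2 powr p * C \<le> e"
    proof -
      have "R powr p * 2 powr p * C \<le> (R + 1) powr p * 2 powr p * C"
        using R p \<open>C > 0\<close> by (intro mult_right_mono powr_mono2) auto
      also have "\<dots> = e" using R by (simp add: C_def)
      finally show ?thesis .
    qed
    finally show ?case by (simp add: ennreal_leI)
  qed
qed

text \<open>Split into \<open>m n\<close> times \<open>grad (w n) - g\<close> and
  \<open>m n - l\<close> times \<open>g\<close>: the bound \<open>K\<close> controls the first,
  dominated convergence with majorant \<open>2 * K\<close> times \<open>g\<close> the
  second.\<close>

lemma smooth_approx_scaled:
  fixes u :: "'a::euclidean_space \<Rightarrow> real"
  assumes w: "smooth_approx p w u g" and p: "1 \<le> p"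
    and g [measurable]: "g \<in> borel_measurable borel" and fin: "pow_int p g < \<infinity>"
    and [measurable]: "\<And>n. m n \<in> borel_measurable borel" "l \<in> borel_measurable borel"
    and K: "\<And>n x. \<bar>m n x\<bar> \<le> K" "\<And>x. \<bar>l x\<bar> \<le> K"
    and lim: "AE x in lborel. (\<lambda>n. m n x) \<longlonglongrightarrow> l x"
  shows "(\<lambda>n. pow_int p (\<lambda>x. m n x *\<^sub>R grad (w n) x - l x *\<^sub>R g x)) \<longlonglongrightarrow> 0"
proof (rule pow_int_tendsto_0_squeeze)
  have s: "smooth (w n)" for n using w by (simp add: smooth_approx_def)
  note [measurable] = smooth_measurable[OF s] smooth_grad_measurable[OF s]
  have K0: "K \<ge> 0" using K(2)[of 0] by linarith
  fix n
  have "pow_int p (\<lambda>x. m n x *\<^sub>R grad (w n) x - l x *\<^sub>R g x)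
    = pow_int p (\<lambda>x. m n x *\<^sub>R (grad (w n) x - g x) + (m n x - l x) *\<^sub>R g x)"
    by (simp add: algebra_simps)
  also have "\<dots> \<le> ennreal (2 powr p) * (pow_int p (\<lambda>x. m n x *\<^sub>R (grad (w n) x - g x))
     + pow_int p (\<lambda>x. (m n x - l x) *\<^sub>R g x))"
    by (rule pow_int_add) (use p in auto)
  also have "\<dots> \<le> ennreal (2 powr p) * (pow_int p (\<lambda>x. K *\<^sub>R (grad (w n) x - g x))
     + pow_int p (\<lambda>x. (m n x - l x) *\<^sub>R g x))"
    by (intro mult_left_mono add_right_mono pow_int_mono)
       (use p K K0 in \<open>auto intro!: mult_right_mono\<close>)
  also have "pow_int p (\<lambda>x. K *\<^sub>R (grad (w n) x - g x)) = ennreal (\<bar>K\<bar> powr p) * pow_int p (\<lambda>x. grad (w n) x - g x)"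
    by (rule pow_int_cmult) (use p in auto)
  finally show "pow_int p (\<lambda>x. m n x *\<^sub>R grad (w n) x - l x *\<^sub>R g x) \<le>
    ennreal (2 powr p) * (ennreal (\<bar>K\<bar> powr p) * pow_int p (\<lambda>x. grad (w n) x - g x)
     + pow_int p (\<lambda>x. (m n x - l x) *\<^sub>R g x))" .
next
  have "(\<lambda>n. ennreal (\<bar>K\<bar> powr p) * pow_int p (\<lambda>x. grad (w n) x - g x)) \<longlonglongrightarrow> ennreal (\<bar>K\<bar> powr p) * 0"
    using w by (intro ennreal_tendsto_cmult) (auto simp: smooth_approx_def)
  then show "(\<lambda>n. ennreal (\<bar>K\<bar> powr p) * pow_int p (\<lambda>x. grad (w n) x - g x)) \<longlonglongrightarrow> 0" by simp
  have K0: "K \<ge> 0" using K(2)[of 0] by linarith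
  have fin2: "pow_int p (\<lambda>x. (2 * K) *\<^sub>R g x) < \<infinity>"
    using fin p by (subst pow_int_cmult) (auto simp: ennreal_mult_less_top)
  show "(\<lambda>n. pow_int p (\<lambda>x. (m n x - l x) *\<^sub>R g x)) \<longlonglongrightarrow> 0"
  proof (rule pow_int_dominated_convergence[OF _ _ _ _ _ fin2])
    show "AE x in lborel. (\<lambda>n. (m n x - l x) *\<^sub>R g x) \<longlonglongrightarrow> 0"
      using lim
    proof eventually_elim
      case (elim x)
      from tendsto_scaleR[OF LIM_zero[OF elim] tendsto_const[of "g x"]] show ?case by simp
    qed
    fix n x
    have "\<bar>m n x - l x\<bar> \<le> 2 * K" using K(1)[of n x] K(2)[of x] by linarith
    then show "norm ((m n x - l x) *\<^sub>R g x) \<le> norm ((2 * K) *\<^sub>R g x)"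
      using K0 by (auto intro!: mult_right_mono)
  qed (use p in auto)
qed

text \<open>Chain rule: the outer factor \<open>d\<close> cancels the inner \<open>1 / d\<close>, so
  the gradient carries the factor \<open>flat 2\<close>, bounded by 1 uniformly in
  \<open>d\<close>.\<close>

lemma smooth_approx_flat:
  fixes u :: "'a::euclidean_space \<Rightarrow> real"
  assumes w: "smooth_approx p w u g" and p: "1 \<le> p"
    and g [measurable]: "g \<in> borel_measurable borel" and [measurable]: "u \<in> borel_measurable borel"
    and fin: "pow_int p g < \<infinity>" and d: "0 < d"
  shows "smooth_approx p (\<lambda>n x. d * flat 0 ((w n x - k) / d)) (\<lambda>x. d * flat 0 ((u x - k) / d))
    (\<lambda>x. flat 2 ((u x - k) / d) *\<^sub>R g x)"
proof -
  have s: "smooth (w n)" for n using w by (simp add: smooth_approx_def)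
  have ae: "AE x in lborel. (\<lambda>n. w n x) \<longlonglongrightarrow> u x" "AE x in lborel. (\<lambda>n. grad (w n) x) \<longlonglongrightarrow> g x"
    using w by (auto simp: smooth_approx_def)
  note [measurable] = smooth_measurable[OF s] smooth_grad_measurable[OF s]
  have fc: "isCont (flat m) t" for m t using flat_continuous[of UNIV m] by (simp add: continuous_on_eq_continuous_at)
  have [measurable]: "flat m \<in> borel_measurable borel" for m
    by (intro borel_measurable_continuous_onI flat_continuous)
  have lim: "(\<lambda>n. flat m ((w n x - k) / d)) \<longlonglongrightarrow> flat m ((u x - k) / d)" if "(\<lambda>n. w n x) \<longlonglongrightarrow> u x" for m x
    by (rule isCont_tendsto_compose[OF fc]) (intro tendsto_intros that, use d in simp)
  have gr: "grad (\<lambda>x. d * flat 0 ((w n x - k) / d)) x = flat 2 ((w n x - k) / d) *\<^sub>R grad (w n) x" for n x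
  proof (rule grad_compose[OF s])
    have "((\<lambda>t. flat 0 ((t - k) / d)) has_real_derivative flat 2 ((w n x - k) / d) * (1 / d)) (at (w n x))"
    proof (rule DERIV_chain2[where f = "flat 0" and g = "\<lambda>t. (t - k) / d"])
      show "(flat 0 has_real_derivative flat 2 ((w n x - k) / d)) (at ((w n x - k) / d))"
        using flat_has_derivative[of 0 "(w n x - k) / d"] by (simp add: numeral_2_eq_2)
    qed (use d in \<open>auto intro!: derivative_eq_intros\<close>)
    from DERIV_cmult[OF this, of d]
    show "((\<lambda>t. d * flat 0 ((t - k) / d)) has_real_derivative flat 2 ((w n x - k) / d)) (at (w n x))"
      using d by simp
  qed
  have "(\<lambda>n. pow_int p (\<lambda>x. flat 2 ((w n x - k) / d) *\<^sub>R grad (w n) x - flat 2 ((u x - k) / d) *\<^sub>R g x)) \<longlonglongrightarrow> 0"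
  proof (rule smooth_approx_scaled[OF w p g fin, where K = 1])
    show "AE x in lborel. (\<lambda>n. flat 2 ((w n x - k) / d)) \<longlonglongrightarrow> flat 2 ((u x - k) / d)"
      using ae(1) by eventually_elim (rule lim)
  qed (auto simp: flat_2_le_1)
  moreover have "smooth (\<lambda>x. d * flat 0 ((w n x - k) / d))" for n
    using smooth_cmult[OF smooth_flat[OF smooth_cmult[OF smooth_diff[OF s smooth_const[of k]], of "1 / d"]], of d 0 n]
    by (simp add: mult.commute)
  moreover have "AE x in lborel. (\<lambda>n. d * flat 0 ((w n x - k) / d)) \<longlonglongrightarrow> d * flat 0 ((u x - k) / d)"
    using ae(1) by eventually_elim (intro tendsto_intros lim)
  moreover have "AE x in lborel. (\<lambda>n. flat 2 ((w n x - k) / d) *\<^sub>R grad (w n) x) \<longlonglongrightarrow> flat 2 ((u x - k) / d) *\<^sub>R g x"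
    using ae by eventually_elim (intro tendsto_intros lim)
  ultimately show ?thesis by (simp add: smooth_approx_def gr)
qed

text \<open>Makes the difference between a dilate and the function itself a limit of smooth
  functions, hence admissible in the equation after multiplication by a cut-off.\<close>

lemma smooth_approx_dilate_diff:
  fixes u :: "'a::euclidean_space \<Rightarrow> real"
  assumes w: "smooth_approx p w u g" and p: "1 \<le> p" and c: "c \<noteq> 0"
    and [measurable]: "g \<in> borel_measurable borel"
  shows "smooth_approx p (\<lambda>n x. w n (c *\<^sub>R x) - w n x) (\<lambda>x. u (c *\<^sub>R x) - u x) (\<lambda>x. c *\<^sub>R g (c *\<^sub>R x) - g x)"
proof -
  have s: "smooth (w n)" for n using w by (simp add: smooth_approx_def)
  note [measurable] = smooth_grad_measurable[OF s]
  have s': "smooth (\<lambda>x. w n (c *\<^sub>R x))" for n using smooth_affine[OF s, of n c 0] by simp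
  have gr: "grad (\<lambda>x. w n (c *\<^sub>R x) - w n x) x = c *\<^sub>R grad (w n) (c *\<^sub>R x) - grad (w n) x" for n x
    using grad_diff[OF s' s] grad_affine[OF s, of n c 0] by simp
  have ae: "AE x in lborel. (\<lambda>n. w n x) \<longlonglongrightarrow> u x" "AE x in lborel. (\<lambda>n. grad (w n) x) \<longlonglongrightarrow> g x"
    using w by (auto simp: smooth_approx_def)
  note ae' = AE_lborel_affine[OF ae(1) c, of 0] AE_lborel_affine[OF ae(2) c, of 0]
  define \<delta> where "\<delta> n = pow_int p (\<lambda>x. grad (w n) x - g x)" for n
  have \<delta>: "\<delta> \<longlonglongrightarrow> 0" using w unfolding smooth_approx_def \<delta>_def by simp
  define C where "C = \<bar>c\<bar> powr p * (1 / \<bar>c\<bar> ^ DIM('a))"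
  have "(\<lambda>n. pow_int p (\<lambda>x. c *\<^sub>R grad (w n) (c *\<^sub>R x) - grad (w n) x - (c *\<^sub>R g (c *\<^sub>R x) - g x))) \<longlonglongrightarrow> 0"
  proof (rule pow_int_tendsto_0_squeeze[where A = "\<lambda>n. ennreal C * \<delta> n", OF _ _ \<delta>])
    fix n
    have "pow_int p (\<lambda>x. grad (w n) (c *\<^sub>R x + 0) - g (c *\<^sub>R x + 0)) = ennreal (1 / \<bar>c\<bar> ^ DIM('a)) * \<delta> n"
      unfolding \<delta>_def by (rule pow_int_affine[of "\<lambda>x. grad (w n) x - g x"]) (use c in auto)
    then have 1: "pow_int p (\<lambda>x. c *\<^sub>R (grad (w n) (c *\<^sub>R x) - g (c *\<^sub>R x))) = ennreal C * \<delta> n"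
      using p by (subst pow_int_cmult) (auto simp: C_def ennreal_mult'' mult.assoc simp del: times_divide_eq_right)
    have "pow_int p (\<lambda>x. c *\<^sub>R grad (w n) (c *\<^sub>R x) - grad (w n) x - (c *\<^sub>R g (c *\<^sub>R x) - g x))
      = pow_int p (\<lambda>x. c *\<^sub>R (grad (w n) (c *\<^sub>R x) - g (c *\<^sub>R x)) - (grad (w n) x - g x))"
      by (simp add: algebra_simps)
    also have "\<dots> \<le> ennreal (2 powr p) * (ennreal C * \<delta> n + \<delta> n)"
      unfolding 1[symmetric] unfolding \<delta>_def by (rule pow_int_diff) (use p in auto)
    finally show "pow_int p (\<lambda>x. c *\<^sub>R grad (w n) (c *\<^sub>R x) - grad (w n) x - (c *\<^sub>R g (c *\<^sub>R x) - g x))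
       \<le> ennreal (2 powr p) * (ennreal C * \<delta> n + \<delta> n)" .
  next
    have "(\<lambda>n. ennreal C * \<delta> n) \<longlonglongrightarrow> ennreal C * 0" using \<delta> by (intro ennreal_tendsto_cmult) auto
    then show "(\<lambda>n. ennreal C * \<delta> n) \<longlonglongrightarrow> 0" by simp
  qed
  moreover have "AE x in lborel. (\<lambda>n. w n (c *\<^sub>R x) - w n x) \<longlonglongrightarrow> u (c *\<^sub>R x) - u x"
    using ae(1) ae'(1) by eventually_elim (auto intro: tendsto_diff)
  moreover have "AE x in lborel. (\<lambda>n. c *\<^sub>R grad (w n) (c *\<^sub>R x) - grad (w n) x) \<longlonglongrightarrow> c *\<^sub>R g (c *\<^sub>R x) - g x"
    using ae(2) ae'(2) by eventually_elim (auto intro!: tendsto_intros)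
  ultimately show ?thesis using smooth_diff[OF s' s] by (simp add: smooth_approx_def gr)
qed

text \<open>Here the derivative falls on \<open>Z\<close>, so the other factor need only be locally
  integrable. \<open>Z\<close> is Lipschitz by its bounded gradient, and
  \<open>1 + \<tau> n \<ge> 1 / 2\<close> confines all supports to the ball of radius
  \<open>2 * |R|\<close>.\<close>

lemma dilation_quotient_tendsto:
  fixes Z h :: "'a::euclidean_space \<Rightarrow> real"
  assumes Z: "\<And>x. (Z has_derivative (\<lambda>k. G x \<bullet> k)) (at x)" and G: "continuous_on UNIV G"
    and supp: "\<And>x. norm x > R \<Longrightarrow> Z x = 0" "\<And>x. norm x > R \<Longrightarrow> G x = 0"
    and h: "loc_int h" and \<tau>: "\<tau> \<longlonglongrightarrow> 0" "\<And>n. \<tau> n \<noteq> 0" "\<And>n. - 1 / 2 \<le> \<tau> n"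
  shows "(\<lambda>n. \<integral>x. (Z ((1 + \<tau> n) *\<^sub>R x) - Z x) / \<tau> n * h x \<partial>lborel) \<longlonglongrightarrow> (\<integral>x. (G x \<bullet> x) * h x \<partial>lborel)"
proof -
  have cZ: "continuous_on UNIV Z"
    using Z by (meson continuous_at_imp_continuous_on has_derivative_continuous)
  have [measurable]: "Z \<in> borel_measurable borel" "G \<in> borel_measurable borel"
    by (intro borel_measurable_continuous_onI cZ G)+
  have [measurable]: "h \<in> borel_measurable borel" using h by (rule loc_int_measurable)
  obtain B where B: "B > 0" "\<And>x. norm (G x) \<le> B" using continuous_compact_support_bounded[OF G supp(2)] by metis
  have lip: "\<bar>Z y - Z x\<bar> \<le> B * norm (y - x)" for x y
  proof -
    have "norm (Z y - Z x) \<le> B * norm (y - x)"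
    proof (rule differentiable_bound[of UNIV Z "\<lambda>x. (\<bullet>) (G x)"])
      fix x
      show "onorm ((\<bullet>) (G x)) \<le> B"
      proof (rule onorm_bound)
        show "norm (G x \<bullet> k) \<le> B * norm k" for k
          using Cauchy_Schwarz_ineq2[of "G x" k] mult_right_mono[OF B(2)[of x], of "norm k"] by simp
      qed (use B in simp)
    qed (use Z in auto)
    then show ?thesis by simp
  qed
  define R' where "R' = 2 * \<bar>R\<bar>"
  show ?thesis
  proof (rule integral_dominated_convergence[where w = "\<lambda>x. (B * R') * norm (indicator (cball 0 R') x *\<^sub>R h x)"])
    show "integrable lborel (\<lambda>x. (B * R') * norm (indicator (cball 0 R') x *\<^sub>R h x))"
      using h unfolding loc_int_def by (intro integrable_mult_right integrable_norm) auto
    show "AE x in lborel. (\<lambda>n. (Z ((1 + \<tau> n) *\<^sub>R x) - Z x) / \<tau> n * h x) \<longlonglongrightarrow> (G x \<bullet> x) * h x"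
    proof (intro AE_I2 tendsto_mult tendsto_const)
      fix x :: 'a
      have "((\<lambda>t. (1 + t) *\<^sub>R x) has_derivative (\<lambda>s. s *\<^sub>R x)) (at 0)"
        by (auto intro!: derivative_eq_intros)
      moreover have "(Z has_derivative (\<lambda>k. G x \<bullet> k)) (at ((1 + 0) *\<^sub>R x))" using Z by simp
      ultimately have "((\<lambda>t. Z ((1 + t) *\<^sub>R x)) has_derivative (\<lambda>s. G x \<bullet> (s *\<^sub>R x))) (at 0)"
        by (rule has_derivative_compose)
      also have "(\<lambda>s. G x \<bullet> (s *\<^sub>R x)) = (*) (G x \<bullet> x)" by (auto simp: mult.commute)
      finally have "DERIV (\<lambda>t. Z ((1 + t) *\<^sub>R x)) 0 :> G x \<bullet> x" by (simp add: has_field_derivative_def)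
      then have "((\<lambda>t. (Z ((1 + t) *\<^sub>R x) - Z x) / t) \<longlongrightarrow> G x \<bullet> x) (at 0)" by (simp add: DERIV_def)
      moreover have "filterlim \<tau> (at 0) sequentially" using \<tau> by (simp add: filterlim_at)
      ultimately show "(\<lambda>n. (Z ((1 + \<tau> n) *\<^sub>R x) - Z x) / \<tau> n) \<longlonglongrightarrow> G x \<bullet> x" by (rule filterlim_compose)
    qed
    show "AE x in lborel. norm ((Z ((1 + \<tau> n) *\<^sub>R x) - Z x) / \<tau> n * h x) \<le> (B * R') * norm (indicator (cball 0 R') x *\<^sub>R h x)" for n
    proof (rule AE_I2)
      fix x :: 'a
      show "norm ((Z ((1 + \<tau> n) *\<^sub>R x) - Z x) / \<tau> n * h x) \<le> (B * R') * norm (indicator (cball 0 R') x *\<^sub>R h x)"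
      proof (cases "norm x > R'")
        case True
        have "R < 1 / 2 * norm x" using True by (simp add: R'_def)
        also have "\<dots> \<le> (1 + \<tau> n) * norm x" using \<tau>(3)[of n] by (intro mult_right_mono) auto
        also have "\<dots> \<le> norm ((1 + \<tau> n) *\<^sub>R x)" by (auto intro!: mult_right_mono)
        finally show ?thesis using supp(1) True by (simp add: R'_def)
      next
        case False
        have "(1 + \<tau> n) *\<^sub>R x - x = \<tau> n *\<^sub>R x" by (simp add: algebra_simps)
        then have "\<bar>Z ((1 + \<tau> n) *\<^sub>R x) - Z x\<bar> \<le> B * (\<bar>\<tau> n\<bar> * norm x)"
          using lip[of "(1 + \<tau> n) *\<^sub>R x" x] by simp
        also have "\<dots> \<le> B * (\<bar>\<tau> n\<bar> * R')" using False B by (intro mult_left_mono) auto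
        finally have "\<bar>(Z ((1 + \<tau> n) *\<^sub>R x) - Z x) / \<tau> n\<bar> \<le> B * R'"
          using \<tau>(2)[of n] by (simp add: pos_divide_le_eq mult_ac)
        then have "\<bar>(Z ((1 + \<tau> n) *\<^sub>R x) - Z x) / \<tau> n\<bar> * \<bar>h x\<bar> \<le> B * R' * \<bar>h x\<bar>" by (rule mult_right_mono) simp
        then show ?thesis using False by (simp add: abs_mult)
      qed
    qed
  qed measurable
qed

section \<open>Weak solutions tested with truncations\<close>

lemma bounded_support_finite:
  fixes H :: "'a::euclidean_space \<Rightarrow> 'b::real_normed_vector"
  assumes "\<And>x. norm (H x) \<le> norm (C * indicator (cball 0 R) x :: real)" and r: "0 < r"
  shows "pow_int r H < \<infinity>"
proof -
  have "pow_int r H \<le> pow_int r (\<lambda>x::'a. C * indicator (cball 0 R) x :: real)"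
    using assms by (intro pow_int_mono) auto
  also have "\<dots> < \<infinity>"
  proof -
    have "integrable lborel (\<lambda>x::'a. \<bar>C\<bar> powr r * indicator (cball 0 R) x)"
      by (intro integrable_mult_right integrable_indicator_cball)
    also have "(\<lambda>x::'a. \<bar>C\<bar> powr r * indicator (cball 0 R) x) = (\<lambda>x. norm (C * indicator (cball 0 R) x :: real) powr r)"
      using r by (auto simp: indicator_def)
    finally show ?thesis by (subst pow_int_finite_iff) auto
  qed
  finally show ?thesis .
qed

text \<open>The factor \<open>exp 1\<close> makes the value at the origin 1. Elsewhere the cut-off
  is below 1, but it stays in \<open>[0, 1]\<close> and tends to 1 pointwise, which is enough for
  dominated convergence.\<close>

definition cutoff :: "nat \<Rightarrow> 'a::euclidean_space \<Rightarrow> real" where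
  "cutoff n x = exp 1 * bump ((1 / real (Suc n)) *\<^sub>R x)"

lemma cutoff_test: "cutoff n \<in> test_functions"
proof -
  have "(\<lambda>x::'a. bump ((1 / real (Suc n)) *\<^sub>R x + 0)) \<in> test_functions"
    by (intro test_functions_affine bump_test) auto
  from test_functions_mult[OF this smooth_const[of "exp 1"]] show ?thesis
    by (simp add: cutoff_def[abs_def] mult.commute)
qed

lemma cutoff_nonneg: "0 \<le> cutoff n x"
  by (simp add: cutoff_def bump_nonneg)

lemma cutoff_le_1: "cutoff n x \<le> 1"
proof -
  have "exp 1 * bump ((1 / real (Suc n)) *\<^sub>R x) \<le> exp 1 * exp (- 1)"
    by (intro mult_left_mono bump_le) auto
  also have "\<dots> = 1" by (simp flip: exp_add)
  finally show ?thesis by (simp add: cutoff_def)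
qed

lemma cutoff_tendsto_1:
  fixes x :: "'a::euclidean_space"
  shows "(\<lambda>n. cutoff n x) \<longlonglongrightarrow> 1"
proof -
  have "continuous_on UNIV (bump :: 'a \<Rightarrow> real)"
    by (rule smooth_continuous[OF test_functions_smooth[OF bump_test]])
  then have "isCont bump (0::'a)"
    by (simp add: continuous_on_eq_continuous_at)
  moreover have "(\<lambda>n. (1 / real (Suc n)) *\<^sub>R x) \<longlonglongrightarrow> 0 *\<^sub>R x"
    using LIMSEQ_inverse_real_of_nat by (intro tendsto_scaleR tendsto_const) (simp add: inverse_eq_divide)
  ultimately have "(\<lambda>n. bump ((1 / real (Suc n)) *\<^sub>R x)) \<longlonglongrightarrow> bump (0::'a)"
    by (intro isCont_tendsto_compose[of _ bump]) (simp_all only: scaleR_zero_left)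
  then have "(\<lambda>n. exp 1 * bump ((1 / real (Suc n)) *\<^sub>R x)) \<longlonglongrightarrow> exp 1 * exp (- 1)"
    by (intro tendsto_mult tendsto_const) (simp add: bump_0)
  then show ?thesis by (simp add: cutoff_def flip: exp_add)
qed

text \<open>By scaling, the gradient is of order \<open>1 / n\<close> and lives at distance at most
  of order \<open>n\<close> from the origin. Its product with \<open>norm x\<close> is thus bounded
  uniformly in \<open>n\<close>; this dominates the boundary terms when the cut-off is
  expanded.\<close>

lemma grad_cutoff_bound:
  obtains B where "0 < B" "\<And>n x. norm (grad (cutoff n) (x::'a::euclidean_space)) \<le> B / real (Suc n)"
    "\<And>n x. norm x * norm (grad (cutoff n) (x::'a)) \<le> B"
proof -
  obtain R where R: "R > 0" "\<And>x::'a. norm x > R \<Longrightarrow> grad bump x = 0"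
    using test_functions_obtain[OF bump_test] by metis
  obtain B where B: "B > 0" "\<And>x::'a. norm (grad bump x) \<le> B"
    using continuous_compact_support_bounded[OF smooth_grad_continuous[OF test_functions_smooth[OF bump_test]] R(2)] by metis
  define c where "c n = 1 / real (Suc n)" for n
  have g: "grad (cutoff n) x = (exp 1 * c n) *\<^sub>R grad bump (c n *\<^sub>R x)" for n and x :: 'a
  proof -
    have "grad (cutoff n) x = grad (\<lambda>x. exp 1 * bump (c n *\<^sub>R x + 0)) x" by (simp add: cutoff_def[abs_def] c_def)
    also have "\<dots> = exp 1 *\<^sub>R grad (\<lambda>x. bump (c n *\<^sub>R x + 0)) x"
      by (rule grad_compose[OF smooth_affine[OF test_functions_smooth[OF bump_test]]])
         (auto intro!: derivative_eq_intros)
    finally show ?thesis by (simp add: grad_affine[OF test_functions_smooth[OF bump_test], of "c n" 0, simplified])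
  qed
  have c: "c n > 0" for n by (simp add: c_def)
  have 1: "norm (grad (cutoff n) x) \<le> exp 1 * c n * B" for n and x :: 'a
    unfolding g using B c[of n] by (auto simp: abs_mult intro!: mult_left_mono)
  have 2: "norm x * norm (grad (cutoff n) x) \<le> exp 1 * R * B" for n and x :: 'a
  proof (cases "norm (c n *\<^sub>R x) > R")
    case True
    then show ?thesis using R B by (simp add: g)
  next
    case False
    then have "c n * norm x \<le> R" using c[of n] by simp
    have "norm x * norm (grad (cutoff n) x) \<le> norm x * (exp 1 * c n * B)" by (intro mult_left_mono 1) auto
    also have "\<dots> = exp 1 * (c n * norm x) * B" by simp
    also have "\<dots> \<le> exp 1 * R * B" using B \<open>c n * norm x \<le> R\<close> by (intro mult_right_mono mult_left_mono) auto
    finally show ?thesis .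
  qed
  show ?thesis
  proof (rule that[of "exp 1 * B * max 1 R"])
    have m: "1 \<le> max 1 R" "R \<le> max 1 R" by auto
    show "norm (grad (cutoff n) x) \<le> exp 1 * B * max 1 R / real (Suc n)" for n and x :: 'a
    proof -
      have "exp 1 * c n * B * 1 \<le> exp 1 * c n * B * max 1 R"
        using c[of n] B by (intro mult_left_mono) auto
      then show ?thesis using 1[of n x] by (simp add: c_def mult_ac)
    qed
    show "norm x * norm (grad (cutoff n) x) \<le> exp 1 * B * max 1 R" for n and x :: 'a
    proof -
      have "exp 1 * B * R \<le> exp 1 * B * max 1 R" using B by (intro mult_left_mono) auto
      then show ?thesis using 2[of x n] by (simp add: mult_ac)
    qed
  qed (use B in auto)
qed

text \<open>The equation in Borel form, with one fixed representative \<open>g\<close> of the weak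
  gradient. The growth of \<open>f\<close> is left to the lemmas and no sign of \<open>u\<close> is
  fixed, so that the estimates for \<open>u\<close> apply verbatim to \<open>- u\<close>.\<close>

locale weak_solution =
  fixes u V :: "'a::euclidean_space \<Rightarrow> real" and g :: "'a \<Rightarrow> 'a" and f :: "real \<Rightarrow> real" and p N :: real
  assumes p2: "2 \<le> p" and N_eq: "N = real DIM('a)"
    and V_measurable [measurable]: "V \<in> borel_measurable borel" and V_nonneg: "\<And>x. 0 \<le> V x"
    and f_cont: "continuous_on UNIV f"
    and wg: "weak_gradient u g"
    and fin_u: "pow_int p u < \<infinity>" and fin_g: "pow_int p g < \<infinity>"
    and int_V: "\<And>v. v \<in> test_functions \<Longrightarrow> integrable lborel (\<lambda>x. V x * \<bar>u x\<bar> powr (p - 2) * u x * v x)"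
    and int_f: "\<And>v. v \<in> test_functions \<Longrightarrow> integrable lborel (\<lambda>x. f (u x) * v x)"
    and equation: "\<And>v. v \<in> test_functions \<Longrightarrow>
        (\<integral>x. (norm (g x) powr (p - 2) *\<^sub>R g x) \<bullet> grad v x \<partial>lborel)
          + (\<integral>x. V x * \<bar>u x\<bar> powr (p - 2) * u x * v x \<partial>lborel) = (\<integral>x. f (u x) * v x \<partial>lborel)"
begin

lemma N_pos: "0 < N"
  by (simp add: N_eq)

lemma u_measurable [measurable]: "u \<in> borel_measurable borel"
  and g_measurable [measurable]: "g \<in> borel_measurable borel"
  using wg by (auto simp: weak_gradient_def loc_int_def)

lemma f_measurable [measurable]: "f \<in> borel_measurable borel"
  using f_cont by (rule borel_measurable_continuous_onI)

definition flux :: "'a \<Rightarrow> 'a" where "flux x = norm (g x) powr (p - 2) *\<^sub>R g x"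

definition pot :: "'a \<Rightarrow> real" where "pot x = V x * \<bar>u x\<bar> powr (p - 2) * u x"

lemma flux_measurable [measurable]: "flux \<in> borel_measurable borel"
  unfolding flux_def[abs_def] by measurable

lemma pot_measurable [measurable]: "pot \<in> borel_measurable borel"
  unfolding pot_def[abs_def] by measurable

lemma norm_flux: "norm (flux x) = norm (g x) powr (p - 1)"
  using powr_add[of "norm (g x)" "p - 2" 1] by (cases "g x = 0") (auto simp: flux_def)

lemma flux_inner_g: "flux x \<bullet> g x = norm (g x) powr p"
proof (cases "g x = 0")
  case False
  then show ?thesis using powr_add[of "norm (g x)" "p - 2" 2]
    by (simp add: flux_def power2_norm_eq_inner)
qed (simp add: flux_def)

lemma fin_flux: "pow_int (p / (p - 1)) flux < \<infinity>"
proof -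
  have "norm (flux x) powr (p / (p - 1)) = norm (g x) powr p" for x
    using p2 by (simp add: norm_flux powr_powr)
  then show ?thesis using fin_g by (simp add: pow_int_def)
qed

section \<open>Enlarging the class of test functions\<close>

lemma test_functions_dominate:
  obtains \<phi> m where "\<phi> \<in> test_functions" "0 < m" "\<And>x::'a. x \<in> cball 0 R \<Longrightarrow> m \<le> \<phi> x" "\<And>x. 0 \<le> \<phi> x"
proof
  \<comment> \<open>The radius is doubled so that the rescaled ball lies within
    \<open>norm y \<le> 1 / 2\<close>, where the exponent \<open>- 1 / (1 - |y|^2)\<close> of the
    bump is at least \<open>- 4 / 3\<close>.\<close>
  define r where "r = 2 * (\<bar>R\<bar> + 1)"
  have r: "r > 0" by (simp add: r_def)
  show "(\<lambda>x::'a. bump ((1 / r) *\<^sub>R x + 0)) \<in> test_functions"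
    using r by (intro test_functions_affine bump_test) auto
  show "exp (- 4 / 3) \<le> bump ((1 / r) *\<^sub>R x + 0)" if "x \<in> cball 0 R" for x :: 'a
  proof -
    have "norm x \<le> r / 2" using that by (simp add: r_def)
    then have "norm ((1 / r) *\<^sub>R x) \<le> 1 / 2" using r by (simp add: field_simps)
    then have "norm ((1 / r) *\<^sub>R x) ^ 2 \<le> (1 / 2) ^ 2" by (intro power_mono) auto
    then have *: "((1 / r) *\<^sub>R x) \<bullet> ((1 / r) *\<^sub>R x) \<le> 1 / 4"
      unfolding power2_norm_eq_inner by (simp only: power_one_over) simp
    define y where "y = (1 / r) *\<^sub>R x"
    have "3 / 4 \<le> 1 - y \<bullet> y" using * by (simp add: y_def)
    then have "- 4 / 3 \<le> - 1 / (1 - y \<bullet> y)" by (simp add: field_simps)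
    then show ?thesis using \<open>3 / 4 \<le> 1 - y \<bullet> y\<close> by (simp add: bump_def flat_def flip: y_def)
  qed
qed (auto simp: bump_nonneg)

text \<open>A multiple of a nonnegative test function dominates the indicator of any ball, so
  integrability against test functions is local integrability.\<close>

lemma loc_int_from_tests:
  assumes [measurable]: "h \<in> borel_measurable borel"
    and i: "\<And>v. v \<in> test_functions \<Longrightarrow> integrable lborel (\<lambda>x::'a. h x * v x)"
  shows "loc_int h"
  unfolding loc_int_def
proof (intro conjI allI)
  fix R
  obtain \<phi> m where \<phi>: "\<phi> \<in> test_functions" "0 < m" "\<And>x::'a. x \<in> cball 0 R \<Longrightarrow> m \<le> \<phi> x" "\<And>x. 0 \<le> \<phi> x"
    using test_functions_dominate[where R=R] by metis
  show "integrable lborel (\<lambda>x. indicator (cball 0 R) x *\<^sub>R h x)"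
  proof (rule Bochner_Integration.integrable_bound[OF integrable_mult_left[OF i[OF \<phi>(1)], of "1 / m"]])
    have "norm (indicator (cball 0 R) x *\<^sub>R h x) \<le> norm (h x * \<phi> x * (1 / m))" for x
    proof (cases "x \<in> cball 0 R")
      case True
      have "\<bar>h x\<bar> * m \<le> \<bar>h x\<bar> * \<phi> x" by (intro mult_left_mono \<phi> True) auto
      then show ?thesis using True \<phi>(2) \<phi>(4)[of x] by (simp add: abs_mult field_simps)
    qed simp
    then show "AE x in lborel. norm (indicator (cball 0 R) x *\<^sub>R h x) \<le> norm (h x * \<phi> x * (1 / m))" by simp
  qed measurable
qed simp

lemma loc_int_pot: "loc_int pot"
  using int_V by (intro loc_int_from_tests) (auto simp: pot_def)

lemma loc_int_f: "loc_int (\<lambda>x. f (u x))"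
  using int_f by (intro loc_int_from_tests) auto

lemma loc_int_dominated:
  assumes h: "loc_int (h :: 'a \<Rightarrow> real)" and [measurable]: "\<And>n. v n \<in> borel_measurable borel" "v' \<in> borel_measurable borel"
    and supp: "\<And>n x. norm x > R \<Longrightarrow> v n x = 0" and M: "\<And>n x. \<bar>v n x\<bar> \<le> M"
    and lim: "AE x in lborel. (\<lambda>n. v n x) \<longlonglongrightarrow> v' x"
  shows "integrable lborel (\<lambda>x. h x * v' x)" "(\<lambda>n. \<integral>x. h x * v n x \<partial>lborel) \<longlonglongrightarrow> (\<integral>x. h x * v' x \<partial>lborel)"
proof -
  have [measurable]: "h \<in> borel_measurable borel" using h by (rule loc_int_measurable)
  have i: "integrable lborel (\<lambda>x. M * norm (indicator (cball 0 R) x *\<^sub>R h x))"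
    using h unfolding loc_int_def by (intro integrable_mult_right integrable_norm) auto
  have le: "norm (h x * v n x) \<le> M * norm (indicator (cball 0 R) x *\<^sub>R h x)" for n x
  proof (cases "norm x > R")
    case False
    then show ?thesis using mult_right_mono[OF M[of n x], of "\<bar>h x\<bar>"] by (simp add: abs_mult mult.commute)
  qed (simp add: supp)
  have lim': "AE x in lborel. (\<lambda>n. h x * v n x) \<longlonglongrightarrow> h x * v' x"
    using lim by eventually_elim (intro tendsto_intros)
  show "integrable lborel (\<lambda>x. h x * v' x)"
    by (rule integrable_dominated_convergence[OF _ _ i lim']) (use le in auto)
  show "(\<lambda>n. \<integral>x. h x * v n x \<partial>lborel) \<longlonglongrightarrow> (\<integral>x. h x * v' x \<partial>lborel)"
    by (rule integral_dominated_convergence[OF _ _ i lim']) (use le in auto)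
qed

text \<open>The flux lies in the dual exponent \<open>p / (p - 1)\<close>, so \<open>L^p\<close>
  convergence of the gradients suffices for the first term. For the other two terms only local
  integrability of \<open>pot\<close> and \<open>f (u x)\<close> is at hand, whence the common bound
  \<open>M\<close> and the common support.\<close>

lemma equation_limit:
  assumes v: "\<And>n. v n \<in> test_functions" and supp: "\<And>n x. norm x > R \<Longrightarrow> v n x = 0"
    and M: "\<And>n x. \<bar>v n x\<bar> \<le> M" and lim: "AE x in lborel. (\<lambda>n. v n x) \<longlonglongrightarrow> v' x"
    and [measurable]: "v' \<in> borel_measurable borel" "G \<in> borel_measurable borel" and G: "pow_int p G < \<infinity>"
    and lim_grad: "(\<lambda>n. pow_int p (\<lambda>x. grad (v n) x - G x)) \<longlonglongrightarrow> 0"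
  shows "integrable lborel (\<lambda>x. flux x \<bullet> G x)" "integrable lborel (\<lambda>x. pot x * v' x)"
    "integrable lborel (\<lambda>x. f (u x) * v' x)"
    "(\<integral>x. flux x \<bullet> G x \<partial>lborel) + (\<integral>x. pot x * v' x \<partial>lborel) = (\<integral>x. f (u x) * v' x \<partial>lborel)"
proof -
  note s = test_functions_smooth[OF v]
  note [measurable] = smooth_measurable[OF s] smooth_grad_measurable[OF s]
  have p1: "1 < p" using p2 by simp
  show "integrable lborel (\<lambda>x. flux x \<bullet> G x)"
    by (rule pow_int_holder_integrable[OF _ _ p1 fin_flux G]) measurable
  note P = loc_int_dominated[OF loc_int_pot _ _ supp M lim]
  note Q = loc_int_dominated[OF loc_int_f _ _ supp M lim]
  show "integrable lborel (\<lambda>x. pot x * v' x)" by (rule P(1)) measurable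
  show "integrable lborel (\<lambda>x. f (u x) * v' x)" by (rule Q(1)) measurable
  have "(\<lambda>n. \<integral>x. pot x * v n x \<partial>lborel) \<longlonglongrightarrow> (\<integral>x. pot x * v' x \<partial>lborel)" by (rule P(2)) measurable
  moreover have "(\<lambda>n. \<integral>x. f (u x) * v n x \<partial>lborel) \<longlonglongrightarrow> (\<integral>x. f (u x) * v' x \<partial>lborel)" by (rule Q(2)) measurable
  moreover have "(\<lambda>n. \<integral>x. flux x \<bullet> grad (v n) x \<partial>lborel) \<longlonglongrightarrow> (\<integral>x. flux x \<bullet> G x \<partial>lborel)"
    by (rule pow_int_holder_tendsto[OF _ _ _ p1 fin_flux G lim_grad]) measurable
  ultimately have "(\<lambda>n. (\<integral>x. flux x \<bullet> grad (v n) x \<partial>lborel) + (\<integral>x. pot x * v n x \<partial>lborel)) \<longlonglongrightarrow>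
    (\<integral>x. flux x \<bullet> G x \<partial>lborel) + (\<integral>x. pot x * v' x \<partial>lborel)"
    and "(\<lambda>n. (\<integral>x. f (u x) * v n x \<partial>lborel)) \<longlonglongrightarrow> (\<integral>x. f (u x) * v' x \<partial>lborel)"
    by (auto intro: tendsto_add)
  then show "(\<integral>x. flux x \<bullet> G x \<partial>lborel) + (\<integral>x. pot x * v' x \<partial>lborel) = (\<integral>x. f (u x) * v' x \<partial>lborel)"
    using equation[OF v] by (simp add: flux_def pot_def LIMSEQ_unique)
qed

text \<open>Applies \<open>equation_limit\<close> to \<open>\<phi> x * w n x\<close>. In the
  gradient error, \<open>\<phi>\<close> times the error of \<open>h\<close> vanishes in
  \<open>L^p\<close> by assumption, and the term with \<open>grad \<phi>\<close> by dominated
  convergence, since \<open>v\<close> and \<open>w n\<close> are bounded and \<open>\<phi>\<close>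
  has compact support.\<close>

lemma equation_product:
  assumes w: "smooth_approx p w v h" and M: "\<And>n x. \<bar>w n x\<bar> \<le> M" "\<And>x. \<bar>v x\<bar> \<le> M"
    and [measurable]: "v \<in> borel_measurable borel" and h [measurable]: "h \<in> borel_measurable borel" and fin: "pow_int p h < \<infinity>"
    and \<phi>: "\<phi> \<in> test_functions"
  shows "integrable lborel (\<lambda>x. \<phi> x * (flux x \<bullet> h x))" "integrable lborel (\<lambda>x. v x * (flux x \<bullet> grad \<phi> x))"
    "integrable lborel (\<lambda>x. pot x * (\<phi> x * v x))" "integrable lborel (\<lambda>x. f (u x) * (\<phi> x * v x))"
    "(\<integral>x. \<phi> x * (flux x \<bullet> h x) \<partial>lborel) + (\<integral>x. v x * (flux x \<bullet> grad \<phi> x) \<partial>lborel) + (\<integral>x. pot x * (\<phi> x * v x) \<partial>lborel)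
      = (\<integral>x. f (u x) * (\<phi> x * v x) \<partial>lborel)"
proof -
  have s: "smooth (w n)" for n using w by (simp add: smooth_approx_def)
  have ae: "AE x in lborel. (\<lambda>n. w n x) \<longlonglongrightarrow> v x" using w by (auto simp: smooth_approx_def)
  have s\<phi>: "smooth \<phi>" by (rule test_functions_smooth[OF \<phi>])
  note [measurable] = smooth_measurable[OF s] smooth_grad_measurable[OF s] smooth_measurable[OF s\<phi>] smooth_grad_measurable[OF s\<phi>]
  have p1: "1 < p" "0 \<le> p" "0 < p" using p2 by auto
  obtain R where R: "\<And>x. norm x > R \<Longrightarrow> \<phi> x = 0" "\<And>x. norm x > R \<Longrightarrow> grad \<phi> x = 0"
    using test_functions_obtain[OF \<phi>] by metis
  obtain B where B: "B > 0" "\<And>x. norm (\<phi> x) \<le> B"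
    using continuous_compact_support_bounded[OF smooth_continuous[OF s\<phi>] R(1)] by metis
  obtain B' where B': "B' > 0" "\<And>x. norm (grad \<phi> x) \<le> B'"
    using continuous_compact_support_bounded[OF smooth_grad_continuous[OF s\<phi>] R(2)] by metis
  have M0: "M \<ge> 0" using M(2)[of 0] by linarith
  have fin_ind: "pow_int p (\<lambda>x::'a. C * indicator (cball 0 R) x :: real) < \<infinity>" for C
    by (rule bounded_support_finite[OF order_refl p1(3)])
  have fin1: "pow_int p (\<lambda>x. \<phi> x *\<^sub>R h x) < \<infinity>"
  proof -
    have "pow_int p (\<lambda>x. \<phi> x *\<^sub>R h x) \<le> pow_int p (\<lambda>x. B *\<^sub>R h x)"
      using B p1 by (intro pow_int_mono) (auto intro!: mult_right_mono)
    also have "\<dots> < \<infinity>" using fin by (subst pow_int_cmult) (auto simp: p1 ennreal_mult_less_top)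
    finally show ?thesis .
  qed
  have fin2: "pow_int p (\<lambda>x. v x *\<^sub>R grad \<phi> x) < \<infinity>"
  proof -
    have "pow_int p (\<lambda>x. v x *\<^sub>R grad \<phi> x) \<le> pow_int p (\<lambda>x::'a. (M * B') * indicator (cball 0 R) x :: real)"
    proof (rule pow_int_mono)
      fix x
      show "norm (v x *\<^sub>R grad \<phi> x) \<le> norm ((M * B') * indicator (cball 0 R) x :: real)"
        using R(2)[of x] mult_mono[OF M(2)[of x] B'(2)[of x]] M0 B'(1)
        by (cases "norm x > R") (auto simp: abs_mult)
    qed (use p1 in auto)
    then show ?thesis using fin_ind by (rule le_less_trans)
  qed
  have i1: "integrable lborel (\<lambda>x. flux x \<bullet> (\<phi> x *\<^sub>R h x))" and i2: "integrable lborel (\<lambda>x. flux x \<bullet> (v x *\<^sub>R grad \<phi> x))"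
    by (rule pow_int_holder_integrable[OF _ _ p1(1) fin_flux fin1] pow_int_holder_integrable[OF _ _ p1(1) fin_flux fin2]; measurable)+
  show j1: "integrable lborel (\<lambda>x. \<phi> x * (flux x \<bullet> h x))" and j2: "integrable lborel (\<lambda>x. v x * (flux x \<bullet> grad \<phi> x))"
    using i1 i2 by simp_all
  define vn where "vn n x = \<phi> x * w n x" for n x
  define G where "G x = \<phi> x *\<^sub>R h x + v x *\<^sub>R grad \<phi> x" for x
  have [measurable]: "G \<in> borel_measurable borel" unfolding G_def[abs_def] by measurable
  have finG: "pow_int p G < \<infinity>"
  proof -
    have "pow_int p G \<le> ennreal (2 powr p) * (pow_int p (\<lambda>x. \<phi> x *\<^sub>R h x) + pow_int p (\<lambda>x. v x *\<^sub>R grad \<phi> x))"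
      unfolding G_def[abs_def] by (rule pow_int_add) (use p1 in auto)
    also have "\<dots> < \<infinity>" using fin1 fin2 by (simp add: ennreal_mult_less_top)
    finally show ?thesis .
  qed
  have vt: "vn n \<in> test_functions" for n
    unfolding vn_def[abs_def] by (rule test_functions_mult[OF \<phi> s])
  have gv: "grad (vn n) x - G x = \<phi> x *\<^sub>R (grad (w n) x - h x) + (w n x - v x) *\<^sub>R grad \<phi> x" for n x
    unfolding vn_def[abs_def] grad_mult[OF s\<phi> s] G_def by (simp add: algebra_simps)
  have lim_grad: "(\<lambda>n. pow_int p (\<lambda>x. grad (vn n) x - G x)) \<longlonglongrightarrow> 0"
  proof (rule pow_int_tendsto_0_squeeze)
    show "pow_int p (\<lambda>x. grad (vn n) x - G x) \<le> ennreal (2 powr p) *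
       (ennreal (B powr p) * pow_int p (\<lambda>x. grad (w n) x - h x) + pow_int p (\<lambda>x. (w n x - v x) *\<^sub>R grad \<phi> x))" for n
    proof -
      have "pow_int p (\<lambda>x. \<phi> x *\<^sub>R (grad (w n) x - h x)) \<le> pow_int p (\<lambda>x. B *\<^sub>R (grad (w n) x - h x))"
        using B p1 by (intro pow_int_mono) (auto intro!: mult_right_mono)
      also have "\<dots> = ennreal (B powr p) * pow_int p (\<lambda>x. grad (w n) x - h x)"
        using B(1) by (subst pow_int_cmult) (auto simp: p1)
      finally have 1: "pow_int p (\<lambda>x. \<phi> x *\<^sub>R (grad (w n) x - h x)) \<le> ennreal (B powr p) * pow_int p (\<lambda>x. grad (w n) x - h x)" .
      have "pow_int p (\<lambda>x. grad (vn n) x - G x) \<le> ennreal (2 powr p) *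
        (pow_int p (\<lambda>x. \<phi> x *\<^sub>R (grad (w n) x - h x)) + pow_int p (\<lambda>x. (w n x - v x) *\<^sub>R grad \<phi> x))"
        unfolding gv by (rule pow_int_add) (use p1 in auto)
      also have "\<dots> \<le> ennreal (2 powr p) *
       (ennreal (B powr p) * pow_int p (\<lambda>x. grad (w n) x - h x) + pow_int p (\<lambda>x. (w n x - v x) *\<^sub>R grad \<phi> x))"
        by (intro mult_left_mono add_right_mono 1) auto
      finally show ?thesis .
    qed
    have "(\<lambda>n. ennreal (B powr p) * pow_int p (\<lambda>x. grad (w n) x - h x)) \<longlonglongrightarrow> ennreal (B powr p) * 0"
      using w by (intro ennreal_tendsto_cmult) (auto simp: smooth_approx_def)
    then show "(\<lambda>n. ennreal (B powr p) * pow_int p (\<lambda>x. grad (w n) x - h x)) \<longlonglongrightarrow> 0" by simp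
    show "(\<lambda>n. pow_int p (\<lambda>x. (w n x - v x) *\<^sub>R grad \<phi> x)) \<longlonglongrightarrow> 0"
    proof (rule pow_int_dominated_convergence[OF _ _ p1(3) _ _ fin_ind[of "2 * M * B'"]])
      show "AE x in lborel. (\<lambda>n. (w n x - v x) *\<^sub>R grad \<phi> x) \<longlonglongrightarrow> 0"
        using ae
      proof eventually_elim
        case (elim x)
        from tendsto_scaleR[OF LIM_zero[OF elim] tendsto_const[of "grad \<phi> x"]] show ?case by simp
      qed
      fix n x
      have "\<bar>w n x - v x\<bar> \<le> 2 * M" using M(1)[of n x] M(2)[of x] by linarith
      from mult_mono[OF this B'(2)[of x]]
      show "norm ((w n x - v x) *\<^sub>R grad \<phi> x) \<le> norm (2 * M * B' * indicator (cball 0 R) x :: real)"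
        using R(2)[of x] M0 B'(1) by (cases "norm x > R") (auto simp: abs_mult)
    qed measurable
  qed
  have lim: "AE x in lborel. (\<lambda>n. vn n x) \<longlonglongrightarrow> \<phi> x * v x"
    using ae unfolding vn_def by eventually_elim (intro tendsto_intros)
  have supp: "vn n x = 0" if "norm x > R" for n x using R(1)[OF that] by (simp add: vn_def)
  have bd: "\<bar>vn n x\<bar> \<le> B * M" for n x
    using mult_mono[OF B(2)[of x] M(1)[of n x]] B(1) by (simp add: vn_def abs_mult)
  have [measurable]: "(\<lambda>x. \<phi> x * v x) \<in> borel_measurable borel" by measurable
  note E = equation_limit[OF vt supp bd lim _ _ finG lim_grad]
  show "integrable lborel (\<lambda>x. pot x * (\<phi> x * v x))" by (rule E(2)) measurable
  show "integrable lborel (\<lambda>x. f (u x) * (\<phi> x * v x))" by (rule E(3)) measurable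
  have "(\<integral>x. flux x \<bullet> G x \<partial>lborel) = (\<integral>x. \<phi> x * (flux x \<bullet> h x) \<partial>lborel) + (\<integral>x. v x * (flux x \<bullet> grad \<phi> x) \<partial>lborel)"
    using j1 j2 by (simp add: G_def inner_add_right)
  moreover have "(\<integral>x. flux x \<bullet> G x \<partial>lborel) + (\<integral>x. pot x * (\<phi> x * v x) \<partial>lborel) = (\<integral>x. f (u x) * (\<phi> x * v x) \<partial>lborel)"
    by (rule E(4)) measurable
  ultimately show "(\<integral>x. \<phi> x * (flux x \<bullet> h x) \<partial>lborel) + (\<integral>x. v x * (flux x \<bullet> grad \<phi> x) \<partial>lborel) + (\<integral>x. pot x * (\<phi> x * v x) \<partial>lborel)
      = (\<integral>x. f (u x) * (\<phi> x * v x) \<partial>lborel)" by simp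
qed

lemma flat_measurable [measurable]: "flat m \<in> borel_measurable borel"
  by (intro borel_measurable_continuous_onI flat_continuous)

text \<open>\<open>d * flat 0 ((u - k) / d)\<close> is a smooth substitute for \<open>min (max 0 (u - k)) d\<close>: it vanishes for \<open>u \<le> k\<close>,
  is at least \<open>d / e\<close> for \<open>u \<ge> k + d\<close>, and its slope \<open>flat 2 ((u - k) / d)\<close> lies in \<open>[0, 1]\<close>.\<close>

lemma truncation_approx:
  assumes "0 < d"
  obtains w where "smooth_approx p w (\<lambda>x. d * flat 0 ((u x - k) / d)) (\<lambda>x. flat 2 ((u x - k) / d) *\<^sub>R g x)"
    "\<And>n x. \<bar>w n x\<bar> \<le> d"
proof -
  obtain w where w: "smooth_approx p w u g"
    by (rule weak_gradient_approx[OF wg _ fin_u fin_g]) (use p2 in auto)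
  have "\<bar>d * flat 0 t\<bar> \<le> d" for t
    using assms flat_0_le_1[of t] by (simp add: abs_mult)
  then show ?thesis
    using smooth_approx_flat[OF w _ g_measurable u_measurable fin_g assms] p2 that by auto
qed

text \<open>Tests with a cut-off times the truncation \<open>S\<close>. Where \<open>S\<close> is
  nonzero, \<open>u > k > 0\<close>, so the potential term is nonnegative and is dropped, and
  \<open>f (u x)\<close> is at most \<open>c * u x powr (q - 1)\<close> while
  \<open>S \<le> d\<close>. The bound is linear in \<open>d\<close>, which the level set estimates
  below exploit.\<close>

lemma truncation_energy:
  assumes growth: "\<And>t. 0 < t \<Longrightarrow> f t \<le> c * t powr (q - 1)" and c: "0 < c"
    and k: "0 < k" and d: "0 < d"
    and m: "integrable lborel (\<lambda>x. indicator {x. k < u x} x * u x powr (q - 1))"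
  shows "pow_int p (\<lambda>x. flat 2 ((u x - k) / d) *\<^sub>R g x)
    \<le> ennreal (c * d * (\<integral>x. indicator {x. k < u x} x * u x powr (q - 1) \<partial>lborel))"
proof -
  define S where "S x = d * flat 0 ((u x - k) / d)" for x
  define T where "T x = flat 2 ((u x - k) / d)" for x
  have [measurable]: "S \<in> borel_measurable borel" "T \<in> borel_measurable borel"
    unfolding S_def[abs_def] T_def[abs_def] by measurable
  have T: "0 \<le> T x" "T x \<le> 1" for x by (auto simp: T_def flat_2_le_1)
  have S: "0 \<le> S x" "S x \<le> d" for x
    using d flat_0_le_1[of "(u x - k) / d"] by (auto simp: S_def)
  have S0: "S x = 0" if "u x \<le> k" for x using that d by (simp add: S_def divide_nonpos_pos)
  obtain w where w: "smooth_approx p w S (\<lambda>x. T x *\<^sub>R g x)" "\<And>n x. \<bar>w n x\<bar> \<le> d"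
    using truncation_approx[OF d] unfolding S_def[abs_def] T_def[abs_def] by metis
  have p1: "1 < p" "0 \<le> p" using p2 by auto
  have finT: "pow_int p (\<lambda>x. T x *\<^sub>R g x) < \<infinity>"
    by (rule le_less_trans[OF pow_int_mono fin_g]) (use T p1 in \<open>auto intro!: mult_left_le_one_le\<close>)
  have finS: "pow_int p S < \<infinity>"
  proof -
    \<comment> \<open>\<open>S\<close> vanishes below the level \<open>k\<close> and never exceeds
      \<open>d\<close>, so it lies under a multiple of \<open>u\<close>. This puts it in
      \<open>L^p\<close> without compact support.\<close>
    have "norm (S x) \<le> norm ((d / k) *\<^sub>R u x)" for x
    proof (cases "u x \<le> k")
      case False
      then have "d * k \<le> d * u x" using d by simp
      have "0 < u x" using False k by simp
      have "S x * k \<le> d * k" using S[of x] k by (intro mult_right_mono) auto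
      with \<open>d * k \<le> d * u x\<close> have "S x * k \<le> d * u x" by linarith
      then have "S x \<le> d * u x / k" using k by (simp add: pos_le_divide_eq)
      then show ?thesis using S[of x] k d \<open>0 < u x\<close> by (simp add: abs_mult)
    qed (simp add: S0)
    then have "pow_int p S \<le> pow_int p (\<lambda>x. (d / k) *\<^sub>R u x)" using p1 by (intro pow_int_mono) auto
    also have "\<dots> < \<infinity>" using fin_u by (subst pow_int_cmult) (auto simp: p1 ennreal_mult_less_top)
    finally show ?thesis .
  qed
  define I where "I = (\<integral>x. indicator {x. k < u x} x * u x powr (q - 1) \<partial>lborel)"
  obtain B where B: "0 < B" "\<And>n x. norm (grad (cutoff n) (x::'a)) \<le> B / real (Suc n)" using grad_cutoff_bound by metis
  have fS: "integrable lborel (\<lambda>x. norm (flux x) * \<bar>S x\<bar>)"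
  proof -
    have "integrable lborel (\<lambda>x. norm (norm (flux x)) * norm (S x))"
      by (rule pow_int_holder_integrable[OF _ _ p1(1), where H = "\<lambda>x. norm (flux x)"])
         (use fin_flux finS in \<open>auto simp: pow_int_def\<close>)
    then show ?thesis by simp
  qed
  define J where "J = (\<integral>x. norm (flux x) * \<bar>S x\<bar> \<partial>lborel)"
  have iT: "integrable lborel (\<lambda>x. T x * norm (g x) powr p)"
  proof (rule Bochner_Integration.integrable_bound)
    show "integrable lborel (\<lambda>x. norm (g x) powr p)" using fin_g pow_int_finite_iff[of g] by auto
    show "AE x in lborel. norm (T x * norm (g x) powr p) \<le> norm (norm (g x) powr p)"
      using T by (auto intro!: mult_left_le_one_le)
  qed measurable
  have fact: "(\<integral>x. cutoff n x * (T x * norm (g x) powr p) \<partial>lborel) \<le> c * d * I + B * J * (1 / real (Suc n))" for n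
  proof -
    note E = equation_product[OF w(1) w(2) _ _ _ finT cutoff_test[of n]]
    have ES: "\<And>x. \<bar>S x\<bar> \<le> d" using S by simp
    have j2: "integrable lborel (\<lambda>x. S x * (flux x \<bullet> grad (cutoff n) x))" by (rule E(2)[OF ES]) measurable
    have j4: "integrable lborel (\<lambda>x. f (u x) * (cutoff n x * S x))" by (rule E(4)[OF ES]) measurable
    have eq: "(\<integral>x. cutoff n x * (flux x \<bullet> (T x *\<^sub>R g x)) \<partial>lborel) + (\<integral>x. S x * (flux x \<bullet> grad (cutoff n) x) \<partial>lborel)
       + (\<integral>x. pot x * (cutoff n x * S x) \<partial>lborel) = (\<integral>x. f (u x) * (cutoff n x * S x) \<partial>lborel)"
      by (rule E(5)[OF ES]) measurable
    have "0 \<le> (\<integral>x. pot x * (cutoff n x * S x) \<partial>lborel)"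
    proof (rule integral_nonneg_AE, rule AE_I2)
      fix x
      show "0 \<le> pot x * (cutoff n x * S x)"
      proof (cases "u x \<le> k")
        case False
        then have "0 \<le> pot x" using k V_nonneg by (auto simp: pot_def)
        then show ?thesis using S[of x] cutoff_nonneg[of n x] by auto
      qed (simp add: S0)
    qed
    moreover have "(\<integral>x. f (u x) * (cutoff n x * S x) \<partial>lborel) \<le> (\<integral>x. c * d * (indicator {x. k < u x} x * u x powr (q - 1)) \<partial>lborel)"
    proof (rule integral_mono[OF j4])
      fix x
      show "f (u x) * (cutoff n x * S x) \<le> c * d * (indicator {x. k < u x} x * u x powr (q - 1))"
      proof (cases "u x \<le> k")
        case False
        then have "f (u x) \<le> c * u x powr (q - 1)" using k by (intro growth) auto
        then have "f (u x) * (cutoff n x * S x) \<le> (c * u x powr (q - 1)) * (cutoff n x * S x)"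
          using S cutoff_nonneg by (intro mult_right_mono mult_nonneg_nonneg) auto
        also have "\<dots> \<le> (c * u x powr (q - 1)) * (1 * d)"
          using S cutoff_nonneg[of n x] cutoff_le_1[of n x] c by (intro mult_left_mono mult_mono) auto
        finally show ?thesis using False by (simp add: mult_ac)
      qed (simp add: S0)
    qed (use m in simp)
    \<comment> \<open>The gradient of the cut-off contributes a term of order \<open>1 / n\<close>
      times the fixed integral \<open>J\<close>, finite by the duality of \<open>S\<close> and the
      flux.\<close>
    moreover have "- (\<integral>x. S x * (flux x \<bullet> grad (cutoff n) x) \<partial>lborel) \<le> B * J * (1 / real (Suc n))"
    proof -
      have "- (\<integral>x. S x * (flux x \<bullet> grad (cutoff n) x) \<partial>lborel) \<le> norm (\<integral>x. S x * (flux x \<bullet> grad (cutoff n) x) \<partial>lborel)"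
        by simp
      also have "\<dots> \<le> (\<integral>x. (norm (flux x) * \<bar>S x\<bar>) * (B / real (Suc n)) \<partial>lborel)"
      proof (rule Bochner_Integration.integral_norm_bound_integral[OF j2])
        show "integrable lborel (\<lambda>x. (norm (flux x) * \<bar>S x\<bar>) * (B / real (Suc n)))" using fS by (rule integrable_mult_left)
        fix x
        have "norm (S x * (flux x \<bullet> grad (cutoff n) x)) \<le> \<bar>S x\<bar> * (norm (flux x) * norm (grad (cutoff n) x))"
          by (auto simp: abs_mult Cauchy_Schwarz_ineq2 intro!: mult_left_mono)
        also have "\<dots> \<le> \<bar>S x\<bar> * (norm (flux x) * (B / real (Suc n)))"
          by (intro mult_left_mono B) auto
        finally show "norm (S x * (flux x \<bullet> grad (cutoff n) x)) \<le> (norm (flux x) * \<bar>S x\<bar>) * (B / real (Suc n))"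
          by (simp add: mult_ac)
      qed
      also have "\<dots> = B * J * (1 / real (Suc n))" by (simp add: J_def mult_ac)
      finally show ?thesis .
    qed
    ultimately show ?thesis using eq m by (simp add: flux_inner_g I_def mult_ac)
  qed
  have "(\<lambda>n. \<integral>x. cutoff n x * (T x * norm (g x) powr p) \<partial>lborel) \<longlonglongrightarrow> (\<integral>x. 1 * (T x * norm (g x) powr p) \<partial>lborel)"
  proof (rule integral_dominated_convergence[OF _ _ iT])
    show "AE x in lborel. (\<lambda>n. cutoff n x * (T x * norm (g x) powr p)) \<longlonglongrightarrow> 1 * (T x * norm (g x) powr p)"
      by (intro AE_I2 tendsto_intros cutoff_tendsto_1)
    show "AE x in lborel. norm (cutoff n x * (T x * norm (g x) powr p)) \<le> T x * norm (g x) powr p" for n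
      using T by (intro AE_I2) (auto simp: abs_mult cutoff_nonneg cutoff_le_1 intro!: mult_left_le_one_le)
    have [measurable]: "cutoff n \<in> borel_measurable borel" for n :: nat
      by (intro smooth_measurable test_functions_smooth cutoff_test)
    show "(\<lambda>x. cutoff n x * (T x * norm (g x) powr p)) \<in> borel_measurable lborel" for n by measurable
  qed measurable
  moreover have "(\<lambda>n. c * d * I + B * J * (1 / real (Suc n))) \<longlonglongrightarrow> c * d * I + B * J * 0"
    using LIMSEQ_inverse_real_of_nat by (intro tendsto_intros) (simp add: inverse_eq_divide)
  ultimately have *: "(\<integral>x. T x * norm (g x) powr p \<partial>lborel) \<le> c * d * I"
    using fact by (intro LIMSEQ_le[of _ _ _ "c * d * I"]) auto
  have "pow_int p (\<lambda>x. T x *\<^sub>R g x) \<le> (\<integral>\<^sup>+x. ennreal (T x * norm (g x) powr p) \<partial>lborel)"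
    unfolding pow_int_def
  proof (intro nn_integral_mono ennreal_leI)
    fix x
    \<comment> \<open>The energy bound carries the factor \<open>T\<close>, whereas
      \<open>pow_int\<close> of the truncated gradient carries \<open>T powr p\<close>; the latter
      is smaller because \<open>T\<close> lies in \<open>[0, 1]\<close>.\<close>
    have "T x powr p \<le> T x powr 1" if "T x > 0"
      using T[of x] that p1 by (intro powr_mono') auto
    then have "T x powr p \<le> T x" using T[of x] by (cases "T x = 0") auto
    then show "norm (T x *\<^sub>R g x) powr p \<le> T x * norm (g x) powr p"
      using T[of x] by (simp add: powr_mult mult_right_mono)
  qed
  also have "\<dots> = ennreal (\<integral>x. T x * norm (g x) powr p \<partial>lborel)"
    using T by (intro nn_integral_eq_integral[OF iT]) auto
  also have "\<dots> \<le> ennreal (c * d * I)" using * by (rule ennreal_leI)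
  finally show ?thesis by (simp add: T_def I_def)
qed

end

section \<open>Level sets and boundedness\<close>

lemma half_powr: "0 < k \<Longrightarrow> (k / 2) powr (- R) = 2 powr R * k powr (- R)" for k R :: real
  by (simp add: powr_divide powr_minus field_simps)

text \<open>Stampacchia's iteration. Along the levels \<open>1 + D * (1 - 2 powr (- j))\<close> the
  superlinear exponent \<open>1 + b\<close> beats the growth of \<open>d powr (- \<alpha>)\<close>,
  and \<open>a\<close> decays geometrically; monotonicity carries this to the limit level
  \<open>1 + D\<close>.\<close>

lemma stampacchia:
  fixes a :: "real \<Rightarrow> real"
  assumes nonneg: "\<And>k. 0 \<le> a k" and mono: "\<And>k l. 0 < k \<Longrightarrow> k \<le> l \<Longrightarrow> a l \<le> a k"
    and step: "\<And>k d. 0 < k \<Longrightarrow> 0 < d \<Longrightarrow> a (k + d) \<le> K * d powr (- \<alpha>) * a k powr (1 + b)"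
    and "0 < \<alpha>" "0 < b" "0 < K"
  shows "\<exists>k>0. a k = 0"
proof (cases "a 1 = 0")
  case True
  then show ?thesis by (intro exI[of _ 1]) auto
next
  case False
  then have a1: "a 1 > 0" using nonneg[of 1] by simp
  \<comment> \<open>The rate \<open>\<mu>\<close>, with \<open>\<mu> * b = \<alpha>\<close>,
    balances the powers of \<open>2 powr j\<close> in the induction step; \<open>D\<close> is then
    chosen to make the remaining constant equal to 1.\<close>
  define \<mu> where "\<mu> = \<alpha> / b"
  have \<mu>: "\<mu> > 0" "\<mu> * b = \<alpha>" using assms by (auto simp: \<mu>_def)
  define D where "D = (K * 2 powr (\<alpha> + \<mu>) * a 1 powr b) powr (1 / \<alpha>)"
  have D: "D > 0" using a1 assms by (simp add: D_def)
  have D\<alpha>: "D powr \<alpha> = K * 2 powr (\<alpha> + \<mu>) * a 1 powr b"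
    using a1 assms by (simp add: D_def powr_powr)
  define \<kappa> where "\<kappa> j = 1 + D * (1 - 2 powr (- real j))" for j
  have \<kappa>: "\<kappa> j > 0" "\<kappa> j \<le> 1 + D" for j
  proof -
    have "2 powr (- real j) \<le> (2 :: real) powr 0" by (intro powr_mono) auto
    then have "0 \<le> 1 - 2 powr (- real j)" by simp
    then have "0 \<le> D * (1 - 2 powr (- real j))" using D by (intro mult_nonneg_nonneg) auto
    then show "\<kappa> j > 0" unfolding \<kappa>_def by linarith
    have "D * (1 - 2 powr (- real j)) \<le> D * 1" using D by (intro mult_left_mono) auto
    then show "\<kappa> j \<le> 1 + D" by (simp add: \<kappa>_def)
  qed
  have bound: "a (\<kappa> j) \<le> a 1 * 2 powr (- \<mu> * real j)" for j
  proof (induction j)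
    case 0
    then show ?case by (simp add: \<kappa>_def)
  next
    case (Suc j)
    define d where "d = D * 2 powr (- real j - 1)"
    have d: "d > 0" using D by (simp add: d_def)
    have "(2::real) powr (- real (Suc j)) = 2 powr (- real j - 1)"
      by (rule arg_cong[of _ _ "(powr) 2"]) simp
    moreover have "(2 :: real) powr (- real j) = 2 * 2 powr (- real j - 1)"
      by (simp add: powr_diff)
    ultimately have "\<kappa> (Suc j) = \<kappa> j + d" by (simp add: \<kappa>_def d_def algebra_simps)
    then have "a (\<kappa> (Suc j)) \<le> K * d powr (- \<alpha>) * a (\<kappa> j) powr (1 + b)"
      using step[OF \<kappa>(1) d] by simp
    also have "\<dots> \<le> K * d powr (- \<alpha>) * (a 1 * 2 powr (- \<mu> * real j)) powr (1 + b)"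
      using Suc assms nonneg by (intro mult_left_mono powr_mono2) auto
    also have "\<dots> = K * (D powr (- \<alpha>) * 2 powr ((- real j - 1) * (- \<alpha>))) *
        (a 1 powr (1 + b) * 2 powr (- \<mu> * real j * (1 + b)))"
      using D a1 by (simp add: d_def powr_mult powr_powr)
    also have "\<dots> = K * D powr (- \<alpha>) * (a 1 * a 1 powr b) *
        (2 powr ((- real j - 1) * (- \<alpha>)) * 2 powr (- \<mu> * real j * (1 + b)))"
      using a1 by (simp add: powr_add)
    also have "2 powr ((- real j - 1) * (- \<alpha>)) * 2 powr (- \<mu> * real j * (1 + b))
       = 2 powr (\<alpha> + \<mu>) * 2 powr (- \<mu> * real (Suc j))"
    proof -
      have "\<mu> * (b * real j) = \<alpha> * real j" by (metis \<mu>(2) mult.assoc)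
      moreover have "(- real j - 1) * (- \<alpha>) + (- \<mu> * real j * (1 + b)) = \<alpha> * real j + \<alpha> - \<mu> * real j - \<mu> * (b * real j)"
        by (simp add: algebra_simps)
      moreover have "(\<alpha> + \<mu>) + (- \<mu> * real (Suc j)) = \<alpha> - \<mu> * real j" by (simp add: algebra_simps)
      ultimately have "(- real j - 1) * (- \<alpha>) + (- \<mu> * real j * (1 + b)) = (\<alpha> + \<mu>) + (- \<mu> * real (Suc j))"
        by linarith
      then show ?thesis unfolding powr_add[symmetric] by (rule arg_cong)
    qed
    also have "K * D powr (- \<alpha>) * (a 1 * a 1 powr b) * (2 powr (\<alpha> + \<mu>) * 2 powr (- \<mu> * real (Suc j)))
       = (K * 2 powr (\<alpha> + \<mu>) * a 1 powr b) * D powr (- \<alpha>) * (a 1 * 2 powr (- \<mu> * real (Suc j)))"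
      by (simp add: mult_ac)
    also have "(K * 2 powr (\<alpha> + \<mu>) * a 1 powr b) * D powr (- \<alpha>) = 1"
      using D unfolding D\<alpha>[symmetric] by (simp add: powr_minus)
    finally show ?case by simp
  qed
  have "a (1 + D) \<le> a 1 * 2 powr (- \<mu> * real j)" for j
    using bound[of j] mono[OF \<kappa>] by (meson order_trans)
  moreover have "(\<lambda>j. a 1 * 2 powr (- \<mu> * real j)) \<longlonglongrightarrow> 0"
  proof -
    have "(\<lambda>j. a 1 * (2 powr (- \<mu>)) ^ j) \<longlonglongrightarrow> a 1 * 0"
    proof (intro tendsto_mult tendsto_const LIMSEQ_power_zero)
      have "(2::real) powr (- \<mu>) < 2 powr 0" using \<mu> by (intro powr_less_mono) auto
      then show "norm ((2::real) powr (- \<mu>)) < 1" by simp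
    qed
    moreover have "(2 powr (- \<mu>)) ^ j = 2 powr (- \<mu> * real j)" for j
      by (simp add: powr_realpow[symmetric] powr_powr)
    ultimately show ?thesis by simp
  qed
  ultimately have "a (1 + D) \<le> 0"
    by (intro LIMSEQ_le_const[of _ 0 "a (1 + D)"]) auto
  then show ?thesis using nonneg[of "1 + D"] D by (intro exI[of _ "1 + D"]) auto
qed

context weak_solution
begin

text \<open>The distribution function of \<open>u\<close>. For \<open>k > 0\<close> the set has
  finite measure; for other \<open>k\<close> the value may be the default 0 of
  \<open>measure\<close> on sets of infinite measure, so monotonicity and all upper bounds require
  \<open>0 < k\<close>.\<close>

definition lev :: "real \<Rightarrow> real" where "lev k = measure lborel {x. k < u x}"

lemma unit_ball_vol_nonzero: "unit_ball_vol N \<noteq> 0"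
  by (metis unit_ball_vol_pos N_pos less_imp_le less_irrefl)

lemma lev_sets [measurable]: "{x. k < u x} \<in> sets borel"
  by measurable

lemma lev_markov:
  assumes "0 < k"
  shows "ennreal (k powr p) * emeasure lborel {x. k < u x} \<le> pow_int p u"
proof -
  have "ennreal (k powr p) * emeasure lborel {x. k < u x} = (\<integral>\<^sup>+x. ennreal (k powr p) * indicator {x. k < u x} x \<partial>lborel)"
    by (subst nn_integral_cmult_indicator) auto
  also have "\<dots> \<le> pow_int p u"
    unfolding pow_int_def using assms p2
    by (intro nn_integral_mono) (auto simp: indicator_def intro!: ennreal_leI powr_mono2)
  finally show ?thesis .
qed

lemma lev_finite: "0 < k \<Longrightarrow> emeasure lborel {x. k < u x} < \<infinity>"
  using le_less_trans[OF lev_markov fin_u] by (fastforce simp: ennreal_mult_less_top)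

lemma lev_emeasure: "0 < k \<Longrightarrow> emeasure lborel {x. k < u x} = ennreal (lev k)"
  unfolding lev_def by (rule emeasure_eq_ennreal_measure) (use lev_finite in \<open>auto simp: less_top\<close>)

lemma lev_nonneg: "0 \<le> lev k"
  by (simp add: lev_def)

lemma lev_mono: "0 < k \<Longrightarrow> k \<le> l \<Longrightarrow> lev l \<le> lev k"
  unfolding lev_def using lev_finite[of k]
  by (intro measure_mono_fmeasurable) (auto simp: fmeasurable_def)

lemma lev_decay_p: "\<exists>C>0. \<forall>k>0. lev k \<le> C * k powr (- p)"
proof -
  define I where "I = (\<integral>x. norm (u x) powr p \<partial>lborel)"
  have i: "integrable lborel (\<lambda>x. norm (u x) powr p)" using fin_u pow_int_finite_iff[of u] by auto
  have I0: "I \<ge> 0" by (simp add: I_def)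
  have "lev k \<le> (I + 1) * k powr (- p)" if k: "k > 0" for k
  proof -
    have "ennreal (k powr p * lev k) \<le> ennreal I"
      using lev_markov[OF k] unfolding lev_emeasure[OF k] pow_int_eq_integral[OF i] I_def
      by (simp add: ennreal_mult lev_nonneg)
    then have "k powr p * lev k \<le> I + 1" using I0 by (simp add: ennreal_le_iff)
    then show ?thesis using k by (simp add: powr_minus field_simps)
  qed
  then show ?thesis using I0 by (intro exI[of _ "I + 1"]) auto
qed

text \<open>If \<open>|B\<^sub>\<epsilon>|\<close> is twice the measure of \<open>{u > k}\<close>, then the truncation of \<open>u\<close> vanishes on at least
  half of every ball of radius \<open>\<epsilon>\<close>. Averaging the translation estimate over such balls replaces
  the Sobolev inequality.\<close>

lemma lev_step:
  assumes k: "0 < k" and d: "0 < d" and G0: "0 \<le> G"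
    and G: "pow_int p (\<lambda>x. flat 2 ((u x - k) / d) *\<^sub>R g x) \<le> ennreal G"
  shows "lev (k + d) \<le> 2 powr (p + 1) * (2 / unit_ball_vol N) powr (p / N) * exp p * d powr (- p) * lev k powr (p / N) * G"
proof (cases "lev k = 0")
  case True
  then have "lev (k + d) = 0" using lev_mono[of k "k + d"] lev_nonneg[of "k + d"] k d by simp
  then show ?thesis using G0 True by simp
next
  case False
  then have lk: "lev k > 0" using lev_nonneg[of k] by simp
  define W where "W x = d * flat 0 ((u x - k) / d)" for x
  have [measurable]: "W \<in> borel_measurable borel" unfolding W_def[abs_def] by measurable
  obtain w where w: "smooth_approx p w W (\<lambda>x. flat 2 ((u x - k) / d) *\<^sub>R g x)"
    using truncation_approx[OF d, of k] unfolding W_def[abs_def] by metis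
  define L where "L = d * exp (- 1)"
  have L: "L > 0" using d by (simp add: L_def)
  have W1: "L \<le> W x" if "k + d < u x" for x
  proof -
    have t: "1 < (u x - k) / d" using that d by (simp add: field_simps)
    then have "1 / ((u x - k) / d) \<le> 1" unfolding divide_le_eq_1 by linarith
    then have "exp (- 1) \<le> flat 0 ((u x - k) / d)" using t by (simp add: flat_def)
    then show ?thesis using d by (simp add: L_def W_def)
  qed
  have W0: "W x = 0" if "u x \<le> k" for x using that d by (simp add: W_def divide_nonpos_pos)
  define \<omega> where "\<omega> = unit_ball_vol N"
  have \<omega>: "\<omega> > 0" using N_pos by (simp add: \<omega>_def)
  have N: "N > 0" by (rule N_pos)
  define \<epsilon> where "\<epsilon> = (2 * lev k / \<omega>) powr (1 / N)"
  have \<epsilon>: "\<epsilon> > 0" using lk \<omega> by (simp add: \<epsilon>_def)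
  have "\<epsilon> ^ DIM('a) = \<epsilon> powr N" using \<epsilon> by (simp add: powr_realpow N_eq)
  also have "\<dots> = 2 * lev k / \<omega>" using lk \<omega> N by (simp add: \<epsilon>_def powr_powr)
  finally have "\<omega> * \<epsilon> ^ DIM('a) = 2 * lev k" using \<omega> by simp
  then have "measure lborel (ball (0::'a) \<epsilon>) = 2 * lev k"
    using content_ball[of \<epsilon> "0::'a"] \<epsilon> by (simp add: \<omega>_def N_eq)
  then have ball: "emeasure lborel (ball (0::'a) \<epsilon>) = ennreal (2 * lev k)"
    using emeasure_lborel_ball_finite[of "0::'a" \<epsilon>]
    by (metis emeasure_eq_ennreal_measure infinity_ennreal_def less_irrefl)
  \<comment> \<open>Integrating \<open>\<Phi>\<close> first in \<open>y\<close> gives the lower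
    bound on \<open>{u > k + d}\<close>, integrating first in \<open>x\<close> the translation
    estimate; Tonelli compares the two.\<close>
  define \<Phi> where "\<Phi> x y = indicator (ball 0 \<epsilon>) y * ennreal (norm (W (x + y) - W x) powr p)" for x y :: 'a
  have [measurable]: "ball (0::'a) \<epsilon> \<in> sets borel" by simp
  have lower: "ennreal (L powr p * lev k) * indicator {x. k + d < u x} x \<le> (\<integral>\<^sup>+y. \<Phi> x y \<partial>lborel)" for x
  proof (cases "k + d < u x")
    case True
    \<comment> \<open>The superlevel set as seen from \<open>x\<close>. By translation invariance
      its measure is \<open>lev k\<close>, so at least that much of the ball lies outside
      it.\<close>
    define E where "E = {y. k < u (1 *\<^sub>R y + x)}"
    have [measurable]: "E \<in> sets borel" unfolding E_def by measurable
    have "emeasure lborel E = (\<integral>\<^sup>+y. indicator {z. k < u z} (1 *\<^sub>R y + x) \<partial>lborel)"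
    proof -
      have "(\<lambda>y. indicator {z. k < u z} (1 *\<^sub>R y + x)) = (indicator E :: 'a \<Rightarrow> ennreal)"
        by (auto simp: E_def indicator_def fun_eq_iff)
      then show ?thesis by simp
    qed
    also have "\<dots> = ennreal (lev k)"
      by (subst nn_integral_lborel_affine) (auto simp: lev_emeasure[OF k])
    finally have mE: "emeasure lborel E = ennreal (lev k)" .
    have "emeasure lborel (ball (0::'a) \<epsilon>) \<le> emeasure lborel ((ball 0 \<epsilon> - E) \<union> E)"
      by (intro emeasure_mono) auto
    also have "\<dots> \<le> emeasure lborel (ball 0 \<epsilon> - E) + emeasure lborel E"
      by (intro emeasure_subadditive) auto
    finally have "ennreal (lev k) \<le> emeasure lborel (ball 0 \<epsilon> - E)"
      unfolding ball mE using lk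
      by (cases "emeasure lborel (ball 0 \<epsilon> - E)") (auto simp: ennreal_plus[symmetric] simp del: ennreal_plus)
    then have "ennreal (L powr p * lev k) \<le> ennreal (L powr p) * emeasure lborel (ball 0 \<epsilon> - E)"
      using lk by (simp add: ennreal_mult mult_left_mono)
    also have "\<dots> = (\<integral>\<^sup>+y. ennreal (L powr p) * indicator (ball 0 \<epsilon> - E) y \<partial>lborel)"
      by (subst nn_integral_cmult_indicator) auto
    also have "\<dots> \<le> (\<integral>\<^sup>+y. \<Phi> x y \<partial>lborel)"
    proof (rule nn_integral_mono)
      fix y
      show "ennreal (L powr p) * indicator (ball 0 \<epsilon> - E) y \<le> \<Phi> x y"
      proof (cases "y \<in> ball 0 \<epsilon> - E")
        case y: True
        then have "W (x + y) = 0" by (intro W0) (auto simp: E_def add.commute)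
        moreover have "L powr p \<le> W x powr p" using W1[OF True] L p2 by (intro powr_mono2) auto
        ultimately show ?thesis using y W1[OF True] L by (simp add: \<Phi>_def ennreal_leI)
      qed simp
    qed
    finally show ?thesis using True by simp
  qed simp
  have "ennreal (L powr p * lev k) * ennreal (lev (k + d)) = (\<integral>\<^sup>+x. ennreal (L powr p * lev k) * indicator {x. k + d < u x} x \<partial>lborel)"
    using k d by (subst nn_integral_cmult_indicator) (auto simp: lev_emeasure)
  also have "\<dots> \<le> (\<integral>\<^sup>+x. \<integral>\<^sup>+y. \<Phi> x y \<partial>lborel \<partial>lborel)" by (intro nn_integral_mono lower)
  also have "\<dots> = (\<integral>\<^sup>+y. \<integral>\<^sup>+x. \<Phi> x y \<partial>lborel \<partial>lborel)"
    by (rule lborel_pair.Fubini') (unfold \<Phi>_def, measurable)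
  also have "\<dots> \<le> (\<integral>\<^sup>+y. ennreal (\<epsilon> powr p * 2 powr p * G) * indicator (ball (0::'a) \<epsilon>) y \<partial>lborel)"
  proof (rule nn_integral_mono)
    fix y :: 'a
    show "(\<integral>\<^sup>+x. \<Phi> x y \<partial>lborel) \<le> ennreal (\<epsilon> powr p * 2 powr p * G) * indicator (ball 0 \<epsilon>) y"
    proof (cases "y \<in> ball 0 \<epsilon>")
      case True
      then have "(\<integral>\<^sup>+x. \<Phi> x y \<partial>lborel) = pow_int p (\<lambda>x. W (x + y) - W x)"
        by (simp add: \<Phi>_def pow_int_def)
      also have "\<dots> \<le> ennreal (norm y powr p * 2 powr p) * pow_int p (\<lambda>x. flat 2 ((u x - k) / d) *\<^sub>R g x)"
        by (rule pow_int_translate[OF w]) (use p2 in auto)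
      also have "\<dots> \<le> ennreal (\<epsilon> powr p * 2 powr p) * ennreal G"
        using True p2 by (intro mult_mono G ennreal_leI mult_right_mono powr_mono2) auto
      finally show ?thesis using True G0 by (simp add: ennreal_mult)
    qed (simp add: \<Phi>_def)
  qed
  also have "\<dots> = ennreal (\<epsilon> powr p * 2 powr p * G) * ennreal (2 * lev k)"
    using ball by (subst nn_integral_cmult_indicator) auto
  finally have "ennreal (L powr p * lev k * lev (k + d)) \<le> ennreal (\<epsilon> powr p * 2 powr p * G * (2 * lev k))"
    using lk G0 lev_nonneg by (simp add: ennreal_mult)
  then have "L powr p * lev k * lev (k + d) \<le> \<epsilon> powr p * 2 powr p * G * (2 * lev k)"
    using lk G0 by (subst (asm) ennreal_le_iff) auto
  \<comment> \<open>Both sides carry a factor \<open>lev k\<close>, one from the lower bound and one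
    from the volume of the ball. What remains of the radius is \<open>\<epsilon> powr p\<close>, a
    multiple of \<open>lev k powr (p / N)\<close>: this power is the gain of the estimate.\<close>
  then have "lev k * (L powr p * lev (k + d)) \<le> lev k * (2 * 2 powr p * \<epsilon> powr p * G)" by (simp add: mult_ac)
  then have *: "L powr p * lev (k + d) \<le> 2 * 2 powr p * \<epsilon> powr p * G" using lk by simp
  have "\<epsilon> powr p = (2 / \<omega> * lev k) powr (p / N)" by (simp add: \<epsilon>_def powr_powr)
  also have "\<dots> = (2 / \<omega>) powr (p / N) * lev k powr (p / N)" using \<omega> lk by (subst powr_mult) auto
  finally have e: "\<epsilon> powr p = (2 / \<omega>) powr (p / N) * lev k powr (p / N)" .
  have "L powr p = d powr p * exp (- p)" using d by (simp add: L_def powr_mult exp_powr_real)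
  then have "lev (k + d) = (d powr (- p) * exp p) * (L powr p * lev (k + d))"
    using d by (simp add: powr_minus exp_minus field_simps)
  also have "\<dots> \<le> (d powr (- p) * exp p) * (2 * 2 powr p * \<epsilon> powr p * G)"
    by (intro mult_left_mono *) auto
  also have "\<dots> = 2 powr (p + 1) * (2 / \<omega>) powr (p / N) * exp p * d powr (- p) * lev k powr (p / N) * G"
    unfolding e by (simp add: powr_add mult_ac)
  finally show ?thesis by (simp add: \<omega>_def)
qed

text \<open>The positive part of \<open>u\<close> lies in weak \<open>L^r\<close>. Unlike a strong
  norm, this is a property that level set estimates reproduce directly.\<close>

definition decays :: "real \<Rightarrow> bool" where
  "decays r \<longleftrightarrow> (\<exists>C>0. \<forall>k>0. lev k \<le> C * k powr (- r))"

lemma decays_p: "decays p"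
  unfolding decays_def by (rule lev_decay_p)

text \<open>\<open>lev_step\<close> with level and increment both \<open>k / 2\<close>, the energy
  bounded by that of the whole gradient. The map \<open>r \<mapsto> p + p * r / N\<close> has the
  Sobolev exponent \<open>N * p / (N - p)\<close> as its fixed point.\<close>

lemma decays_sobolev:
  assumes "decays r"
  shows "decays (p + p * r / N)"
proof -
  obtain C where C: "C > 0" "\<And>k. k > 0 \<Longrightarrow> lev k \<le> C * k powr (- r)" using assms by (auto simp: decays_def)
  have i: "integrable lborel (\<lambda>x. norm (g x) powr p)" using fin_g pow_int_finite_iff[of g] by auto
  define G where "G = (\<integral>x. norm (g x) powr p \<partial>lborel) + 1"
  have G: "G > 0" by (simp add: G_def add_nonneg_pos)
  define K where "K = 2 powr (p + 1) * (2 / unit_ball_vol N) powr (p / N) * exp p"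
  have K: "K > 0" unfolding K_def by (intro mult_pos_pos) (auto simp: unit_ball_vol_nonzero)
  have step: "lev k \<le> (K * C powr (p / N) * G * 2 powr (p + p * r / N)) * k powr (- (p + p * r / N))" if k: "k > 0" for k
  proof -
    have k2: "k / 2 > 0" "k / 2 + k / 2 = k" using k by auto
    have "pow_int p (\<lambda>x. flat 2 ((u x - k / 2) / (k / 2)) *\<^sub>R g x) \<le> pow_int p g"
      by (rule pow_int_mono) (use p2 flat_2_le_1 in \<open>auto intro!: mult_left_le_one_le\<close>)
    also have "\<dots> \<le> ennreal G" unfolding pow_int_eq_integral[OF i] G_def by (intro ennreal_leI) simp
    finally have "lev (k / 2 + k / 2) \<le> K * (k / 2) powr (- p) * lev (k / 2) powr (p / N) * G"
      unfolding K_def by (intro lev_step k2) (use G in auto)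
    also have "\<dots> \<le> K * (k / 2) powr (- p) * (C * (k / 2) powr (- r)) powr (p / N) * G"
      using C(2)[OF k2(1)] K G p2 lev_nonneg N_pos by (intro mult_right_mono mult_left_mono powr_mono2) auto
    also have "\<dots> = K * C powr (p / N) * G * ((k / 2) powr (- p) * (k / 2) powr (- r * (p / N)))"
      using k C(1) by (simp add: powr_mult powr_powr)
    also have "(k / 2) powr (- p) * (k / 2) powr (- r * (p / N)) = (k / 2) powr (- (p + p * r / N))"
      by (simp add: powr_add[symmetric] algebra_simps)
    also have "\<dots> = 2 powr (p + p * r / N) * k powr (- (p + p * r / N))"
      by (rule half_powr[OF k])
    finally show ?thesis unfolding k2(2) by (simp add: mult_ac)
  qed
  show ?thesis unfolding decays_def
    by (intro exI[of _ "K * C powr (p / N) * G * 2 powr (p + p * r / N)"] conjI allI impI step)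
       (use K G C in auto)
qed

text \<open>Iterating \<open>decays_sobolev\<close> from \<open>r = p\<close> approaches the fixed
  point \<open>P\<close> with ratio \<open>p / N\<close>. No iterate reaches \<open>P\<close>, but
  the iterates pass every smaller exponent.\<close>

lemma decays_up_to_sobolev_exponent:
  assumes pN: "p < N" and r: "r < N * p / (N - p)"
  shows "\<exists>r'>r. decays r'"
proof -
  define P where "P = N * p / (N - p)"
  have "P * (N - p) = N * p" using pN by (simp add: P_def)
  then have "N * P = N * p + p * P" by (simp add: algebra_simps)
  then have P: "P = p + p * P / N" using N_pos by (simp add: field_simps)
  define t where "t = p / N"
  have t: "0 < t" "t < 1" using pN p2 by (auto simp: t_def)
  have "decays (P - (P - p) * t ^ j)" for j
  proof (induction j)
    case 0
    then show ?case using decays_p by simp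
  next
    case (Suc j)
    have "P - (P - p) * t ^ Suc j = p + p * (P - (P - p) * t ^ j) / N"
    proof -
      have "p + p * (P - (P - p) * t ^ j) / N = (p + t * P) - (P - p) * t ^ Suc j"
        by (simp add: t_def algebra_simps diff_divide_distrib add_divide_distrib)
      moreover have "p + t * P = P" using P by (simp add: t_def)
      ultimately show ?thesis by simp
    qed
    then show ?case using decays_sobolev[OF Suc] by simp
  qed
  moreover have "(\<lambda>j. P - (P - p) * t ^ j) \<longlonglongrightarrow> P - (P - p) * 0"
    using t by (intro tendsto_intros LIMSEQ_power_zero) auto
  then have "eventually (\<lambda>j. r < P - (P - p) * t ^ j) sequentially"
    using r by (intro order_tendstoD) (auto simp: P_def)
  then obtain j where "r < P - (P - p) * t ^ j" by (auto simp: eventually_sequentially)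
  ultimately show ?thesis by blast
qed

text \<open>Layers between the dyadic levels \<open>l n = 2 ^ n * k\<close>: where
  \<open>l n < u x \<le> 2 * l n\<close> the integrand is at most
  \<open>(2 * l n) powr (q - 1)\<close>, and the decay of \<open>lev\<close> turns the sum into a
  geometric series of ratio \<open>2 powr (q - 1 - r) < 1\<close>.\<close>

lemma tail_integral:
  assumes r: "q - 1 < r" and q: "1 < q" and C: "0 < C" "\<And>k. k > 0 \<Longrightarrow> lev k \<le> C * k powr (- r)" and k: "0 < k"
  shows "integrable lborel (\<lambda>x. indicator {x. k < u x} x * u x powr (q - 1))"
    "(\<integral>x. indicator {x. k < u x} x * u x powr (q - 1) \<partial>lborel)
      \<le> C * 2 powr (q - 1) / (1 - 2 powr (q - 1 - r)) * k powr (q - 1 - r)"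
proof -
  let ?h = "\<lambda>x. indicator {x. k < u x} x * u x powr (q - 1)"
  define \<theta> where "\<theta> = (2::real) powr (q - 1 - r)"
  have "\<theta> < 2 powr 0" unfolding \<theta>_def using r by (intro powr_less_mono) auto
  then have \<theta>: "0 < \<theta>" "\<theta> < 1" by (auto simp: \<theta>_def)
  define l where "l n = 2 ^ n * k" for n
  have l: "l n > 0" for n using k by (simp add: l_def)
  have pw: "ennreal (?h x) \<le> (\<Sum>n. ennreal ((2 * l n) powr (q - 1)) * indicator {x. l n < u x} x)" for x
  proof (cases "k < u x")
    case True
    define n where "n = (LEAST n. u x \<le> l (Suc n))"
    have ex: "\<exists>n. u x \<le> l (Suc n)"
    proof -
      obtain n where "u x / k < 2 ^ n" using real_arch_pow[of 2 "u x / k"] by auto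
      then have "u x < 2 ^ n * k" using k by (simp add: field_simps)
      also have "\<dots> \<le> 2 ^ Suc n * k" using k by simp
      finally show ?thesis unfolding l_def by (intro exI[of _ n]) simp
    qed
    have n1: "u x \<le> l (Suc n)" unfolding n_def by (rule LeastI_ex[OF ex])
    have n2: "l n < u x"
    proof (cases n)
      case 0
      then show ?thesis using True by (simp add: l_def)
    next
      case (Suc m)
      then have "\<not> u x \<le> l (Suc m)" using not_less_Least[of m "\<lambda>n. u x \<le> l (Suc n)"] by (simp add: n_def)
      then show ?thesis using Suc by simp
    qed
    have "ennreal (?h x) \<le> ennreal ((2 * l n) powr (q - 1)) * indicator {x. l n < u x} x"
      using True n1 n2 q k l[of n] by (auto simp: l_def intro!: ennreal_leI powr_mono2)
    also have "\<dots> \<le> (\<Sum>n. ennreal ((2 * l n) powr (q - 1)) * indicator {x. l n < u x} x)"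
    proof -
      have "F n \<le> suminf F" for F :: "nat \<Rightarrow> ennreal"
        using sum_le_suminf[OF summableI, of "{n}" F] by simp
      then show ?thesis .
    qed
    finally show ?thesis .
  qed simp
  have trm: "(2 * l n) powr (q - 1) * lev (l n) \<le> C * 2 powr (q - 1) * k powr (q - 1 - r) * \<theta> ^ n" for n
  proof -
    have "(2 * l n) powr (q - 1) * lev (l n) \<le> (2 * l n) powr (q - 1) * (C * l n powr (- r))"
      by (intro mult_left_mono C l) auto
    also have "\<dots> = C * 2 powr (q - 1) * (l n powr (q - 1) * l n powr (- r))"
      using l[of n] by (simp add: powr_mult)
    also have "l n powr (q - 1) * l n powr (- r) = l n powr (q - 1 - r)" by (simp flip: powr_add)
    also have "\<dots> = (2 ^ n) powr (q - 1 - r) * k powr (q - 1 - r)" using k by (simp add: l_def powr_mult)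
    also have "((2::real) ^ n) powr (q - 1 - r) = \<theta> ^ n"
      by (simp add: \<theta>_def powr_realpow[symmetric] powr_powr mult.commute)
    finally show ?thesis by (simp add: mult_ac)
  qed
  have sums: "(\<lambda>n. C * 2 powr (q - 1) * k powr (q - 1 - r) * \<theta> ^ n) sums (C * 2 powr (q - 1) * k powr (q - 1 - r) * (1 / (1 - \<theta>)))"
    using \<theta> by (intro sums_mult geometric_sums) auto
  have "(\<integral>\<^sup>+x. ennreal (?h x) \<partial>lborel) \<le> (\<integral>\<^sup>+x. (\<Sum>n. ennreal ((2 * l n) powr (q - 1)) * indicator {x. l n < u x} x) \<partial>lborel)"
    by (intro nn_integral_mono pw)
  also have "\<dots> = (\<Sum>n. \<integral>\<^sup>+x. ennreal ((2 * l n) powr (q - 1)) * indicator {x. l n < u x} x \<partial>lborel)"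
    by (rule nn_integral_suminf) measurable
  also have "\<dots> = (\<Sum>n. ennreal ((2 * l n) powr (q - 1) * lev (l n)))"
    by (subst nn_integral_cmult_indicator) (auto simp: lev_emeasure[OF l] ennreal_mult lev_nonneg)
  also have "\<dots> \<le> (\<Sum>n. ennreal (C * 2 powr (q - 1) * k powr (q - 1 - r) * \<theta> ^ n))"
    by (intro suminf_le summableI ennreal_leI trm)
  also have "\<dots> = ennreal (\<Sum>n. C * 2 powr (q - 1) * k powr (q - 1 - r) * \<theta> ^ n)"
    using C \<theta> sums by (intro suminf_ennreal2) (auto simp: sums_iff)
  also have "(\<Sum>n. C * 2 powr (q - 1) * k powr (q - 1 - r) * \<theta> ^ n) = C * 2 powr (q - 1) / (1 - \<theta>) * k powr (q - 1 - r)"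
    using sums by (simp add: sums_iff)
  finally have b: "(\<integral>\<^sup>+x. ennreal (?h x) \<partial>lborel) \<le> ennreal (C * 2 powr (q - 1) / (1 - \<theta>) * k powr (q - 1 - r))" .
  show i: "integrable lborel ?h"
    by (rule integrableI_nonneg) (use le_less_trans[OF b, of top] in auto)
  have "0 \<le> C * 2 powr (q - 1) / (1 - \<theta>) * k powr (q - 1 - r)" using C \<theta> by auto
  then show "(\<integral>x. ?h x \<partial>lborel) \<le> C * 2 powr (q - 1) / (1 - 2 powr (q - 1 - r)) * k powr (q - 1 - r)"
    using b nn_integral_eq_integral[OF i] by (simp add: \<theta>_def ennreal_le_iff)
qed

text \<open>Now the energy in \<open>lev_step\<close> is taken from \<open>truncation_energy\<close>
  and \<open>tail_integral\<close>, hence of order \<open>h powr (q - r)\<close> with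
  \<open>h = k / 2\<close>. Collecting powers gives the new exponent, an improvement exactly when
  \<open>p + p * r / N > q\<close>.\<close>

lemma decays_subcritical:
  assumes growth: "\<And>t. 0 < t \<Longrightarrow> f t \<le> c * t powr (q - 1)" and c: "0 < c" and q: "1 < q"
    and r: "q - 1 < r" and dec: "decays r"
  shows "decays (r + (p + p * r / N - q))"
proof -
  obtain C where C: "C > 0" "\<And>k. k > 0 \<Longrightarrow> lev k \<le> C * k powr (- r)" using dec by (auto simp: decays_def)
  define D where "D = C * 2 powr (q - 1) / (1 - 2 powr (q - 1 - r))"
  have "(2::real) powr (q - 1 - r) < 2 powr 0" using r by (intro powr_less_mono) auto
  then have D: "D > 0" using C(1) by (simp add: D_def)
  have T: "integrable lborel (\<lambda>x. indicator {x. k < u x} x * u x powr (q - 1))"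
    "(\<integral>x. indicator {x. k < u x} x * u x powr (q - 1) \<partial>lborel) \<le> D * k powr (q - 1 - r)" if "0 < k" for k
    unfolding D_def by (rule tail_integral[OF r q C(1) _ that]; rule C(2); assumption)+
  define K where "K = 2 powr (p + 1) * (2 / unit_ball_vol N) powr (p / N) * exp p"
  have K: "K > 0" unfolding K_def by (intro mult_pos_pos) (auto simp: unit_ball_vol_nonzero)
  define R where "R = r + (p + p * r / N - q)"
  have step: "lev k \<le> (K * C powr (p / N) * c * D * 2 powr R) * k powr (- R)" if k: "k > 0" for k
  proof -
    define h where "h = k / 2"
    have h: "h > 0" "h + h = k" using k by (auto simp: h_def)
    define M where "M = (\<integral>x. indicator {x. h < u x} x * u x powr (q - 1) \<partial>lborel)"
    have M: "0 \<le> M" "M \<le> D * h powr (q - 1 - r)" using T(2)[OF h(1)] by (auto simp: M_def)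
    have "lev (h + h) \<le> K * h powr (- p) * lev h powr (p / N) * (c * h * M)"
      unfolding K_def M_def
      by (intro lev_step h truncation_energy growth c T(1)) (use c h M in \<open>auto simp: M_def\<close>)
    also have "\<dots> \<le> K * h powr (- p) * (C * h powr (- r)) powr (p / N) * (c * h * (D * h powr (q - 1 - r)))"
      using C(2)[OF h(1)] K M p2 c h lev_nonneg N_pos
      by (intro mult_mono mult_left_mono powr_mono2 mult_nonneg_nonneg) auto
    also have "\<dots> = K * C powr (p / N) * c * D * (h powr (- p) * h powr (- r * (p / N)) * (h powr 1 * h powr (q - 1 - r)))"
      using h C(1) by (simp add: powr_mult powr_powr)
    also have "h powr (- p) * h powr (- r * (p / N)) * (h powr 1 * h powr (q - 1 - r)) = h powr (- R)"
      unfolding powr_add[symmetric] by (rule arg_cong[of _ _ "(powr) h"]) (simp add: R_def algebra_simps)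
    also have "\<dots> = 2 powr R * k powr (- R)"
      unfolding h_def by (rule half_powr[OF k])
    finally show ?thesis unfolding h(2) by (simp add: mult_ac)
  qed
  have "decays R" unfolding decays_def
    by (intro exI[of _ "K * C powr (p / N) * c * D * 2 powr R"] conjI allI impI step)
       (use K D c C in auto)
  then show ?thesis by (simp add: R_def)
qed

text \<open>The gain of \<open>decays_subcritical\<close> at \<open>r\<close> is positive if
  \<open>r > N * (q - p) / p\<close>. Such an \<open>r\<close> exists below the Sobolev exponent
  because \<open>q\<close> is itself below it. The gain increases with \<open>r\<close>, so it stays
  at least \<open>\<delta>\<close> in every round and any given exponent is passed.\<close>

lemma decays_all:
  assumes growth: "\<And>t. 0 < t \<Longrightarrow> f t \<le> c * t powr (q - 1)" and c: "0 < c"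
    and pN: "p < N" and pq: "p < q" and q: "q < N * p / (N - p)"
  shows "\<exists>r'>r. decays r'"
proof -
  have q1: "1 < q" using p2 pq by simp
  \<comment> \<open>After clearing denominators this is the subcriticality
    \<open>q * (N - p) < N * p\<close> again.\<close>
  have "N * (q - p) / p < N * p / (N - p)"
  proof -
    have "q * (N - p) < N * p" using q pN by (simp add: pos_less_divide_eq)
    then have "(q - p) * (N - p) < p * p" by (simp add: algebra_simps)
    then have "N * (q - p) * (N - p) < N * p * p"
      using mult_strict_left_mono[OF _ N_pos, of "(q - p) * (N - p)" "p * p"] by (simp add: mult_ac)
    then show ?thesis using pN p2 by (simp add: divide_simps mult_ac)
  qed
  then have "max (q - 1) (N * (q - p) / p) < N * p / (N - p)" using q by simp
  from decays_up_to_sobolev_exponent[OF pN this] obtain r0 where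
    r0: "q - 1 < r0" "N * (q - p) / p < r0" "decays r0" by auto
  define \<delta> where "\<delta> = p + p * r0 / N - q"
  have "N * (q - p) < r0 * p" using r0(2) p2 by (simp add: pos_divide_less_eq)
  then have "q - p < r0 * p / N" using N_pos by (simp add: pos_less_divide_eq mult.commute)
  then have \<delta>: "\<delta> > 0" by (simp add: \<delta>_def mult.commute)
  have "\<exists>r'. r0 + real j * \<delta> \<le> r' \<and> decays r'" for j
  proof (induction j)
    case 0
    then show ?case using r0 by auto
  next
    case (Suc j)
    then obtain r' where r': "r0 + real j * \<delta> \<le> r'" "decays r'" by blast
    have "0 \<le> real j * \<delta>" using \<delta> by simp
    then have r0r: "r0 \<le> r'" using r'(1) by linarith
    then have "p * r0 / N \<le> p * r' / N" using p2 N_pos by (intro divide_right_mono mult_left_mono) auto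
    then have "\<delta> \<le> p + p * r' / N - q" by (simp add: \<delta>_def)
    moreover have "real (Suc j) * \<delta> = real j * \<delta> + \<delta>" by (simp add: algebra_simps)
    ultimately have "r0 + real (Suc j) * \<delta> \<le> r' + (p + p * r' / N - q)"
      using r'(1) by linarith
    moreover have "decays (r' + (p + p * r' / N - q))"
      by (rule decays_subcritical[OF growth c q1 _ r'(2)]) (use r0 r0r in auto)
    ultimately show ?case by blast
  qed
  moreover obtain j where "r - r0 < real j * \<delta>" using reals_Archimedean3[OF \<delta>] by blast
  ultimately show ?thesis by (smt (verit, best))
qed

text \<open>With fast decay at hand the tail integral is nearly proportional to
  \<open>lev k\<close>, and \<open>lev_step\<close> becomes a recursion with exponent
  \<open>1 + b\<close>, \<open>b > 0\<close>. In \<open>stampacchia\<close> one has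
  \<open>\<alpha> = p - 1\<close>, because the energy bound is linear in \<open>d\<close> and
  absorbs one power of \<open>d powr (- p)\<close>.\<close>

lemma bounded_above:
  assumes growth: "\<And>t. 0 < t \<Longrightarrow> f t \<le> c * t powr (q - 1)" and c: "0 < c"
    and pN: "p < N" and pq: "p < q" and q: "q < N * p / (N - p)"
  shows "\<exists>M. AE x in lborel. u x \<le> M"
proof -
  have q1: "1 < q" using p2 pq by simp
  \<comment> \<open>Large enough for both \<open>q - 1 < r\<close>, used by the tail integral, and
    \<open>N * (q - 1) / p < r\<close>, which says \<open>b > 0\<close>.\<close>
  obtain r where r: "2 * N * (q - 1) / p + (q - 1) < r" "decays r"
    using decays_all[OF assms] by blast
  have "0 \<le> 2 * N * (q - 1) / p" using q1 p2 N_pos by (intro divide_nonneg_nonneg mult_nonneg_nonneg) auto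
  then have r1: "q - 1 < r" "0 < r" using r(1) q1 by linarith+
  define b where "b = p / N - (q - 1) / r"
  have b: "b > 0"
  proof -
    have "N * (q - 1) / p < r"
    proof -
      have "0 \<le> N * (q - 1) / p" using q1 p2 N_pos by (intro divide_nonneg_nonneg mult_nonneg_nonneg) auto
      moreover have "2 * N * (q - 1) / p = 2 * (N * (q - 1) / p)" by simp
      ultimately show ?thesis using r(1) q1 by linarith
    qed
    then have "N * (q - 1) < r * p" using p2 by (simp add: pos_divide_less_eq)
    then have "(q - 1) / r < p / N" using r1 p2 N_pos by (simp add: divide_simps mult_ac)
    then show ?thesis by (simp add: b_def)
  qed
  obtain C where C: "C > 0" "\<And>k. k > 0 \<Longrightarrow> lev k \<le> C * k powr (- r)" using r(2) by (auto simp: decays_def)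
  define D where "D = C * 2 powr (q - 1) / (1 - 2 powr (q - 1 - r))"
  have "(2::real) powr (q - 1 - r) < 2 powr 0" using r1 by (intro powr_less_mono) auto
  then have D: "D > 0" using C(1) by (simp add: D_def)
  have T: "integrable lborel (\<lambda>x. indicator {x. k < u x} x * u x powr (q - 1))"
    "(\<integral>x. indicator {x. k < u x} x * u x powr (q - 1) \<partial>lborel) \<le> D * k powr (q - 1 - r)" if "0 < k" for k
    unfolding D_def by (rule tail_integral[OF r1(1) q1 C(1) _ that]; rule C(2); assumption)+
  define K where "K = 2 powr (p + 1) * (2 / unit_ball_vol N) powr (p / N) * exp p"
  have K: "K > 0" unfolding K_def by (intro mult_pos_pos) (auto simp: unit_ball_vol_nonzero)
  have step: "lev (k + d) \<le> (K * c * (1 + D)) * d powr (- (p - 1)) * lev k powr (1 + b)" if k: "0 < k" and d: "0 < d" for k d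
  proof (cases "lev k = 0")
    case True
    then have "lev (k + d) = 0" using lev_mono[of k "k + d"] lev_nonneg[of "k + d"] k d by simp
    then show ?thesis using True by simp
  next
    case False
    then have lk: "lev k > 0" using lev_nonneg[of k] by simp
    \<comment> \<open>The height \<open>L\<close> balances two parts of the integral: values up to
      \<open>L\<close> contribute at most \<open>L powr (q - 1) * lev k\<close>, larger ones at most
      \<open>D * L powr (q - 1 - r)\<close>, and both are multiples of
      \<open>lev k powr (1 - (q - 1) / r)\<close>.\<close>
    define L where "L = lev k powr (- 1 / r)"
    have L: "L > 0" using lk by (simp add: L_def)
    define M where "M k = (\<integral>x. indicator {x. k < u x} x * u x powr (q - 1) \<partial>lborel)" for k
    have "M k \<le> (\<integral>x. L powr (q - 1) * indicator {x. k < u x} x + indicator {x. L < u x} x * u x powr (q - 1) \<partial>lborel)"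
      unfolding M_def
    proof (rule integral_mono[OF T(1)[OF k]])
      show "integrable lborel (\<lambda>x. L powr (q - 1) * indicator {x. k < u x} x + indicator {x. L < u x} x * u x powr (q - 1))"
        using lev_finite[OF k] T(1)[OF L]
        by (intro Bochner_Integration.integrable_add integrable_mult_right integrable_real_indicator) auto
      show "indicator {x. k < u x} x * u x powr (q - 1)
         \<le> L powr (q - 1) * indicator {x. k < u x} x + indicator {x. L < u x} x * u x powr (q - 1)" for x
        using k q1 by (auto simp: indicator_def intro!: powr_mono2)
    qed
    also have "\<dots> = L powr (q - 1) * lev k + M L"
      using lev_finite[OF k] T(1)[OF L]
      by (subst Bochner_Integration.integral_add) (auto simp: M_def lev_def)
    also have "\<dots> \<le> L powr (q - 1) * lev k + D * L powr (q - 1 - r)"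
      using T(2)[OF L] by (simp add: M_def)
    also have "L powr (q - 1) * lev k = lev k powr (1 - (q - 1) / r)"
    proof -
      have "L powr (q - 1) = lev k powr (- ((q - 1) / r))" by (simp add: L_def powr_powr)
      then have "L powr (q - 1) * lev k = lev k powr (- ((q - 1) / r)) * lev k powr 1" using lk by simp
      then show ?thesis by (simp only: powr_add[symmetric]) simp
    qed
    also have "L powr (q - 1 - r) = lev k powr (1 - (q - 1) / r)"
    proof -
      have "- 1 / r * (q - 1 - r) = 1 - (q - 1) / r" using r1 by (simp add: field_simps)
      then show ?thesis by (simp only: L_def powr_powr)
    qed
    finally have Mk: "M k \<le> (1 + D) * lev k powr (1 - (q - 1) / r)" by (simp add: algebra_simps)
    have M0: "0 \<le> M k" by (simp add: M_def)
    have "lev (k + d) \<le> K * d powr (- p) * lev k powr (p / N) * (c * d * M k)"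
      unfolding K_def M_def
      by (intro lev_step k d truncation_energy growth c T(1)) (use c d M0 in \<open>auto simp: M_def\<close>)
    also have "\<dots> \<le> K * d powr (- p) * lev k powr (p / N) * (c * d * ((1 + D) * lev k powr (1 - (q - 1) / r)))"
      using Mk K c d by (intro mult_left_mono) auto
    also have "\<dots> = (K * c * (1 + D)) * (d powr (- p) * d powr 1) * (lev k powr (p / N) * lev k powr (1 - (q - 1) / r))"
      using d by (simp add: mult_ac)
    also have "\<dots> = (K * c * (1 + D)) * d powr (- (p - 1)) * lev k powr (1 + b)"
      unfolding powr_add[symmetric] by (simp add: b_def algebra_simps)
    finally show ?thesis .
  qed
  have "\<exists>k>0. lev k = 0"
    by (rule stampacchia[OF lev_nonneg lev_mono step]) (use p2 b K c D in auto)
  then obtain k where k: "k > 0" "lev k = 0" by blast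
  then have "emeasure lborel {x. k < u x} = 0" using lev_emeasure by simp
  then have "AE x in lborel. \<not> k < u x"
    by (subst AE_iff_measurable[of "{x. k < u x}"]) auto
  then show ?thesis by (intro exI[of _ k]) (auto simp: not_less)
qed

end

section \<open>The dilation variation of a bounded solution\<close>

text \<open>\<open>bound\<close> holds at every point, so that mollification inherits it.
  \<open>F\<close> may be any primitive: a constant does not affect the local identity, since
  \<open>N * \<phi> x + grad \<phi> x \<bullet> x\<close> is the divergence of
  \<open>\<phi> x *\<^sub>R x\<close> and integrates to 0.\<close>

locale bounded_solution = weak_solution u V g f p N
  for u V :: "'a::euclidean_space \<Rightarrow> real" and g :: "'a \<Rightarrow> 'a" and f :: "real \<Rightarrow> real" and p N :: real +
  fixes M :: real and F :: "real \<Rightarrow> real"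
  assumes bound: "\<And>x. \<bar>u x\<bar> \<le> M"
    and V_square: "\<And>R. integrable lborel (\<lambda>x. indicator (cball 0 R) x * (V x)\<^sup>2)"
    and F: "\<And>t. (F has_real_derivative f t) (at t)"
begin

lemma p1: "1 < p" "1 \<le> p" "0 < p" "0 \<le> p"
  using p2 by auto

lemma F_cont: "continuous_on A F"
  using F by (meson DERIV_isCont continuous_at_imp_continuous_on)

lemma F_measurable [measurable]: "F \<in> borel_measurable borel"
  by (rule borel_measurable_continuous_onI[OF F_cont])

lemma continuous_bounded_values:
  assumes "continuous_on UNIV (h :: real \<Rightarrow> real)"
  obtains K where "0 < K" "\<And>t. \<bar>t\<bar> \<le> M \<Longrightarrow> \<bar>h t\<bar> \<le> K"
proof -
  have "compact (h ` {-M..M})"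
    by (intro compact_continuous_image continuous_on_subset[OF assms]) auto
  then obtain K where K: "\<And>y. y \<in> h ` {-M..M} \<Longrightarrow> norm y \<le> K" using compact_imp_bounded bounded_iff by metis
  have "\<bar>h t\<bar> \<le> max K 1" if "\<bar>t\<bar> \<le> M" for t
    using K[of "h t"] that by (auto simp: abs_le_iff)
  then show ?thesis by (intro that[of "max K 1"]) auto
qed

lemma approx:
  obtains w where "smooth_approx p w u g" "\<And>n x. \<bar>w n x\<bar> \<le> M"
  by (rule weak_gradient_approx[OF wg _ fin_u fin_g]) (use p1 bound in auto)

text \<open>The difference quotient converges in \<open>L^p\<close> on balls. Since \<open>H\<close>
  is supported in one, the indicator can be inserted, and the duality of \<open>L^p\<close> with its
  dual exponent does the rest.\<close>

lemma quotient_tendsto: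
  assumes [measurable]: "H \<in> borel_measurable borel" and H: "pow_int (p / (p - 1)) (H :: 'a \<Rightarrow> real) < \<infinity>"
    and supp: "\<And>x. norm x > R \<Longrightarrow> H x = 0" and \<tau>: "\<tau> \<longlonglongrightarrow> 0" "\<And>n. \<tau> n \<noteq> 0"
  shows "(\<lambda>n. \<integral>x. H x * ((u ((1 + \<tau> n) *\<^sub>R x) - u x) / \<tau> n) \<partial>lborel) \<longlonglongrightarrow> (\<integral>x. H x * (g x \<bullet> x) \<partial>lborel)"
    "integrable lborel (\<lambda>x. H x * (g x \<bullet> x))"
proof -
  define R' where "R' = \<bar>R\<bar>"
  have supp': "H x = 0" if "norm x > R'" for x using that by (intro supp) (simp add: R'_def)
  obtain w where w: "smooth_approx p w u g" using approx by metis
  have lim: "(\<lambda>n. pow_int p (\<lambda>x. indicator (cball 0 R') x * ((u ((1 + \<tau> n) *\<^sub>R x) - u x) / \<tau> n)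
      - indicator (cball 0 R') x * (g x \<bullet> x))) \<longlonglongrightarrow> 0"
    by (rule difference_quotient_tendsto[OF w p1(2) _ _ _ fin_g \<tau>]) (auto simp: R'_def)
  have fin: "pow_int p (\<lambda>x. indicator (cball 0 R') x * (g x \<bullet> x) :: real) < \<infinity>"
  proof -
    have "norm (indicator (cball 0 R') x * (g x \<bullet> x) :: real) \<le> norm (R' *\<^sub>R g x)" for x
    proof (cases "norm x \<le> R'")
      case True
      have "\<bar>g x \<bullet> x\<bar> \<le> norm (g x) * norm x" by (rule Cauchy_Schwarz_ineq2)
      also have "\<dots> \<le> norm (g x) * R'" using True by (intro mult_left_mono) auto
      finally show ?thesis using True by (simp add: R'_def mult.commute)
    qed simp
    then have "pow_int p (\<lambda>x. indicator (cball 0 R') x * (g x \<bullet> x) :: real) \<le> pow_int p (\<lambda>x. R' *\<^sub>R g x)"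
      using p1 by (intro pow_int_mono) auto
    also have "\<dots> < \<infinity>" using fin_g by (subst pow_int_cmult) (auto simp: p1 ennreal_mult_less_top)
    finally show ?thesis .
  qed
  have eq: "H x \<bullet> (indicator (cball 0 R') x * y) = H x * y" for x y
    using supp'[of x] by (cases "norm x > R'") auto
  show "(\<lambda>n. \<integral>x. H x * ((u ((1 + \<tau> n) *\<^sub>R x) - u x) / \<tau> n) \<partial>lborel) \<longlonglongrightarrow> (\<integral>x. H x * (g x \<bullet> x) \<partial>lborel)"
    using pow_int_holder_tendsto[OF _ _ _ p1(1) H fin lim] unfolding eq by simp
  show "integrable lborel (\<lambda>x. H x * (g x \<bullet> x))"
    using pow_int_holder_integrable(2)[OF _ _ p1(1) H fin] unfolding eq by simp
qed

lemma loc_int_1: "loc_int (\<lambda>x::'a. 1::real)"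
  by (simp add: loc_int_def)

text \<open>Integration by parts for the field \<open>F (u x) * \<phi> x\<close> times
  \<open>x\<close>, whose divergence is not classical. For a smooth approximant \<open>w n\<close>
  it is read off from scaling; boundedness of \<open>f\<close> and \<open>F\<close> on
  \<open>[- M, M]\<close> then permits the limit.\<close>

lemma reaction_identity:
  assumes \<phi>: "\<phi> \<in> test_functions"
  shows "(\<integral>x. f (u x) * \<phi> x * (g x \<bullet> x) \<partial>lborel) = - (\<integral>x. F (u x) * (N * \<phi> x + grad \<phi> x \<bullet> x) \<partial>lborel)"
proof -
  have s\<phi>: "smooth \<phi>" by (rule test_functions_smooth[OF \<phi>])
  obtain R where R: "\<And>x. norm x > R \<Longrightarrow> \<phi> x = 0" "\<And>x. norm x > R \<Longrightarrow> grad \<phi> x = 0" "R > 0"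
    using test_functions_obtain[OF \<phi>] by metis
  obtain B where B: "B > 0" "\<And>x. norm (\<phi> x) \<le> B"
    using continuous_compact_support_bounded[OF smooth_continuous[OF s\<phi>] R(1)] by metis
  obtain B' where B': "B' > 0" "\<And>x. norm (grad \<phi> x) \<le> B'"
    using continuous_compact_support_bounded[OF smooth_grad_continuous[OF s\<phi>] R(2)] by metis
  obtain w where w: "smooth_approx p w u g" and wM: "\<And>n x. \<bar>w n x\<bar> \<le> M" using approx by metis
  have s: "smooth (w n)" for n using w by (simp add: smooth_approx_def)
  have ae: "AE x in lborel. (\<lambda>n. w n x) \<longlonglongrightarrow> u x" using w by (auto simp: smooth_approx_def)
  note [measurable] = smooth_measurable[OF s] smooth_grad_measurable[OF s] smooth_measurable[OF s\<phi>] smooth_grad_measurable[OF s\<phi>]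
  obtain K where K: "0 < K" "\<And>t. \<bar>t\<bar> \<le> M \<Longrightarrow> \<bar>f t\<bar> \<le> K" using continuous_bounded_values[OF f_cont] by metis
  obtain K' where K': "0 < K'" "\<And>t. \<bar>t\<bar> \<le> M \<Longrightarrow> \<bar>F t\<bar> \<le> K'" using continuous_bounded_values[OF F_cont] by metis
  define G where "G n x = (f (w n x) * \<phi> x) *\<^sub>R grad (w n) x + F (w n x) *\<^sub>R grad \<phi> x" for n x
  have id_n: "(\<integral>x. G n x \<bullet> x \<partial>lborel) = - N * (\<integral>x. F (w n x) * \<phi> x \<partial>lborel)" for n
  proof -
    define Z where "Z x = F (w n x) * \<phi> x" for x
    have Zd: "(Z has_derivative (\<lambda>k. G n x \<bullet> k)) (at x)" for x
    proof -
      have "(F has_derivative (*) (f (w n x))) (at (w n x))" using F by (simp add: has_field_derivative_def)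
      from has_derivative_compose[OF smooth_has_derivative[OF s] this]
      have "((\<lambda>x. F (w n x)) has_derivative (\<lambda>k. f (w n x) * (grad (w n) x \<bullet> k))) (at x)" .
      from has_derivative_mult[OF this smooth_has_derivative[OF s\<phi>]]
      have "(Z has_derivative (\<lambda>k. F (w n x) * (grad \<phi> x \<bullet> k) + f (w n x) * (grad (w n) x \<bullet> k) * \<phi> x)) (at x)"
        unfolding Z_def[abs_def] .
      also have "(\<lambda>k. F (w n x) * (grad \<phi> x \<bullet> k) + f (w n x) * (grad (w n) x \<bullet> k) * \<phi> x) = (\<lambda>k. G n x \<bullet> k)"
        by (auto simp: G_def inner_add_left mult_ac)
      finally show ?thesis .
    qed
    have cG: "continuous_on UNIV (G n)"
      unfolding G_def
      by (intro continuous_intros continuous_on_compose2[OF f_cont] continuous_on_compose2[OF F_cont[of UNIV]]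
          smooth_continuous s s\<phi> smooth_grad_continuous) auto
    have supp: "Z x = 0" "G n x = 0" if "norm x > R" for x using R that by (auto simp: Z_def G_def)
    define \<tau> where "\<tau> m = 1 / real (Suc m)" for m
    have \<tau>: "\<tau> \<longlonglongrightarrow> 0" "\<And>m. \<tau> m \<noteq> 0" "\<And>m. - 1 / 2 \<le> \<tau> m" "\<And>m. 0 < \<tau> m"
      using LIMSEQ_inverse_real_of_nat by (auto simp: \<tau>_def[abs_def] inverse_eq_divide intro: order_trans[of _ 0])
    have [measurable]: "Z \<in> borel_measurable borel" unfolding Z_def[abs_def] by measurable
    have iZ: "integrable lborel Z"
    proof -
      have "integrable lborel (\<lambda>x. Z x *\<^sub>R (1::real))"
      proof (rule loc_int_mult_integrable[OF loc_int_1 _ _ supp(1)])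
        show "\<bar>Z x\<bar> \<le> K' * B" for x
          using mult_mono[OF K'(2)[OF wM] B(2)] K' by (auto simp: Z_def abs_mult)
      qed auto
      then show ?thesis by simp
    qed
    have 1: "(\<lambda>m. \<integral>x. (Z ((1 + \<tau> m) *\<^sub>R x) - Z x) / \<tau> m * 1 \<partial>lborel) \<longlonglongrightarrow> (\<integral>x. (G n x \<bullet> x) * 1 \<partial>lborel)"
      by (rule dilation_quotient_tendsto[OF Zd cG supp loc_int_1 \<tau>(1-3)])
    \<comment> \<open>Dilating \<open>Z\<close> by \<open>1 + \<tau>\<close> multiplies its integral
      by \<open>(1 + \<tau>) powr (- N)\<close>. The two limits of the resulting difference quotient
      at \<open>\<tau> = 0\<close> identify the integral of \<open>G n x \<bullet> x\<close> as
      \<open>- N\<close> times that of \<open>Z\<close>.\<close>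
    have 2: "(\<integral>x. (Z ((1 + \<tau> m) *\<^sub>R x) - Z x) / \<tau> m * 1 \<partial>lborel) = ((1 + \<tau> m) powr (- N) - 1) / \<tau> m * (\<integral>x. Z x \<partial>lborel)" for m
    proof -
      have c: "1 + \<tau> m > 0" "1 + \<tau> m \<noteq> 0" using \<tau>(4)[of m] by auto
      have "1 / \<bar>1 + \<tau> m\<bar> ^ DIM('a) = (1 + \<tau> m) powr (- N)"
        using c by (simp add: N_eq powr_minus powr_realpow divide_inverse)
      then have "(\<integral>x. Z ((1 + \<tau> m) *\<^sub>R x + 0) \<partial>lborel) = (1 + \<tau> m) powr (- N) * (\<integral>x. Z x \<partial>lborel)"
        using c by (subst lborel_integral_affine) auto
      moreover have "integrable lborel (\<lambda>x. Z ((1 + \<tau> m) *\<^sub>R x + 0))"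
        using c iZ by (intro lborel_integral_affine(2)) auto
      ultimately show ?thesis using iZ \<tau>(2)[of m] by (simp add: field_simps)
    qed
    have "((\<lambda>t. (1 + t) powr (- N)) has_real_derivative - N) (at 0)"
      by (auto intro!: derivative_eq_intros)
    then have "((\<lambda>t. ((1 + t) powr (- N) - 1) / t) \<longlongrightarrow> - N) (at 0)" by (simp add: DERIV_def)
    then have "(\<lambda>m. ((1 + \<tau> m) powr (- N) - 1) / \<tau> m) \<longlonglongrightarrow> - N"
      by (rule filterlim_compose) (use \<tau> in \<open>auto simp: filterlim_at\<close>)
    then have "(\<lambda>m. ((1 + \<tau> m) powr (- N) - 1) / \<tau> m * (\<integral>x. Z x \<partial>lborel)) \<longlonglongrightarrow> - N * (\<integral>x. Z x \<partial>lborel)"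
      by (intro tendsto_mult tendsto_const)
    from LIMSEQ_unique[OF 1[unfolded 2] this] show ?thesis by (simp add: Z_def)
  qed
  have lim1: "(\<lambda>n. pow_int p (\<lambda>x. f (w n x) *\<^sub>R grad (w n) x - f (u x) *\<^sub>R g x)) \<longlonglongrightarrow> 0"
  proof (rule smooth_approx_scaled[OF w p1(2) _ fin_g])
    show "AE x in lborel. (\<lambda>n. f (w n x)) \<longlonglongrightarrow> f (u x)"
      using ae f_cont by (auto elim!: eventually_mono intro: isCont_tendsto_compose[of _ f] simp: continuous_on_eq_continuous_at)
  qed (use K wM bound in auto)
  have finfg: "pow_int p (\<lambda>x. f (u x) *\<^sub>R g x) < \<infinity>"
  proof -
    have "pow_int p (\<lambda>x. f (u x) *\<^sub>R g x) \<le> pow_int p (\<lambda>x. K *\<^sub>R g x)"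
      using K bound p1 by (intro pow_int_mono) (auto intro!: mult_right_mono)
    also have "\<dots> < \<infinity>" using fin_g by (subst pow_int_cmult) (auto simp: p1 ennreal_mult_less_top)
    finally show ?thesis .
  qed
  have finH: "pow_int (p / (p - 1)) (\<lambda>x. \<phi> x *\<^sub>R x) < \<infinity>"
  proof (rule bounded_support_finite[where C = "B * R" and R = R])
    show "norm (\<phi> x *\<^sub>R x) \<le> norm (B * R * indicator (cball 0 R) x :: real)" for x
      using R(1)[of x] R(3) mult_mono[OF B(2)[of x], of "norm x" R] B(1) by (cases "norm x > R") (auto simp: abs_mult)
  qed (use p1 in auto)
  have L1: "(\<lambda>n. \<integral>x. (\<phi> x *\<^sub>R x) \<bullet> (f (w n x) *\<^sub>R grad (w n) x) \<partial>lborel) \<longlonglongrightarrow> (\<integral>x. (\<phi> x *\<^sub>R x) \<bullet> (f (u x) *\<^sub>R g x) \<partial>lborel)"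
    by (rule pow_int_holder_tendsto[OF _ _ _ p1(1) finH finfg lim1]) measurable
  have aeF: "AE x in lborel. (\<lambda>n. F (w n x)) \<longlonglongrightarrow> F (u x)"
    using ae F_cont[of UNIV] by (auto elim!: eventually_mono intro: isCont_tendsto_compose[of _ F] simp: continuous_on_eq_continuous_at)
  have dom: "integrable lborel (\<lambda>x. 1 * (F (u x) * \<psi> x))" "(\<lambda>n. \<integral>x. 1 * (F (w n x) * \<psi> x) \<partial>lborel) \<longlonglongrightarrow> (\<integral>x. 1 * (F (u x) * \<psi> x) \<partial>lborel)"
    if [measurable]: "\<psi> \<in> borel_measurable borel" and "\<And>x. norm x > R \<Longrightarrow> \<psi> x = 0" "\<And>x. \<bar>\<psi> x\<bar> \<le> C" for \<psi> :: "'a \<Rightarrow> real" and C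
  proof -
    have 1: "\<bar>F (w n x) * \<psi> x\<bar> \<le> K' * C" for n x
      using mult_mono[OF K'(2)[OF wM[of n x]] that(3)[of x]] K'(1) by (simp add: abs_mult)
    have 2: "AE x in lborel. (\<lambda>n. F (w n x) * \<psi> x) \<longlonglongrightarrow> F (u x) * \<psi> x"
      using aeF by eventually_elim (intro tendsto_intros)
    have 3: "F (w n x) * \<psi> x = 0" if "norm x > R" for n x using \<open>\<And>x. norm x > R \<Longrightarrow> \<psi> x = 0\<close> that by simp
    note * = loc_int_dominated[OF loc_int_1 _ _ 3 1 2]
    show "integrable lborel (\<lambda>x. 1 * (F (u x) * \<psi> x))" by (rule *(1)) measurable
    show "(\<lambda>n. \<integral>x. 1 * (F (w n x) * \<psi> x) \<partial>lborel) \<longlonglongrightarrow> (\<integral>x. 1 * (F (u x) * \<psi> x) \<partial>lborel)" by (rule *(2)) measurable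
  qed
  have dom_n: "integrable lborel (\<lambda>x. F (w n x) * \<psi> x)"
    if [measurable]: "\<psi> \<in> borel_measurable borel" and "\<And>x. norm x > R \<Longrightarrow> \<psi> x = 0" "\<And>x. \<bar>\<psi> x\<bar> \<le> C" for \<psi> :: "'a \<Rightarrow> real" and C n
  proof -
    have "integrable lborel (\<lambda>x. (F (w n x) * \<psi> x) *\<^sub>R (1::real))"
    proof (rule loc_int_mult_integrable[OF loc_int_1])
      show "\<bar>F (w n x) * \<psi> x\<bar> \<le> K' * C" for x
        using mult_mono[OF K'(2)[OF wM[of n x]] that(3)[of x]] K'(1) by (simp add: abs_mult)
      show "F (w n x) * \<psi> x = 0" if "norm x > R" for x using \<open>\<And>x. norm x > R \<Longrightarrow> \<psi> x = 0\<close> that by simp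
    qed measurable
    then show ?thesis by simp
  qed
  have \<psi>2: "(\<lambda>x. grad \<phi> x \<bullet> x) \<in> borel_measurable borel" "\<And>x. norm x > R \<Longrightarrow> grad \<phi> x \<bullet> x = 0" "\<And>x. \<bar>grad \<phi> x \<bullet> x\<bar> \<le> B' * R"
  proof -
    show "\<bar>grad \<phi> x \<bullet> x\<bar> \<le> B' * R" for x
    proof (cases "norm x > R")
      case False
      have "\<bar>grad \<phi> x \<bullet> x\<bar> \<le> norm (grad \<phi> x) * norm x" by (rule Cauchy_Schwarz_ineq2)
      also have "\<dots> \<le> B' * R" using False B' by (intro mult_mono) auto
      finally show ?thesis .
    qed (use R B' in auto)
  qed (use R in auto)
  have \<psi>1: "\<phi> \<in> borel_measurable borel" "\<And>x. norm x > R \<Longrightarrow> \<phi> x = 0" "\<And>x. \<bar>\<phi> x\<bar> \<le> B"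
    using R B by auto
  have int_n: "integrable lborel (\<lambda>x. (\<phi> x *\<^sub>R x) \<bullet> (f (w n x) *\<^sub>R grad (w n) x))" for n
  proof -
    have c: "continuous_on UNIV (\<lambda>x. (\<phi> x *\<^sub>R x) \<bullet> (f (w n x) *\<^sub>R grad (w n) x))"
      by (intro continuous_intros continuous_on_compose2[OF f_cont]
          smooth_continuous s s\<phi> smooth_grad_continuous) auto
    obtain C where C: "\<And>x. norm ((\<phi> x *\<^sub>R x) \<bullet> (f (w n x) *\<^sub>R grad (w n) x)) \<le> C"
    proof -
      have "(\<phi> x *\<^sub>R x) \<bullet> (f (w n x) *\<^sub>R grad (w n) x) = 0" if "norm x > R" for x using R(1)[OF that] by simp
      from continuous_compact_support_bounded[OF c this] that show ?thesis by metis
    qed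
    have "integrable lborel (\<lambda>x. ((\<phi> x *\<^sub>R x) \<bullet> (f (w n x) *\<^sub>R grad (w n) x)) *\<^sub>R (1::real))"
      by (rule loc_int_mult_integrable[OF loc_int_1, where B = C and R = R])
         (use C R(1) borel_measurable_continuous_onI[OF c] in auto)
    then show ?thesis by simp
  qed
  have "(\<lambda>n. (\<integral>x. (\<phi> x *\<^sub>R x) \<bullet> (f (w n x) *\<^sub>R grad (w n) x) \<partial>lborel) + (\<integral>x. 1 * (F (w n x) * (grad \<phi> x \<bullet> x)) \<partial>lborel))
    \<longlonglongrightarrow> (\<integral>x. (\<phi> x *\<^sub>R x) \<bullet> (f (u x) *\<^sub>R g x) \<partial>lborel) + (\<integral>x. 1 * (F (u x) * (grad \<phi> x \<bullet> x)) \<partial>lborel)"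
    by (intro tendsto_add L1 dom(2)[OF \<psi>2])
  moreover have "(\<integral>x. (\<phi> x *\<^sub>R x) \<bullet> (f (w n x) *\<^sub>R grad (w n) x) \<partial>lborel) + (\<integral>x. 1 * (F (w n x) * (grad \<phi> x \<bullet> x)) \<partial>lborel)
     = - N * (\<integral>x. 1 * (F (w n x) * \<phi> x) \<partial>lborel)" for n
  proof -
    have "(\<integral>x. (\<phi> x *\<^sub>R x) \<bullet> (f (w n x) *\<^sub>R grad (w n) x) \<partial>lborel) + (\<integral>x. 1 * (F (w n x) * (grad \<phi> x \<bullet> x)) \<partial>lborel)
       = (\<integral>x. (\<phi> x *\<^sub>R x) \<bullet> (f (w n x) *\<^sub>R grad (w n) x) + 1 * (F (w n x) * (grad \<phi> x \<bullet> x)) \<partial>lborel)"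
      using int_n dom_n[OF \<psi>2] by (intro Bochner_Integration.integral_add[symmetric]) auto
    also have "\<dots> = (\<integral>x. G n x \<bullet> x \<partial>lborel)"
      by (intro Bochner_Integration.integral_cong) (auto simp: G_def inner_add_left inner_add_right inner_commute mult_ac)
    finally show ?thesis using id_n by simp
  qed
  moreover have "(\<lambda>n. - N * (\<integral>x. 1 * (F (w n x) * \<phi> x) \<partial>lborel)) \<longlonglongrightarrow> - N * (\<integral>x. 1 * (F (u x) * \<phi> x) \<partial>lborel)"
    by (intro tendsto_mult tendsto_const dom(2)[OF \<psi>1])
  ultimately have "(\<integral>x. (\<phi> x *\<^sub>R x) \<bullet> (f (u x) *\<^sub>R g x) \<partial>lborel) + (\<integral>x. F (u x) * (grad \<phi> x \<bullet> x) \<partial>lborel)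
    = - N * (\<integral>x. F (u x) * \<phi> x \<partial>lborel)" by (simp add: LIMSEQ_unique)
  moreover have "(\<integral>x. (\<phi> x *\<^sub>R x) \<bullet> (f (u x) *\<^sub>R g x) \<partial>lborel) = (\<integral>x. f (u x) * \<phi> x * (g x \<bullet> x) \<partial>lborel)"
    by (intro Bochner_Integration.integral_cong) (auto simp: inner_commute mult_ac)
  moreover have "(\<integral>x. F (u x) * (N * \<phi> x + grad \<phi> x \<bullet> x) \<partial>lborel) = N * (\<integral>x. F (u x) * \<phi> x \<partial>lborel) + (\<integral>x. F (u x) * (grad \<phi> x \<bullet> x) \<partial>lborel)"
  proof -
    have "(\<integral>x. F (u x) * (N * \<phi> x + grad \<phi> x \<bullet> x) \<partial>lborel) = (\<integral>x. N * (F (u x) * \<phi> x) + F (u x) * (grad \<phi> x \<bullet> x) \<partial>lborel)"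
      by (intro Bochner_Integration.integral_cong) (auto simp: algebra_simps)
    then show ?thesis using dom(1)[OF \<psi>1] dom(1)[OF \<psi>2] by simp
  qed
  ultimately show ?thesis by linarith
qed

text \<open>The equation tested with \<open>\<phi>\<close> times the dilation difference, solved for
  the flux term and divided by \<open>\<tau> n\<close>. The three factors multiplying the quotient
  \<open>Q\<close> have compact support and lie in the dual exponent, as
  \<open>quotient_tendsto\<close> demands.\<close>

lemma variation_tendsto:
  assumes \<phi>: "\<phi> \<in> test_functions" and \<tau>: "\<tau> \<longlonglongrightarrow> 0" "\<And>n. \<tau> n \<noteq> 0" "\<And>n. - 1 / 2 \<le> \<tau> n"
  shows "(\<lambda>n. (\<integral>x. \<phi> x * (flux x \<bullet> ((1 + \<tau> n) *\<^sub>R g ((1 + \<tau> n) *\<^sub>R x) - g x)) \<partial>lborel) / \<tau> n) \<longlonglongrightarrow>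
      (\<integral>x. f (u x) * \<phi> x * (g x \<bullet> x) \<partial>lborel) - (\<integral>x. (flux x \<bullet> grad \<phi> x) * (g x \<bullet> x) \<partial>lborel)
      - (\<integral>x. pot x * \<phi> x * (g x \<bullet> x) \<partial>lborel)" (is "_ \<longlonglongrightarrow> ?L")
    "\<And>n. integrable lborel (\<lambda>x. \<phi> x * (flux x \<bullet> ((1 + \<tau> n) *\<^sub>R g ((1 + \<tau> n) *\<^sub>R x) - g x)))"
proof -
  have s\<phi>: "smooth \<phi>" by (rule test_functions_smooth[OF \<phi>])
  note [measurable] = smooth_measurable[OF s\<phi>] smooth_grad_measurable[OF s\<phi>]
  obtain R where R: "\<And>x. norm x > R \<Longrightarrow> \<phi> x = 0" "\<And>x. norm x > R \<Longrightarrow> grad \<phi> x = 0" "R > 0"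
    using test_functions_obtain[OF \<phi>] by metis
  obtain B where B: "B > 0" "\<And>x. norm (\<phi> x) \<le> B"
    using continuous_compact_support_bounded[OF smooth_continuous[OF s\<phi>] R(1)] by metis
  obtain B' where B': "B' > 0" "\<And>x. norm (grad \<phi> x) \<le> B'"
    using continuous_compact_support_bounded[OF smooth_grad_continuous[OF s\<phi>] R(2)] by metis
  obtain w where w: "smooth_approx p w u g" and wM: "\<And>n x. \<bar>w n x\<bar> \<le> M" using approx by metis
  obtain K where K: "0 < K" "\<And>t. \<bar>t\<bar> \<le> M \<Longrightarrow> \<bar>f t\<bar> \<le> K" using continuous_bounded_values[OF f_cont] by metis
  let ?q = "p / (p - 1)"
  have q: "0 < ?q" "?q \<le> 2" using p2 by (auto simp: field_simps)
  define Q where "Q n x = (u ((1 + \<tau> n) *\<^sub>R x) - u x) / \<tau> n" for n x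
  have HA: "pow_int ?q (\<lambda>x. flux x \<bullet> grad \<phi> x) < \<infinity>"
  proof -
    have "norm (flux x \<bullet> grad \<phi> x) \<le> norm (B' *\<^sub>R flux x)" for x
      using order_trans[OF Cauchy_Schwarz_ineq2 mult_left_mono[OF B'(2)], of "flux x" x] B'(1) by (simp add: mult.commute)
    then have "pow_int ?q (\<lambda>x. flux x \<bullet> grad \<phi> x) \<le> pow_int ?q (\<lambda>x. B' *\<^sub>R flux x)"
      using q by (intro pow_int_mono) auto
    also have "\<dots> < \<infinity>" using fin_flux q by (subst pow_int_cmult) (auto simp: ennreal_mult_less_top)
    finally show ?thesis .
  qed
  have HC: "pow_int ?q (\<lambda>x. f (u x) * \<phi> x) < \<infinity>"
  proof (rule bounded_support_finite[where C = "K * B" and R = R])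
    show "norm (f (u x) * \<phi> x) \<le> norm (K * B * indicator (cball 0 R) x :: real)" for x
      using R(1)[of x] mult_mono[OF K(2)[OF bound[of x]] B(2)[of x]] B(1) K(1)
      by (cases "norm x > R") (auto simp: abs_mult)
  qed (use q in auto)
  \<comment> \<open>Here \<open>p \<ge> 2\<close> enters: the dual exponent is at most 2, so
    boundedness of \<open>u\<close> and \<open>V x powr ?q \<le> 1 + (V x)^2\<close> reduce the
    claim to local square integrability of \<open>V\<close>.\<close>
  have HB: "pow_int ?q (\<lambda>x. pot x * \<phi> x) < \<infinity>"
  proof -
    define C where "C = (M powr (p - 1) * B) powr ?q"
    have "integrable lborel (\<lambda>x. C * (indicator (cball 0 R) x + indicator (cball 0 R) x * (V x)\<^sup>2))"
      by (intro integrable_mult_right Bochner_Integration.integrable_add V_square integrable_indicator_cball)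
    then have "integrable lborel (\<lambda>x. norm (pot x * \<phi> x) powr ?q)"
    proof (rule Bochner_Integration.integrable_bound)
      show "AE x in lborel. norm (norm (pot x * \<phi> x) powr ?q) \<le> norm (C * (indicator (cball 0 R) x + indicator (cball 0 R) x * (V x)\<^sup>2))"
      proof (rule AE_I2)
        fix x
        show "norm (norm (pot x * \<phi> x) powr ?q) \<le> norm (C * (indicator (cball 0 R) x + indicator (cball 0 R) x * (V x)\<^sup>2))"
        proof (cases "norm x > R")
          case True
          then show ?thesis using R(1) by simp
        next
          case False
          have "\<bar>u x\<bar> powr (p - 2) * \<bar>u x\<bar> = \<bar>u x\<bar> powr (p - 1)"
            using powr_add[of "\<bar>u x\<bar>" "p - 2" 1] by (cases "u x = 0") auto
          then have "\<bar>pot x\<bar> = V x * \<bar>u x\<bar> powr (p - 1)"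
            using V_nonneg[of x] by (simp add: pot_def abs_mult mult.assoc)
          also have "\<dots> \<le> V x * M powr (p - 1)"
            using V_nonneg[of x] bound[of x] p2 by (intro mult_left_mono powr_mono2) auto
          finally have "norm (pot x * \<phi> x) \<le> V x * M powr (p - 1) * B"
            using mult_mono[OF _ B(2)[of x], of "\<bar>pot x\<bar>" "V x * M powr (p - 1)"] V_nonneg[of x] by (simp add: abs_mult)
          then have "norm (pot x * \<phi> x) powr ?q \<le> (V x * (M powr (p - 1) * B)) powr ?q"
            using q by (intro powr_mono2) (auto simp: mult.assoc)
          also have "\<dots> = C * V x powr ?q" using V_nonneg[of x] B(1) by (simp add: C_def powr_mult)
          also have "\<dots> \<le> C * (1 + (V x)\<^sup>2)"
          proof (rule mult_left_mono)
            show "V x powr ?q \<le> 1 + (V x)\<^sup>2"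
            proof (cases "V x \<le> 1")
              case True
              then have "V x powr ?q \<le> 1 powr ?q" using V_nonneg[of x] q by (intro powr_mono2) auto
              then show ?thesis by (simp add: add_increasing2)
            next
              case False
              then have "V x powr ?q \<le> V x powr 2" using q by (intro powr_mono) auto
              then show ?thesis using False by simp
            qed
          qed (simp add: C_def)
          finally show ?thesis using False by (simp add: C_def)
        qed
      qed
    qed measurable
    then show ?thesis by (subst pow_int_finite_iff) auto
  qed
  have c: "1 + \<tau> n \<noteq> 0" for n using \<tau>(3)[of n] by auto
  have eqn: "integrable lborel (\<lambda>x. \<phi> x * (flux x \<bullet> ((1 + \<tau> n) *\<^sub>R g ((1 + \<tau> n) *\<^sub>R x) - g x)))"
    "(\<integral>x. \<phi> x * (flux x \<bullet> ((1 + \<tau> n) *\<^sub>R g ((1 + \<tau> n) *\<^sub>R x) - g x)) \<partial>lborel) / \<tau> n =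
     (\<integral>x. (f (u x) * \<phi> x) * Q n x \<partial>lborel) - (\<integral>x. (flux x \<bullet> grad \<phi> x) * Q n x \<partial>lborel) - (\<integral>x. (pot x * \<phi> x) * Q n x \<partial>lborel)" for n
  proof -
    let ?D = "\<lambda>x. u ((1 + \<tau> n) *\<^sub>R x) - u x" and ?h = "\<lambda>x. (1 + \<tau> n) *\<^sub>R g ((1 + \<tau> n) *\<^sub>R x) - g x"
    have fin: "pow_int p ?h < \<infinity>"
    proof -
      have "pow_int p (\<lambda>x. g ((1 + \<tau> n) *\<^sub>R x + 0)) < \<infinity>"
        using fin_g c by (subst pow_int_affine) (auto simp: ennreal_mult_less_top)
      then have "pow_int p (\<lambda>x. (1 + \<tau> n) *\<^sub>R g ((1 + \<tau> n) *\<^sub>R x)) < \<infinity>"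
        by (subst pow_int_cmult) (auto simp: p1 ennreal_mult_less_top)
      moreover have "pow_int p ?h \<le> ennreal (2 powr p) * (pow_int p (\<lambda>x. (1 + \<tau> n) *\<^sub>R g ((1 + \<tau> n) *\<^sub>R x)) + pow_int p g)"
        by (rule pow_int_diff) (use p1 in auto)
      ultimately show ?thesis using fin_g by (auto intro!: le_less_trans[of "pow_int p ?h"] simp: ennreal_mult_less_top)
    qed
    have b1: "\<bar>w m ((1 + \<tau> n) *\<^sub>R x) - w m x\<bar> \<le> 2 * M" for m x
      using wM[of m "(1 + \<tau> n) *\<^sub>R x"] wM[of m x] by linarith
    have b2: "\<bar>?D x\<bar> \<le> 2 * M" for x using bound[of "(1 + \<tau> n) *\<^sub>R x"] bound[of x] by linarith
    note E = equation_product[OF smooth_approx_dilate_diff[OF w p1(2) c] b1 b2 _ _ fin \<phi>]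
    show "integrable lborel (\<lambda>x. \<phi> x * (flux x \<bullet> ?h x))" by (rule E(1)) measurable
    have "(\<integral>x. \<phi> x * (flux x \<bullet> ?h x) \<partial>lborel) + (\<integral>x. ?D x * (flux x \<bullet> grad \<phi> x) \<partial>lborel) + (\<integral>x. pot x * (\<phi> x * ?D x) \<partial>lborel)
      = (\<integral>x. f (u x) * (\<phi> x * ?D x) \<partial>lborel)" by (rule E(5)) measurable
    then have I: "(\<integral>x. \<phi> x * (flux x \<bullet> ?h x) \<partial>lborel) = (\<integral>x. f (u x) * (\<phi> x * ?D x) \<partial>lborel)
      - (\<integral>x. ?D x * (flux x \<bullet> grad \<phi> x) \<partial>lborel) - (\<integral>x. pot x * (\<phi> x * ?D x) \<partial>lborel)" by linarith
    have Q1: "(\<integral>x. (f (u x) * \<phi> x) * Q n x \<partial>lborel) = (\<integral>x. f (u x) * (\<phi> x * ?D x) \<partial>lborel) / \<tau> n"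
      and Q2: "(\<integral>x. (flux x \<bullet> grad \<phi> x) * Q n x \<partial>lborel) = (\<integral>x. ?D x * (flux x \<bullet> grad \<phi> x) \<partial>lborel) / \<tau> n"
      and Q3: "(\<integral>x. (pot x * \<phi> x) * Q n x \<partial>lborel) = (\<integral>x. pot x * (\<phi> x * ?D x) \<partial>lborel) / \<tau> n"
      unfolding integral_divide_zero[symmetric] Q_def by (simp_all add: mult_ac)
    show "(\<integral>x. \<phi> x * (flux x \<bullet> ?h x) \<partial>lborel) / \<tau> n =
     (\<integral>x. (f (u x) * \<phi> x) * Q n x \<partial>lborel) - (\<integral>x. (flux x \<bullet> grad \<phi> x) * Q n x \<partial>lborel) - (\<integral>x. (pot x * \<phi> x) * Q n x \<partial>lborel)"
      unfolding Q1 Q2 Q3 I by (simp only: diff_divide_distrib)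
  qed
  show "integrable lborel (\<lambda>x. \<phi> x * (flux x \<bullet> ((1 + \<tau> n) *\<^sub>R g ((1 + \<tau> n) *\<^sub>R x) - g x)))" for n by (rule eqn)
  show "(\<lambda>n. (\<integral>x. \<phi> x * (flux x \<bullet> ((1 + \<tau> n) *\<^sub>R g ((1 + \<tau> n) *\<^sub>R x) - g x)) \<partial>lborel) / \<tau> n) \<longlonglongrightarrow> ?L"
    unfolding eqn(2) Q_def
    by (intro tendsto_diff quotient_tendsto(1)[OF _ HA _ \<tau>(1,2), of R] quotient_tendsto(1)[OF _ HB _ \<tau>(1,2), of R] quotient_tendsto(1)[OF _ HC _ \<tau>(1,2), of R])
       (use R in auto)
qed

text \<open>The substitution \<open>y = (1 + \<tau>) x\<close> moves the dilation from
  \<open>g\<close>, which cannot be differentiated, to \<open>\<phi>\<close>, and yields the factor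
  \<open>(1 + \<tau>) powr (p - N)\<close>. What remains is the product rule at
  \<open>\<tau> = 0\<close>.\<close>

lemma energy_tendsto:
  assumes \<phi>: "\<phi> \<in> test_functions" and \<tau>: "\<tau> \<longlonglongrightarrow> 0" "\<And>n. \<tau> n \<noteq> 0" "\<And>n. \<bar>\<tau> n\<bar> \<le> 1 / 2"
  shows "(\<lambda>n. ((\<integral>x. \<phi> x * norm ((1 + \<tau> n) *\<^sub>R g ((1 + \<tau> n) *\<^sub>R x)) powr p \<partial>lborel) - (\<integral>x. \<phi> x * norm (g x) powr p \<partial>lborel)) / \<tau> n)
     \<longlonglongrightarrow> (p - N) * (\<integral>x. \<phi> x * norm (g x) powr p \<partial>lborel) - (\<integral>x. (grad \<phi> x \<bullet> x) * norm (g x) powr p \<partial>lborel)"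
    "\<And>n. integrable lborel (\<lambda>x. \<phi> x * norm ((1 + \<tau> n) *\<^sub>R g ((1 + \<tau> n) *\<^sub>R x)) powr p)"
proof -
  have s\<phi>: "smooth \<phi>" by (rule test_functions_smooth[OF \<phi>])
  note [measurable] = smooth_measurable[OF s\<phi>] smooth_grad_measurable[OF s\<phi>]
  obtain R where R: "\<And>x. norm x > R \<Longrightarrow> \<phi> x = 0" "\<And>x. norm x > R \<Longrightarrow> grad \<phi> x = 0" "R > 0"
    using test_functions_obtain[OF \<phi>] by metis
  obtain B where B: "B > 0" "\<And>x. norm (\<phi> x) \<le> B"
    using continuous_compact_support_bounded[OF smooth_continuous[OF s\<phi>] R(1)] by metis
  define e where "e x = norm (g x) powr p" for x
  have [measurable]: "e \<in> borel_measurable borel" unfolding e_def[abs_def] by measurable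
  have ie: "integrable lborel e" using fin_g pow_int_finite_iff[of g] by (auto simp: e_def[abs_def])
  have le: "loc_int e"
    unfolding loc_int_def by (intro conjI allI integrable_mult_indicator ie) auto
  have i\<phi>: "integrable lborel (\<lambda>x. \<phi> (c *\<^sub>R x) * e x)" for c
  proof (rule Bochner_Integration.integrable_bound[OF integrable_mult_right[OF ie, of B]])
    show "AE x in lborel. norm (\<phi> (c *\<^sub>R x) * e x) \<le> norm (B * e x)"
      using B by (auto simp: abs_mult intro!: mult_right_mono)
  qed measurable
  have c: "1 + \<tau> n > 0" for n using \<tau>(3)[of n] by (auto simp: abs_le_iff)
  \<comment> \<open>After the substitution \<open>\<phi>\<close> is dilated by
    \<open>1 / (1 + \<tau>)\<close>, whose offset from 1 is \<open>\<sigma>\<close>. The ratio of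
    \<open>\<sigma>\<close> to \<open>\<tau>\<close> tends to \<open>- 1\<close>, hence the minus
    sign of the term with \<open>grad \<phi>\<close>.\<close>
  define \<sigma> where "\<sigma> n = 1 / (1 + \<tau> n) - 1" for n
  have \<sigma>1: "\<sigma> \<longlonglongrightarrow> 1 / (1 + 0) - 1" unfolding \<sigma>_def by (intro tendsto_intros \<tau>(1)) auto
  have \<sigma>: "\<sigma> n = - \<tau> n / (1 + \<tau> n)" for n using c[of n] by (simp add: \<sigma>_def field_simps)
  have \<sigma>2: "\<sigma> n \<noteq> 0" for n using c[of n] \<tau>(2)[of n] by (simp add: \<sigma>)
  have \<sigma>3: "- 1 / 2 \<le> \<sigma> n" for n
  proof -
    have "1 / (3/2) \<le> 1 / (1 + \<tau> n)" using \<tau>(3)[of n] c[of n] by (intro divide_left_mono) (auto simp: abs_le_iff)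
    then show ?thesis by (simp add: \<sigma>_def)
  qed
  define a where "a = p - N"
  define J where "J n = (\<integral>x. \<phi> ((1 + \<sigma> n) *\<^sub>R x) * e x \<partial>lborel)" for n
  define J0 where "J0 = (\<integral>x. \<phi> x * e x \<partial>lborel)"
  define D where "D = (\<integral>x. (grad \<phi> x \<bullet> x) * e x \<partial>lborel)"
  have scale: "(\<integral>x. \<phi> x * norm ((1 + \<tau> n) *\<^sub>R g ((1 + \<tau> n) *\<^sub>R x)) powr p \<partial>lborel) = (1 + \<tau> n) powr a * J n" and
    int: "integrable lborel (\<lambda>x. \<phi> x * norm ((1 + \<tau> n) *\<^sub>R g ((1 + \<tau> n) *\<^sub>R x)) powr p)" for n
  proof -
    let ?k = "\<lambda>x. \<phi> ((1 + \<sigma> n) *\<^sub>R x) * e x"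
    have inv: "(1 + \<sigma> n) * (1 + \<tau> n) = 1" using c[of n] by (simp add: \<sigma>_def)
    have eq: "\<phi> x * norm ((1 + \<tau> n) *\<^sub>R g ((1 + \<tau> n) *\<^sub>R x)) powr p = (1 + \<tau> n) powr p * ?k ((1 + \<tau> n) *\<^sub>R x + 0)" for x
      using c[of n] inv by (simp add: e_def powr_mult)
    have "(\<integral>x. \<phi> x * norm ((1 + \<tau> n) *\<^sub>R g ((1 + \<tau> n) *\<^sub>R x)) powr p \<partial>lborel) = (1 + \<tau> n) powr p * (\<integral>x. ?k ((1 + \<tau> n) *\<^sub>R x + 0) \<partial>lborel)"
      unfolding eq by (rule integral_mult_right_zero)
    also have "(\<integral>x. ?k ((1 + \<tau> n) *\<^sub>R x + 0) \<partial>lborel) = (1 / \<bar>1 + \<tau> n\<bar> ^ DIM('a)) *\<^sub>R J n"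
      unfolding J_def by (rule lborel_integral_affine) (use c[of n] in auto)
    also have "1 / \<bar>1 + \<tau> n\<bar> ^ DIM('a) = (1 + \<tau> n) powr (- N)"
      using c[of n] by (simp add: N_eq powr_minus powr_realpow divide_inverse)
    finally show "(\<integral>x. \<phi> x * norm ((1 + \<tau> n) *\<^sub>R g ((1 + \<tau> n) *\<^sub>R x)) powr p \<partial>lborel) = (1 + \<tau> n) powr a * J n"
      by (simp add: a_def powr_add[symmetric] flip: mult.assoc)
    show "integrable lborel (\<lambda>x. \<phi> x * norm ((1 + \<tau> n) *\<^sub>R g ((1 + \<tau> n) *\<^sub>R x)) powr p)"
      unfolding eq by (intro integrable_mult_right lborel_integral_affine(2) i\<phi>) (use c[of n] in auto)
  qed
  show "integrable lborel (\<lambda>x. \<phi> x * norm ((1 + \<tau> n) *\<^sub>R g ((1 + \<tau> n) *\<^sub>R x)) powr p)" for n by (rule int)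
  have "(\<lambda>n. \<integral>x. (\<phi> ((1 + \<sigma> n) *\<^sub>R x) - \<phi> x) / \<sigma> n * e x \<partial>lborel) \<longlonglongrightarrow> D"
    unfolding D_def
    by (rule dilation_quotient_tendsto[OF smooth_has_derivative[OF s\<phi>] smooth_grad_continuous[OF s\<phi>] R(1,2) le])
       (use \<sigma>1 \<sigma>2 \<sigma>3 in auto)
  also have "(\<lambda>n. \<integral>x. (\<phi> ((1 + \<sigma> n) *\<^sub>R x) - \<phi> x) / \<sigma> n * e x \<partial>lborel) = (\<lambda>n. (J n - J0) / \<sigma> n)"
  proof
    fix n
    have "(\<integral>x. (\<phi> ((1 + \<sigma> n) *\<^sub>R x) - \<phi> x) / \<sigma> n * e x \<partial>lborel) = (\<integral>x. (\<phi> ((1 + \<sigma> n) *\<^sub>R x) * e x - \<phi> x * e x) / \<sigma> n \<partial>lborel)"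
      by (intro Bochner_Integration.integral_cong) (auto simp: algebra_simps)
    also have "\<dots> = (J n - J0) / \<sigma> n"
      using i\<phi>[of "1 + \<sigma> n"] i\<phi>[of 1] by (simp add: J_def J0_def)
    finally show "(\<integral>x. (\<phi> ((1 + \<sigma> n) *\<^sub>R x) - \<phi> x) / \<sigma> n * e x \<partial>lborel) = (J n - J0) / \<sigma> n" .
  qed
  finally have q1: "(\<lambda>n. (J n - J0) / \<sigma> n) \<longlonglongrightarrow> D" .
  have q2: "(\<lambda>n. (J n - J0) / \<tau> n) \<longlonglongrightarrow> - D"
  proof -
    have "(\<lambda>n. (J n - J0) / \<sigma> n * (- 1 / (1 + \<tau> n))) \<longlonglongrightarrow> D * (- 1 / (1 + 0))"
      by (intro tendsto_intros q1 \<tau>(1)) auto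
    moreover have "(J n - J0) / \<sigma> n * (- 1 / (1 + \<tau> n)) = (J n - J0) / \<tau> n" for n
      using c[of n] \<tau>(2)[of n] by (simp add: \<sigma>)
    ultimately show ?thesis by simp
  qed
  have "(\<lambda>n. (J n - J0) / \<tau> n * \<tau> n) \<longlonglongrightarrow> - D * 0" by (intro tendsto_mult q2 \<tau>(1))
  then have "(\<lambda>n. J n - J0) \<longlonglongrightarrow> 0" using \<tau>(2) by simp
  then have J: "J \<longlonglongrightarrow> J0" by (rule LIM_zero_cancel)
  have "((\<lambda>t. (1 + t) powr a) has_real_derivative a) (at 0)"
    by (auto intro!: derivative_eq_intros)
  then have "((\<lambda>t. ((1 + t) powr a - 1) / t) \<longlongrightarrow> a) (at 0)" by (simp add: DERIV_def)
  then have q3: "(\<lambda>m. ((1 + \<tau> m) powr a - 1) / \<tau> m) \<longlonglongrightarrow> a"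
    by (rule filterlim_compose) (use \<tau> in \<open>auto simp: filterlim_at\<close>)
  have "(\<lambda>n. ((1 + \<tau> n) powr a - 1) / \<tau> n * J n + (J n - J0) / \<tau> n) \<longlonglongrightarrow> a * J0 + - D"
    by (intro tendsto_add tendsto_mult q2 q3 J)
  moreover have "((1 + \<tau> n) powr a - 1) / \<tau> n * J n + (J n - J0) / \<tau> n = ((1 + \<tau> n) powr a * J n - J0) / \<tau> n" for n
    using \<tau>(2)[of n] by (simp add: field_simps)
  ultimately show "(\<lambda>n. ((\<integral>x. \<phi> x * norm ((1 + \<tau> n) *\<^sub>R g ((1 + \<tau> n) *\<^sub>R x)) powr p \<partial>lborel) - (\<integral>x. \<phi> x * norm (g x) powr p \<partial>lborel)) / \<tau> n)
     \<longlonglongrightarrow> (p - N) * (\<integral>x. \<phi> x * norm (g x) powr p \<partial>lborel) - (\<integral>x. (grad \<phi> x \<bullet> x) * norm (g x) powr p \<partial>lborel)"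
    unfolding scale by (simp add: a_def J0_def D_def e_def)
qed

text \<open>By convexity of \<open>|\<cdot>|\<^sup>p\<close>, the quotients of \<open>variation_tendsto\<close> lie below those of \<open>energy_tendsto\<close>
  for \<open>\<tau> > 0\<close> and above them for \<open>\<tau> < 0\<close>, so the two limits coincide.\<close>

lemma local_pohozaev:
  assumes \<phi>: "\<phi> \<in> test_functions" and pos: "\<And>x. 0 \<le> \<phi> x"
  shows "((p - N) * (\<integral>x. \<phi> x * norm (g x) powr p \<partial>lborel) - (\<integral>x. (grad \<phi> x \<bullet> x) * norm (g x) powr p \<partial>lborel)) / p
    = - (\<integral>x. F (u x) * (N * \<phi> x + grad \<phi> x \<bullet> x) \<partial>lborel) - (\<integral>x. (flux x \<bullet> grad \<phi> x) * (g x \<bullet> x) \<partial>lborel)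
      - (\<integral>x. pot x * \<phi> x * (g x \<bullet> x) \<partial>lborel)" (is "?E / p = ?L")
proof -
  have s\<phi>: "smooth \<phi>" by (rule test_functions_smooth[OF \<phi>])
  note [measurable] = smooth_measurable[OF s\<phi>] smooth_grad_measurable[OF s\<phi>]
  obtain R where R: "\<And>x. norm x > R \<Longrightarrow> \<phi> x = 0"
    using test_functions_obtain[OF \<phi>] by metis
  obtain B where B: "B > 0" "\<And>x. norm (\<phi> x) \<le> B"
    using continuous_compact_support_bounded[OF smooth_continuous[OF s\<phi>] R(1)] by metis
  have ie: "integrable lborel (\<lambda>x. norm (g x) powr p)" using fin_g pow_int_finite_iff[of g] by auto
  have i0: "integrable lborel (\<lambda>x. \<phi> x * norm (g x) powr p)"
  proof (rule Bochner_Integration.integrable_bound[OF integrable_mult_right[OF ie, of B]])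
    show "AE x in lborel. norm (\<phi> x * norm (g x) powr p) \<le> norm (B * norm (g x) powr p)"
      using B by (auto simp: abs_mult intro!: mult_right_mono)
  qed measurable
  define I where "I t = (\<integral>x. \<phi> x * (flux x \<bullet> ((1 + t) *\<^sub>R g ((1 + t) *\<^sub>R x) - g x)) \<partial>lborel)" for t
  define E where "E t = (\<integral>x. \<phi> x * norm ((1 + t) *\<^sub>R g ((1 + t) *\<^sub>R x)) powr p \<partial>lborel) - (\<integral>x. \<phi> x * norm (g x) powr p \<partial>lborel)" for t
  have lims: "(\<lambda>n. I (\<tau> n) / \<tau> n) \<longlonglongrightarrow> ?L" "(\<lambda>n. E (\<tau> n) / p / \<tau> n) \<longlonglongrightarrow> ?E / p" "I (\<tau> n) \<le> E (\<tau> n) / p"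
    if \<tau>: "\<tau> \<longlonglongrightarrow> 0" "\<And>n. \<tau> n \<noteq> 0" "\<And>n. \<bar>\<tau> n\<bar> \<le> 1 / 2" for \<tau> :: "nat \<Rightarrow> real" and n
  proof -
    have \<tau>': "- 1 / 2 \<le> \<tau> n" for n using \<tau>(3)[of n] by (simp add: abs_le_iff)
    note v = variation_tendsto[OF \<phi> \<tau>(1,2) \<tau>'] and e = energy_tendsto[OF \<phi> \<tau>]
    show "(\<lambda>n. I (\<tau> n) / \<tau> n) \<longlonglongrightarrow> ?L" using v(1) by (simp add: I_def reaction_identity[OF \<phi>])
    show "(\<lambda>n. E (\<tau> n) / p / \<tau> n) \<longlonglongrightarrow> ?E / p"
      using tendsto_divide[OF e(1) tendsto_const[of p]] p1 by (simp add: E_def divide_divide_eq_left mult.commute)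
    have "I (\<tau> n) \<le> (\<integral>x. (\<phi> x * norm ((1 + \<tau> n) *\<^sub>R g ((1 + \<tau> n) *\<^sub>R x)) powr p - \<phi> x * norm (g x) powr p) / p \<partial>lborel)"
      unfolding I_def
    proof (rule integral_mono[OF v(2)])
      show "integrable lborel (\<lambda>x. (\<phi> x * norm ((1 + \<tau> n) *\<^sub>R g ((1 + \<tau> n) *\<^sub>R x)) powr p - \<phi> x * norm (g x) powr p) / p)"
        by (intro integrable_divide_zero Bochner_Integration.integrable_diff e(2) i0)
      fix x
      have "\<phi> x * (flux x \<bullet> ((1 + \<tau> n) *\<^sub>R g ((1 + \<tau> n) *\<^sub>R x) - g x))
        \<le> \<phi> x * ((norm ((1 + \<tau> n) *\<^sub>R g ((1 + \<tau> n) *\<^sub>R x)) powr p - norm (g x) powr p) / p)"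
        unfolding flux_def by (intro mult_left_mono norm_powr_tangent p1 pos)
      then show "\<phi> x * (flux x \<bullet> ((1 + \<tau> n) *\<^sub>R g ((1 + \<tau> n) *\<^sub>R x) - g x))
        \<le> (\<phi> x * norm ((1 + \<tau> n) *\<^sub>R g ((1 + \<tau> n) *\<^sub>R x)) powr p - \<phi> x * norm (g x) powr p) / p"
        by (simp only: right_diff_distrib times_divide_eq_right)
    qed
    also have "\<dots> = E (\<tau> n) / p" using e(2)[of n] i0 by (simp add: E_def)
    finally show "I (\<tau> n) \<le> E (\<tau> n) / p" .
  qed
  \<comment> \<open>Starting at \<open>1 / 2\<close> keeps both dilation factors
    \<open>1 + \<tau> n\<close> and \<open>1 - \<tau> n\<close> at least
    \<open>1 / 2\<close>.\<close>
  define \<tau> where "\<tau> n = 1 / real (Suc (Suc n))" for n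
  have t0: "(\<lambda>n. 1 / real (Suc n)) \<longlonglongrightarrow> 0" using LIMSEQ_inverse_real_of_nat by (simp add: inverse_eq_divide)
  have \<tau>: "\<tau> \<longlonglongrightarrow> 0" unfolding \<tau>_def by (rule LIMSEQ_Suc[OF t0])
  have \<tau>pos: "0 < \<tau> n" "\<tau> n \<le> 1 / 2" for n by (auto simp: \<tau>_def field_simps)
  have \<tau>': "\<tau> n \<noteq> 0" "\<bar>\<tau> n\<bar> \<le> 1 / 2" "- \<tau> n \<noteq> 0" "\<bar>- \<tau> n\<bar> \<le> 1 / 2" for n using \<tau>pos[of n] by auto
  have \<tau>m: "(\<lambda>n. - \<tau> n) \<longlonglongrightarrow> 0" using tendsto_minus[OF \<tau>] by simp
  note P = lims[OF \<tau> \<tau>'(1,2)] and Q = lims[OF \<tau>m \<tau>'(3,4)]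
  have "?L \<le> ?E / p"
  proof (rule LIMSEQ_le[OF P(1) P(2)])
    show "\<exists>N. \<forall>n\<ge>N. I (\<tau> n) / \<tau> n \<le> E (\<tau> n) / p / \<tau> n"
      using P(3) \<tau>pos by (intro exI[of _ 0] allI impI divide_right_mono) (auto intro: less_imp_le)
  qed
  moreover have "?E / p \<le> ?L"
  proof (rule LIMSEQ_le[OF Q(2) Q(1)])
    show "\<exists>N. \<forall>n\<ge>N. E (- \<tau> n) / p / - \<tau> n \<le> I (- \<tau> n) / - \<tau> n"
      using Q(3) \<tau>pos by (intro exI[of _ 0] allI impI divide_right_mono_neg) (auto intro: less_imp_le)
  qed
  ultimately show ?thesis by simp
qed

text \<open>Expands the cut-off. The factors \<open>cutoff n\<close> tend to 1, while the terms with
  its gradient are bounded through \<open>norm x * norm (grad (cutoff n) x) \<le> B\<close> and tend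
  to 0 pointwise. Majorants are multiples of \<open>norm (g x) powr p\<close> and of
  \<open>|F (u x)|\<close>, and for the potential term the function in \<open>iV\<close>.\<close>

lemma global_pohozaev:
  assumes iF: "integrable lborel (\<lambda>x. F (u x))"
    and iV: "integrable lborel (\<lambda>x. V x * norm x * \<bar>u x\<bar> powr (p - 1) * norm (g x))"
  shows "(N - p) / p * (\<integral>x. norm (g x) powr p \<partial>lborel) - N * (\<integral>x. F (u x) \<partial>lborel)
     - (\<integral>x. V x * \<bar>u x\<bar> powr (p - 2) * u x * (x \<bullet> g x) \<partial>lborel) = 0"
proof -
  have ie: "integrable lborel (\<lambda>x. norm (g x) powr p)" using fin_g pow_int_finite_iff[of g] by auto
  obtain B where B: "0 < B" "\<And>n x. norm (grad (cutoff n) (x::'a)) \<le> B / real (Suc n)"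
    "\<And>n x. norm x * norm (grad (cutoff n) (x::'a)) \<le> B" using grad_cutoff_bound by metis
  have [measurable]: "cutoff n \<in> borel_measurable (borel :: 'a measure)" "grad (cutoff n) \<in> borel_measurable (borel :: 'a measure)" for n
    by (intro smooth_measurable smooth_grad_measurable test_functions_smooth cutoff_test)+
  have gB: "\<bar>grad (cutoff n) x \<bullet> x\<bar> \<le> B" for n and x :: 'a
    using Cauchy_Schwarz_ineq2[of "grad (cutoff n) x" x] B(3)[of x n] by (simp add: mult.commute)
  have g0: "(\<lambda>n. grad (cutoff n) x \<bullet> x) \<longlonglongrightarrow> 0" for x :: 'a
  proof (rule tendsto_rabs_zero_cancel, rule tendsto_sandwich[OF _ _ tendsto_const])
    show "eventually (\<lambda>n. \<bar>grad (cutoff n) x \<bullet> x\<bar> \<le> (B * norm x) * (1 / real (Suc n))) sequentially"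
    proof (intro always_eventually allI)
      fix n
      have "\<bar>grad (cutoff n) x \<bullet> x\<bar> \<le> norm (grad (cutoff n) x) * norm x" by (rule Cauchy_Schwarz_ineq2)
      also have "\<dots> \<le> B / real (Suc n) * norm x" by (intro mult_right_mono B(2)) auto
      finally show "\<bar>grad (cutoff n) x \<bullet> x\<bar> \<le> (B * norm x) * (1 / real (Suc n))" by (simp add: mult_ac)
    qed
    have "(\<lambda>n. (B * norm x) * (1 / real (Suc n))) \<longlonglongrightarrow> (B * norm x) * 0"
      using LIMSEQ_inverse_real_of_nat by (intro tendsto_intros) (simp add: inverse_eq_divide)
    then show "(\<lambda>n. (B * norm x) * (1 / real (Suc n))) \<longlonglongrightarrow> 0" by simp
  qed auto
  have dct: "(\<lambda>n. \<integral>x. m n x * h x \<partial>lborel) \<longlonglongrightarrow> (\<integral>x. l * h x \<partial>lborel)"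
    if h: "integrable lborel h" and [measurable]: "\<And>n. m n \<in> borel_measurable borel"
      and m: "\<And>n x. \<bar>m n x\<bar> \<le> C" "\<And>x. (\<lambda>n. m n x) \<longlonglongrightarrow> l" for h :: "'a \<Rightarrow> real" and m :: "nat \<Rightarrow> 'a \<Rightarrow> real" and l C
  proof -
    have [measurable]: "h \<in> borel_measurable borel" using h by auto
    show ?thesis
    proof (rule integral_dominated_convergence[where w = "\<lambda>x. C * norm (h x)"])
      show "AE x in lborel. norm (m n x * h x) \<le> C * norm (h x)" for n
        using m(1) by (auto simp: abs_mult intro!: mult_right_mono)
      show "AE x in lborel. (\<lambda>n. m n x * h x) \<longlonglongrightarrow> l * h x" by (intro AE_I2 tendsto_intros m(2))
      show "integrable lborel (\<lambda>x. C * norm (h x))" using h by simp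
    qed measurable
  qed
  have c1: "\<bar>cutoff n x\<bar> \<le> 1" for n and x :: 'a using cutoff_nonneg[of n x] cutoff_le_1[of n x] by simp
  have L1: "(\<lambda>n. \<integral>x. cutoff n x * norm (g x) powr p \<partial>lborel) \<longlonglongrightarrow> (\<integral>x. 1 * norm (g x) powr p \<partial>lborel)"
    by (rule dct[OF ie _ c1 cutoff_tendsto_1]) measurable
  have L2: "(\<lambda>n. \<integral>x. (grad (cutoff n) x \<bullet> x) * norm (g x) powr p \<partial>lborel) \<longlonglongrightarrow> (\<integral>x. 0 * norm (g x) powr p \<partial>lborel)"
    by (rule dct[OF ie _ gB g0]) measurable
  have L3: "(\<lambda>n. \<integral>x. (N * cutoff n x + grad (cutoff n) x \<bullet> x) * F (u x) \<partial>lborel) \<longlonglongrightarrow> (\<integral>x. (N * 1 + 0) * F (u x) \<partial>lborel)"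
  proof (rule dct[OF iF])
    show "\<bar>N * cutoff n x + grad (cutoff n) x \<bullet> x\<bar> \<le> N + B" for n and x :: 'a
    proof -
      have "\<bar>N * cutoff n x\<bar> \<le> N" using c1[of n x] N_pos by (simp add: abs_mult)
      then show ?thesis using gB[of n x] by linarith
    qed
    show "(\<lambda>n. N * cutoff n x + grad (cutoff n) x \<bullet> x) \<longlonglongrightarrow> N * 1 + 0" for x :: 'a
      by (intro tendsto_intros cutoff_tendsto_1 g0)
  qed measurable
  have iP: "integrable lborel (\<lambda>x. pot x * (g x \<bullet> x))"
  proof (rule Bochner_Integration.integrable_bound[OF iV])
    show "AE x in lborel. norm (pot x * (g x \<bullet> x)) \<le> norm (V x * norm x * \<bar>u x\<bar> powr (p - 1) * norm (g x))"
    proof (rule AE_I2)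
      fix x
      have "\<bar>u x\<bar> powr (p - 2) * \<bar>u x\<bar> = \<bar>u x\<bar> powr (p - 1)"
        using powr_add[of "\<bar>u x\<bar>" "p - 2" 1] by (cases "u x = 0") auto
      then have "\<bar>pot x\<bar> = V x * \<bar>u x\<bar> powr (p - 1)"
        using V_nonneg[of x] by (simp add: pot_def abs_mult mult.assoc)
      then have "norm (pot x * (g x \<bullet> x)) \<le> (V x * \<bar>u x\<bar> powr (p - 1)) * (norm (g x) * norm x)"
        using V_nonneg[of x] by (simp add: abs_mult mult_left_mono Cauchy_Schwarz_ineq2)
      then show "norm (pot x * (g x \<bullet> x)) \<le> norm (V x * norm x * \<bar>u x\<bar> powr (p - 1) * norm (g x))"
        using V_nonneg[of x] by (simp add: mult_ac)
    qed
  qed measurable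
  have L4: "(\<lambda>n. \<integral>x. cutoff n x * (pot x * (g x \<bullet> x)) \<partial>lborel) \<longlonglongrightarrow> (\<integral>x. 1 * (pot x * (g x \<bullet> x)) \<partial>lborel)"
    by (rule dct[OF iP _ c1 cutoff_tendsto_1]) measurable
  have L5: "(\<lambda>n. \<integral>x. (flux x \<bullet> grad (cutoff n) x) * (g x \<bullet> x) \<partial>lborel) \<longlonglongrightarrow> (\<integral>x. 0 \<partial>(lborel :: 'a measure))"
  proof (rule integral_dominated_convergence[where w = "\<lambda>x. B * norm (g x) powr p"])
    have b: "norm ((flux x \<bullet> grad (cutoff n) x) * (g x \<bullet> x)) \<le> norm x * norm (grad (cutoff n) x) * norm (g x) powr p" for n x
    proof -
      have "norm ((flux x \<bullet> grad (cutoff n) x) * (g x \<bullet> x)) \<le> (norm (flux x) * norm (grad (cutoff n) x)) * (norm (g x) * norm x)"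
        unfolding norm_mult by (intro mult_mono) (auto simp: Cauchy_Schwarz_ineq2)
      moreover have "norm (flux x) * norm (g x) = norm (g x) powr p"
        using powr_add[of "norm (g x)" "p - 1" 1] by (cases "g x = 0") (auto simp: norm_flux)
      moreover have "(norm (flux x) * norm (grad (cutoff n) x)) * (norm (g x) * norm x)
          = norm x * norm (grad (cutoff n) x) * (norm (flux x) * norm (g x))" by (simp add: mult_ac)
      ultimately show ?thesis by simp
    qed
    show "AE x in lborel. norm ((flux x \<bullet> grad (cutoff n) x) * (g x \<bullet> x)) \<le> B * norm (g x) powr p" for n
      by (intro AE_I2 order_trans[OF b] mult_right_mono B(3)) auto
    show "AE x in lborel. (\<lambda>n. (flux x \<bullet> grad (cutoff n) x) * (g x \<bullet> x)) \<longlonglongrightarrow> 0"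
    proof (rule AE_I2)
      fix x
      show "(\<lambda>n. (flux x \<bullet> grad (cutoff n) x) * (g x \<bullet> x)) \<longlonglongrightarrow> 0"
      proof (rule tendsto_norm_zero_cancel, rule tendsto_sandwich[OF _ _ tendsto_const])
        show "eventually (\<lambda>n. norm ((flux x \<bullet> grad (cutoff n) x) * (g x \<bullet> x)) \<le> (norm x * norm (g x) powr p * B) * (1 / real (Suc n))) sequentially"
        proof (intro always_eventually allI)
          fix n
          have "norm x * norm (grad (cutoff n) x) * norm (g x) powr p \<le> norm x * (B / real (Suc n)) * norm (g x) powr p"
            by (intro mult_right_mono mult_left_mono B(2)) auto
          then show "norm ((flux x \<bullet> grad (cutoff n) x) * (g x \<bullet> x)) \<le> (norm x * norm (g x) powr p * B) * (1 / real (Suc n))"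
            using b[of x n] by (simp add: mult_ac)
        qed
        have "(\<lambda>n. (norm x * norm (g x) powr p * B) * (1 / real (Suc n))) \<longlonglongrightarrow> (norm x * norm (g x) powr p * B) * 0"
          using LIMSEQ_inverse_real_of_nat by (intro tendsto_intros) (simp add: inverse_eq_divide)
        then show "(\<lambda>n. (norm x * norm (g x) powr p * B) * (1 / real (Suc n))) \<longlonglongrightarrow> 0" by simp
      qed auto
    qed
    show "integrable lborel (\<lambda>x. B * norm (g x) powr p)" using ie by simp
  qed measurable
  define A :: "nat \<Rightarrow> real" where "A n = ((p - N) * (\<integral>x. cutoff n x * norm (g x) powr p \<partial>lborel) - (\<integral>x. (grad (cutoff n) x \<bullet> x) * norm (g x) powr p \<partial>lborel)) / p" for n
  have "A \<longlonglongrightarrow> ((p - N) * (\<integral>x. 1 * norm (g x) powr p \<partial>lborel) - (\<integral>x. 0 * norm (g x) powr p \<partial>lborel)) / p"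
    unfolding A_def by (intro tendsto_intros L1 L2) (use p1 in auto)
  moreover have "A = (\<lambda>n. - (\<integral>x. (N * cutoff n x + grad (cutoff n) x \<bullet> x) * F (u x) \<partial>lborel) - (\<integral>x. (flux x \<bullet> grad (cutoff n) x) * (g x \<bullet> x) \<partial>lborel)
      - (\<integral>x. cutoff n x * (pot x * (g x \<bullet> x)) \<partial>lborel))"
    using local_pohozaev[OF cutoff_test cutoff_nonneg] by (simp add: A_def fun_eq_iff mult_ac)
  moreover have "\<dots> \<longlonglongrightarrow> - (\<integral>x. (N * 1 + 0) * F (u x) \<partial>lborel) - (\<integral>x. 0 \<partial>(lborel :: 'a measure)) - (\<integral>x. 1 * (pot x * (g x \<bullet> x)) \<partial>lborel)"
    by (intro tendsto_intros L3 L4 L5)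
  ultimately have "((p - N) * (\<integral>x. norm (g x) powr p \<partial>lborel)) / p = - N * (\<integral>x. F (u x) \<partial>lborel) - (\<integral>x. pot x * (g x \<bullet> x) \<partial>lborel)"
    using LIMSEQ_unique by fastforce
  moreover have "(\<integral>x. pot x * (g x \<bullet> x) \<partial>lborel) = (\<integral>x. V x * \<bar>u x\<bar> powr (p - 2) * u x * (x \<bullet> g x) \<partial>lborel)"
    by (simp add: pot_def inner_commute)
  ultimately show ?thesis using p1 by (simp add: field_simps)
qed

end

section \<open>Lebesgue measurable data\<close>

text \<open>Preimages differ only within a null set, and Lebesgue measure is complete. This spares
  measurability proofs for integrands built from the given representatives: each is compared with a
  Borel counterpart.\<close>

lemma lebesgue_measurable_cong_AE:
  fixes F :: "'a::euclidean_space \<Rightarrow> 'b::topological_space"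
  assumes F': "F' \<in> borel_measurable borel" and ae: "AE x in lborel. F x = F' x"
  shows "F \<in> borel_measurable lebesgue"
proof (rule measurableI)
  fix A :: "'b set" assume A: "A \<in> sets borel"
  obtain Z where Z: "{x. F x \<noteq> F' x} \<subseteq> Z" "Z \<in> null_sets lborel"
    using ae by (auto simp: eventually_ae_filter)
  have Zl: "Z \<in> null_sets lebesgue" using Z(2) by (rule null_sets_completionI)
  have "F' -` A \<in> sets lebesgue" using measurable_sets[OF F' A] by simp
  moreover have "F -` A \<inter> Z \<in> sets lebesgue" by (rule completion.complete[OF _ Zl]) auto
  ultimately have "(F' -` A - Z) \<union> (F -` A \<inter> Z) \<in> sets lebesgue" using Zl by auto
  also have "(F' -` A - Z) \<union> (F -` A \<inter> Z) = F -` A" using Z(1) by auto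
  finally show "F -` A \<inter> space lebesgue \<in> sets lebesgue" by simp
qed simp

lemma lebesgue_integral_cong_AE:
  fixes F :: "'a::euclidean_space \<Rightarrow> 'b::{banach, second_countable_topology}"
  assumes F': "F' \<in> borel_measurable borel" and ae: "AE x in lborel. F x = F' x"
  shows "integrable lebesgue F \<longleftrightarrow> integrable lborel F'" "integral\<^sup>L lebesgue F = integral\<^sup>L lborel F'"
proof -
  have m: "F \<in> borel_measurable lebesgue" by (rule lebesgue_measurable_cong_AE[OF F' ae])
  have m': "F' \<in> borel_measurable lebesgue" using F' by (simp add: measurable_completion)
  have ae': "AE x in lebesgue. F x = F' x" using ae by (rule AE_completion)
  show "integrable lebesgue F \<longleftrightarrow> integrable lborel F'"
    using integrable_cong_AE[OF m m' ae'] integrable_completion[of F' lborel] F' by simp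
  show "integral\<^sup>L lebesgue F = integral\<^sup>L lborel F'"
    using integral_cong_AE[OF m m' ae'] integral_completion[of F' lborel] F' by simp
qed

text \<open>The real case applied to each coordinate; finitely many exceptional null sets are again
  a null set.\<close>

lemma borel_representative:
  fixes F :: "'a::euclidean_space \<Rightarrow> 'b::euclidean_space"
  assumes F: "F \<in> borel_measurable lebesgue"
  obtains F' where "F' \<in> borel_measurable borel" "AE x in lborel. F x = F' x"
proof -
  have "\<exists>h\<in>borel_measurable lborel. AE x in lborel. F x \<bullet> b = h x" for b
    by (intro completion_ex_borel_measurable_real borel_measurable_inner F borel_measurable_const)
  then have "\<forall>b. \<exists>h. h \<in> borel_measurable borel \<and> (AE x in lborel. F x \<bullet> b = h x)" by auto
  from choice[OF this] obtain h where h: "\<And>b. h b \<in> borel_measurable borel" "\<And>b. AE x in lborel. F x \<bullet> b = h b x"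
    by auto
  show ?thesis
  proof (rule that[of "\<lambda>x. \<Sum>b\<in>Basis. h b x *\<^sub>R b"])
    show "(\<lambda>x. \<Sum>b\<in>Basis. h b x *\<^sub>R b) \<in> borel_measurable borel"
      using h(1) by measurable
    have "AE x in lborel. \<forall>b\<in>Basis. F x \<bullet> b = h b x"
      by (intro AE_finite_allI h(2)) auto
    then show "AE x in lborel. F x = (\<Sum>b\<in>Basis. h b x *\<^sub>R b)"
    proof eventually_elim
      case (elim x)
      then have "(\<Sum>b\<in>Basis. h b x *\<^sub>R b) = (\<Sum>b\<in>Basis. (F x \<bullet> b) *\<^sub>R b)" by (intro sum.cong) auto
      then show ?case by (simp add: euclidean_representation)
    qed
  qed
qed

lemma Lp_loc_1_loc_int:
  fixes h :: "'a::euclidean_space \<Rightarrow> 'b::euclidean_space"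
  assumes h: "h \<in> Lp_loc 1" and h' [measurable]: "h' \<in> borel_measurable borel" and ae: "AE x in lborel. h x = h' x"
  shows "loc_int h'"
  unfolding loc_int_def
proof (intro conjI allI h')
  fix R
  have "set_integrable lebesgue (cball 0 R) (\<lambda>x. norm (h x) powr 1)" using h by (auto simp: Lp_loc_def)
  then have "integrable lebesgue (\<lambda>x. indicator (cball 0 R) x *\<^sub>R (norm (h x) powr 1))" by (simp add: set_integrable_def)
  also have "?this \<longleftrightarrow> integrable lborel (\<lambda>x. indicator (cball 0 R) x *\<^sub>R (norm (h' x) powr 1))"
    by (rule lebesgue_integral_cong_AE(1)) (use ae in \<open>measurable, auto elim: eventually_mono\<close>)
  finally show "integrable lborel (\<lambda>x. indicator (cball 0 R) x *\<^sub>R h' x)"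
    by (rule Bochner_Integration.integrable_bound) auto
qed

lemma test_function_measurable: "v \<in> test_functions \<Longrightarrow> v \<in> borel_measurable borel"
  "v \<in> test_functions \<Longrightarrow> grad v \<in> borel_measurable borel"
  "v \<in> test_functions \<Longrightarrow> b \<in> Basis \<Longrightarrow> partial_deriv b v \<in> borel_measurable borel"
  by (intro smooth_measurable smooth_grad_measurable test_functions_smooth smooth_partial; assumption)+

lemma has_weak_gradient_representative:
  fixes u :: "'a::euclidean_space \<Rightarrow> real"
  assumes ug: "has_weak_gradient u g" and [measurable]: "u' \<in> borel_measurable borel" "g' \<in> borel_measurable borel"
    and ae: "AE x in lborel. u x = u' x" "AE x in lborel. g x = g' x"
  shows "weak_gradient u' g'"
  unfolding weak_gradient_def
proof (intro conjI ballI)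
  show "loc_int u'" "loc_int g'"
    using ug ae by (auto simp: has_weak_gradient_def intro: Lp_loc_1_loc_int)
  fix v :: "'a \<Rightarrow> real" and b :: 'a assume v: "v \<in> test_functions" and b: "b \<in> Basis"
  note [measurable] = test_function_measurable(1,2)[OF v] test_function_measurable(3)[OF v b]
  have "(\<integral>x. u x * partial_deriv b v x \<partial>lebesgue) = (\<integral>x. u' x * partial_deriv b v x \<partial>lborel)"
    by (rule lebesgue_integral_cong_AE(2)) (use ae in \<open>measurable, auto elim: eventually_mono\<close>)
  moreover have "(\<integral>x. (g x \<bullet> b) * v x \<partial>lebesgue) = (\<integral>x. (g' x \<bullet> b) * v x \<partial>lborel)"
    by (rule lebesgue_integral_cong_AE(2)) (use ae in \<open>measurable, auto elim: eventually_mono\<close>)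
  ultimately show "(\<integral>x. u' x * partial_deriv b v x \<partial>lborel) = - (\<integral>x. (g' x \<bullet> b) * v x \<partial>lborel)"
    using ug v b by (simp add: has_weak_gradient_def)
qed

text \<open>Both gradients have the same convolution with every test function, namely
  \<open>grad (conv \<eta> u)\<close>, so all mollifications of their difference vanish. The result
  links the choice made by \<open>weak_grad\<close> with the weak gradient in \<open>Lp p\<close>
  that \<open>W1p\<close> provides.\<close>

lemma weak_gradient_unique:
  fixes u :: "'a::euclidean_space \<Rightarrow> real"
  assumes g: "weak_gradient u g" and h: "weak_gradient u h"
  shows "AE x in lborel. g x = h x"
proof -
  have lg: "loc_int g" and lh: "loc_int h" using g h by (auto simp: weak_gradient_def)
  note [measurable] = loc_int_measurable[OF lg] loc_int_measurable[OF lh]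
  define k where "k x = g x - h x" for x
  have lk: "loc_int k"
    using lg lh by (auto simp: loc_int_def k_def[abs_def] scaleR_diff_right)
  have [measurable]: "k \<in> borel_measurable borel" using lk by (rule loc_int_measurable)
  have zero: "conv \<eta> k x = 0" if \<eta>: "\<eta> \<in> test_functions" for \<eta> x
  proof -
    obtain R where R: "\<And>x. norm x > R \<Longrightarrow> \<eta> x = 0" using test_functions_obtain[OF \<eta>] by metis
    have c: "continuous_on UNIV \<eta>" by (rule smooth_continuous[OF test_functions_smooth[OF \<eta>]])
    have "conv \<eta> k x = conv \<eta> g x - conv \<eta> h x"
      using conv_integrable[OF lg c R] conv_integrable[OF lh c R]
      by (simp add: conv_def k_def scaleR_diff_right)
    then show ?thesis using weak_gradient_conv[OF g \<eta>, of x] weak_gradient_conv[OF h \<eta>, of x] by simp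
  qed
  have "AE x in lborel. x \<in> ball 0 (real R) \<longrightarrow> k x = 0" for R :: nat
  proof -
    \<comment> \<open>Mollification converges in \<open>L^1\<close> for globally integrable
      functions, hence the cut-off. The margin 1 is at least the radius of every mollifier used, so
      on the ball of radius \<open>R\<close> the convolutions of \<open>k'\<close> and
      \<open>k\<close> agree.\<close>
    define k' where "k' x = indicator (cball 0 (real R + 1)) x *\<^sub>R k x" for x
    have ik': "integrable lborel k'" using lk by (auto simp: loc_int_def k'_def[abs_def])
    have [measurable]: "k' \<in> borel_measurable borel" using ik' by auto
    have [measurable]: "ball (0::'a) (real R) \<in> sets borel" by simp
    have fk': "pow_int 1 k' < \<infinity>" using ik' by (subst pow_int_finite_iff) auto
    have lk': "loc_int k'" by (rule loc_intI[of _ 1]) (use fk' in auto)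
    have "\<forall>n. \<exists>\<eta>::'a \<Rightarrow> real. is_mollifier (1 / real (Suc n)) \<eta>" by (intro allI mollifier_exists) simp
    then obtain \<eta> :: "nat \<Rightarrow> 'a \<Rightarrow> real" where \<eta>: "\<And>n. is_mollifier (1 / real (Suc n)) (\<eta> n)" by metis
    have t: "\<eta> n \<in> test_functions" for n using \<eta> by (auto simp: is_mollifier_def)
    have loc: "conv (\<eta> n) k' x = 0" if x: "x \<in> ball 0 (real R)" for n x
    proof -
      have "conv (\<eta> n) k' x = conv (\<eta> n) k x"
        unfolding conv_def
      proof (intro Bochner_Integration.integral_cong refl)
        fix y
        show "\<eta> n (x - y) *\<^sub>R k' y = \<eta> n (x - y) *\<^sub>R k y"
        proof (cases "norm (x - y) \<ge> 1 / real (Suc n)")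
          case False
          then have "norm (x - y) < 1 / real (Suc n)" by simp
          also have "\<dots> \<le> 1" by simp
          finally have "norm y \<le> real R + 1" using x norm_triangle_ineq2[of y x] by (simp add: norm_minus_commute)
          then show ?thesis by (simp add: k'_def)
        qed (use \<eta>[of n] in \<open>simp add: is_mollifier_def\<close>)
      qed
      then show ?thesis using zero[OF t] by simp
    qed
    have "(\<lambda>n. pow_int 1 (\<lambda>x. conv (\<eta> n) k' x - k' x)) \<longlonglongrightarrow> 0"
      by (rule pow_int_conv_mollifier[OF _ _ fk' \<eta>]) auto
    moreover have "(\<integral>\<^sup>+x. indicator (ball 0 (real R)) x * ennreal (norm (k' x)) \<partial>lborel) \<le> pow_int 1 (\<lambda>x. conv (\<eta> n) k' x - k' x)" for n
      unfolding pow_int_def by (intro nn_integral_mono) (auto simp: indicator_def loc)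
    ultimately have "(\<integral>\<^sup>+x. indicator (ball 0 (real R)) x * ennreal (norm (k' x)) \<partial>lborel) \<le> 0"
      by (intro LIMSEQ_le_const) auto
    then have "(\<integral>\<^sup>+x. indicator (ball 0 (real R)) x * ennreal (norm (k' x)) \<partial>lborel) = 0" by simp
    then have "AE x in lborel. indicator (ball 0 (real R)) x * ennreal (norm (k' x)) = 0"
      by (subst (asm) nn_integral_0_iff_AE) auto
    then show ?thesis by eventually_elim (auto simp: k'_def indicator_def split: if_splits)
  qed
  then have "AE x in lborel. \<forall>R::nat. x \<in> ball 0 (real R) \<longrightarrow> k x = 0"
    by (subst AE_all_countable) blast
  then show ?thesis
  proof eventually_elim
    case (elim x)
    obtain R :: nat where "norm x < real R" using reals_Archimedean2 by blast
    then show ?case using elim by (auto simp: k_def)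
  qed
qed

lemma Lp_pow_int:
  fixes h :: "'a::euclidean_space \<Rightarrow> 'b::euclidean_space"
  assumes h: "h \<in> Lp r" and [measurable]: "h' \<in> borel_measurable borel" and ae: "AE x in lborel. h x = h' x"
  shows "pow_int r h' < \<infinity>"
proof -
  have "integrable lebesgue (\<lambda>x. norm (h x) powr r)" using h by (simp add: Lp_def)
  also have "?this \<longleftrightarrow> integrable lborel (\<lambda>x. norm (h' x) powr r)"
    by (rule lebesgue_integral_cong_AE(1)) (use ae in \<open>measurable, auto elim: eventually_mono\<close>)
  finally show ?thesis by (subst pow_int_finite_iff) auto
qed

text \<open>\<open>weak_grad u\<close> is a choice among weak gradients; by uniqueness it agrees
  almost everywhere with one in \<open>Lp p\<close>, whence its integrability. The representatives
  are left free because two different ones of \<open>u\<close> will be inserted.\<close>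

lemma weak_solution_representative:
  fixes u V :: "'a::euclidean_space \<Rightarrow> real"
  assumes p: "2 \<le> p" and u: "u \<in> W1p p" and sol: "local_weak_solution p V f u" and f: "continuous_on UNIV f"
    and [measurable]: "u' \<in> borel_measurable borel" "g' \<in> borel_measurable borel" "V' \<in> borel_measurable borel"
    and ae: "AE x in lborel. u x = u' x" "AE x in lborel. weak_grad u x = g' x" "AE x in lborel. V x = V' x"
    and V': "\<And>x. 0 \<le> V' x"
  shows "weak_solution u' V' g' f p (real DIM('a))"
proof
  have [measurable]: "f \<in> borel_measurable borel" using f by (rule borel_measurable_continuous_onI)
  obtain g0 where g0: "has_weak_gradient u g0" "g0 \<in> Lp p" using u by (auto simp: W1p_def)
  have hwg: "has_weak_gradient u (weak_grad u)" unfolding weak_grad_def by (rule someI[of _ g0]) (rule g0(1))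
  show wg: "weak_gradient u' g'"
    by (rule has_weak_gradient_representative[OF hwg _ _ ae(1,2)]) measurable
  show "pow_int p u' < \<infinity>" using Lp_pow_int[OF _ _ ae(1)] u by (auto simp: W1p_def)
  have "g0 \<in> borel_measurable lebesgue" using g0(2) by (simp add: Lp_def)
  from borel_representative[OF this] obtain g1 where
    [measurable]: "g1 \<in> borel_measurable borel" and g1: "AE x in lborel. g0 x = g1 x" by metis
  have "weak_gradient u' g1"
    by (rule has_weak_gradient_representative[OF g0(1) _ _ ae(1) g1]) measurable
  from weak_gradient_unique[OF wg this] have "AE x in lborel. norm (g' x) powr p = norm (g1 x) powr p"
    by eventually_elim simp
  then have "pow_int p g' = pow_int p g1" unfolding pow_int_def by (intro nn_integral_cong_AE) auto
  then show "pow_int p g' < \<infinity>" using Lp_pow_int[OF g0(2) _ g1] by simp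
  fix v :: "'a \<Rightarrow> real" assume v: "v \<in> test_functions"
  note [measurable] = test_function_measurable(1,2)[OF v]
  have aeall: "AE x in lborel. u x = u' x \<and> weak_grad u x = g' x \<and> V x = V' x"
    using ae by auto
  have m1: "(\<lambda>x. V' x * \<bar>u' x\<bar> powr (p - 2) * u' x * v x) \<in> borel_measurable borel"
    and m2: "(\<lambda>x. f (u' x) * v x) \<in> borel_measurable borel"
    and m3: "(\<lambda>x. (norm (g' x) powr (p - 2) *\<^sub>R g' x) \<bullet> grad v x) \<in> borel_measurable borel"
    by measurable
  have a1: "AE x in lborel. V x * \<bar>u x\<bar> powr (p - 2) * u x * v x = V' x * \<bar>u' x\<bar> powr (p - 2) * u' x * v x"
    and a2: "AE x in lborel. f (u x) * v x = f (u' x) * v x"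
    and a3: "AE x in lborel. (norm (weak_grad u x) powr (p - 2) *\<^sub>R weak_grad u x) \<bullet> grad v x
      = (norm (g' x) powr (p - 2) *\<^sub>R g' x) \<bullet> grad v x"
    using aeall by (auto elim: eventually_mono)
  note 1 = lebesgue_integral_cong_AE[OF m1 a1] and 2 = lebesgue_integral_cong_AE[OF m2 a2]
    and 3 = lebesgue_integral_cong_AE(2)[OF m3 a3]
  have sv: "integrable lebesgue (\<lambda>x. V x * \<bar>u x\<bar> powr (p - 2) * u x * v x)" "integrable lebesgue (\<lambda>x. f (u x) * v x)"
    "(\<integral>x. (norm (weak_grad u x) powr (p - 2) *\<^sub>R weak_grad u x) \<bullet> grad v x \<partial>lebesgue)
          + (\<integral>x. V x * \<bar>u x\<bar> powr (p - 2) * u x * v x \<partial>lebesgue) = (\<integral>x. f (u x) * v x \<partial>lebesgue)"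
    using sol v by (auto simp: local_weak_solution_def)
  show "integrable lborel (\<lambda>x. V' x * \<bar>u' x\<bar> powr (p - 2) * u' x * v x)" using sv(1) 1(1) by simp
  show "integrable lborel (\<lambda>x. f (u' x) * v x)" using sv(2) 2(1) by simp
  show "(\<integral>x. (norm (g' x) powr (p - 2) *\<^sub>R g' x) \<bullet> grad v x \<partial>lborel) + (\<integral>x. V' x * \<bar>u' x\<bar> powr (p - 2) * u' x * v x \<partial>lborel)
     = (\<integral>x. f (u' x) * v x \<partial>lborel)" using sv(3) unfolding 1(2) 2(2) 3 .
qed (use p f V' in auto)

text \<open>Oddness of \<open>f\<close> makes \<open>- u\<close> a solution of the same equation,
  which turns the upper bound for solutions into a lower one.\<close>

lemma weak_solution_uminus:
  assumes "weak_solution u V g f p N" and odd: "\<And>t. f (- t) = - f t"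
  shows "weak_solution (\<lambda>x. - u x) V (\<lambda>x. - g x) f p N"
proof -
  interpret weak_solution u V g f p N by fact
  have lu: "loc_int u" and lg: "loc_int g" using wg by (auto simp: weak_gradient_def)
  show ?thesis
  proof
    have "loc_int (\<lambda>x. - u x)" "loc_int (\<lambda>x. - g x)"
      using lu lg by (auto simp: loc_int_def)
    then show "weak_gradient (\<lambda>x. - u x) (\<lambda>x. - g x)"
      using wg by (auto simp: weak_gradient_def)
    show "pow_int p (\<lambda>x. - u x) < \<infinity>" "pow_int p (\<lambda>x. - g x) < \<infinity>"
      using fin_u fin_g by (auto simp: pow_int_uminus)
    fix v :: "'a \<Rightarrow> real" assume v: "v \<in> test_functions"
    show "integrable lborel (\<lambda>x. V x * \<bar>- u x\<bar> powr (p - 2) * - u x * v x)" using int_V[OF v] by simp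
    show "integrable lborel (\<lambda>x. f (- u x) * v x)" using int_f[OF v] by (simp add: odd)
    show "(\<integral>x. (norm (- g x) powr (p - 2) *\<^sub>R - g x) \<bullet> grad v x \<partial>lborel) + (\<integral>x. V x * \<bar>- u x\<bar> powr (p - 2) * - u x * v x \<partial>lborel)
     = (\<integral>x. f (- u x) * v x \<partial>lborel)" using equation[OF v] by (simp add: odd)
  qed (use p2 N_eq V_nonneg f_cont in auto)
qed

lemma primitive_has_derivative:
  assumes f: "continuous_on UNIV f"
  shows "(primitive f has_real_derivative f t) (at t)"
proof -
  \<comment> \<open>The interval from \<open>a\<close> to \<open>b\<close> contains the base point 0
    and has \<open>t\<close> in its interior.\<close>
  define a where "a = - \<bar>t\<bar> - 1"
  define b where "b = \<bar>t\<bar> + 1"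
  have t: "a < t" "t < b" "a \<le> 0" "0 \<le> b" by (auto simp: a_def b_def)
  have "((\<lambda>u. LBINT y=ereal 0..ereal u. f y) has_vector_derivative f t) (at t within {a..b})"
    by (rule interval_integral_FTC2) (use t continuous_on_subset[OF f] in auto)
  then have "(primitive f has_vector_derivative f t) (at t within {a..b})"
    by (simp add: primitive_def[abs_def])
  moreover have "at t within {a..b} = at t" using t by (intro at_within_interior) auto
  ultimately show ?thesis by (simp add: has_real_derivative_iff_has_vector_derivative)
qed

text \<open>Mean value inequality on \<open>[- |t|, |t|]\<close>, where the bound for
  \<open>f\<close> is largest at the endpoints because both exponents are nonnegative.\<close>

lemma primitive_bound:
  assumes f: "continuous_on UNIV f" and b: "\<And>t. \<bar>f t\<bar> \<le> c * (\<bar>t\<bar> powr (s - 1) + \<bar>t\<bar> powr (q - 1))"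
    and c: "0 < c" and s: "1 \<le> s" and q: "1 \<le> q"
  shows "\<bar>primitive f t\<bar> \<le> c * (\<bar>t\<bar> powr s + \<bar>t\<bar> powr q)"
proof (cases "t = 0")
  case False
  define C where "C = c * (\<bar>t\<bar> powr (s - 1) + \<bar>t\<bar> powr (q - 1))"
  have "norm (primitive f t - primitive f 0) \<le> C * norm (t - 0)"
  proof (rule field_differentiable_bound[of "{- \<bar>t\<bar>..\<bar>t\<bar>}" "primitive f" f])
    fix y assume y: "y \<in> {- \<bar>t\<bar>..\<bar>t\<bar>}"
    show "(primitive f has_field_derivative f y) (at y within {- \<bar>t\<bar>..\<bar>t\<bar>})"
      by (rule has_field_derivative_at_within[OF primitive_has_derivative[OF f]])
    have "\<bar>y\<bar> \<le> \<bar>t\<bar>" using y by (auto simp: abs_le_iff)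
    then have "c * (\<bar>y\<bar> powr (s - 1) + \<bar>y\<bar> powr (q - 1)) \<le> C"
      unfolding C_def using c s q by (intro mult_left_mono add_mono powr_mono2) auto
    then show "norm (f y) \<le> C" using b[of y] by simp
  qed auto
  moreover have "primitive f 0 = 0" by (simp add: primitive_def flip: zero_ereal_def)
  moreover have "C * \<bar>t\<bar> = c * (\<bar>t\<bar> powr s + \<bar>t\<bar> powr q)"
    using False powr_add[of "\<bar>t\<bar>" "s - 1" 1] powr_add[of "\<bar>t\<bar>" "q - 1" 1] by (simp add: C_def algebra_simps)
  ultimately show ?thesis by simp
qed (simp add: primitive_def flip: zero_ereal_def)

theorem theorem1p3:
  fixes u V :: "real ^ 'n \<Rightarrow> real" and f :: "real \<Rightarrow> real" and p s q c N :: real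
  defines "N \<equiv> real CARD('n)"
  assumes "2 \<le> p" "p < N"
    and "1 < s" "s \<le> p"
    and "p < q" "q < N * p / (N - p)"
    and "V \<in> Lp_loc (max 2 (N / p))"
    and "AE x in lebesgue. 0 \<le> V x"
    and "continuous_on UNIV f"
    and "\<forall>t. f (- t) = - f t"
    and "0 < c"
    and "\<forall>t>0. - c * t powr (s - 1) \<le> f t \<and> f t \<le> c * t powr (q - 1)"
    and "u \<in> W1p p \<inter> Lp s"
    and "local_weak_solution p V f u"
    and "integrable lebesgue
           (\<lambda>x. V x * norm x * \<bar>u x\<bar> powr (p - 1) * norm (weak_grad u x))"
  shows "(N - p) / p * (\<integral>x. norm (weak_grad u x) powr p \<partial>lebesgue)
           - N * (\<integral>x. primitive f (u x) \<partial>lebesgue)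
           - (\<integral>x. V x * \<bar>u x\<bar> powr (p - 2) * u x * (x \<bullet> weak_grad u x) \<partial>lebesgue) = 0"
proof -
  note p2 = assms(2) and pN = assms(3) and s = assms(4) and pq = assms(6) and q = assms(7) and f = assms(10) and c = assms(12)
    and sol = assms(15) and hyp = assms(16)
  have up: "u \<in> W1p p" "u \<in> Lp p" and us: "u \<in> Lp s" using assms(14) by (auto simp: W1p_def)
  have odd: "f (- t) = - f t" for t using assms(11) by simp
  have growth: "f t \<le> c * t powr (q - 1)" if "0 < t" for t using assms(13) that by simp
  obtain g0 where g0: "has_weak_gradient u g0" using up(1) by (auto simp: W1p_def)
  have hwg: "has_weak_gradient u (weak_grad u)" unfolding weak_grad_def by (rule someI[of _ g0]) (rule g0)
  have m: "u \<in> borel_measurable lebesgue" "weak_grad u \<in> borel_measurable lebesgue" "V \<in> borel_measurable lebesgue"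
    using hwg assms(8) by (auto simp: has_weak_gradient_def Lp_loc_def)
  obtain u1 where [measurable]: "u1 \<in> borel_measurable borel" and ae1: "AE x in lborel. u x = u1 x"
    using borel_representative[OF m(1)] .
  obtain g where g [measurable]: "g \<in> borel_measurable borel" and aeg: "AE x in lborel. weak_grad u x = g x"
    using borel_representative[OF m(2)] .
  obtain V1 where [measurable]: "V1 \<in> borel_measurable borel" and "AE x in lborel. V x = V1 x"
    using borel_representative[OF m(3)] .
  \<comment> \<open>\<open>V\<close> is nonnegative almost everywhere; the positive part makes this
    hold at every point, as the locale demands.\<close>
  define W where "W x = max 0 (V1 x)" for x
  have [measurable]: "W \<in> borel_measurable borel" unfolding W_def[abs_def] by measurable
  have W0: "0 \<le> W x" for x by (simp add: W_def)
  have "AE x in lborel. 0 \<le> V x" using assms(9) by (simp add: AE_completion_iff)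
  with \<open>AE x in lborel. V x = V1 x\<close> have aeV: "AE x in lborel. V x = W x"
    by eventually_elim (simp add: W_def)
  have Neq: "N = real DIM(real ^ 'n)" by (simp add: N_def)
  note rep = weak_solution_representative[OF p2 up(1) sol f _ g _ _ aeg aeV W0, folded Neq]
  have sol1: "weak_solution u1 W g f p N" by (rule rep) (use ae1 in auto)
  obtain M1 where M1: "AE x in lborel. u1 x \<le> M1"
    using weak_solution.bounded_above[OF sol1 growth c pN pq q] by blast
  obtain M2 where M2: "AE x in lborel. - u1 x \<le> M2"
    using weak_solution.bounded_above[OF weak_solution_uminus[OF sol1 odd] growth c pN pq q] by blast
  define M where "M = max 0 (max M1 M2)"
  \<comment> \<open>Boundedness is first obtained for the Borel representative \<open>u1\<close>.
    Clamping \<open>u1\<close> to \<open>[- M, M]\<close> alters it on a null set and yields the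
    bound at every point that \<open>bounded_solution\<close> asks for.\<close>
  define w where "w x = max (- M) (min M (u1 x))" for x
  have M0: "0 \<le> M" by (simp add: M_def)
  have [measurable]: "w \<in> borel_measurable borel" unfolding w_def[abs_def] by measurable
  have wM: "\<bar>w x\<bar> \<le> M" for x using M0 by (auto simp: w_def)
  have aeu: "AE x in lborel. u x = w x"
    using ae1 M1 M2 by eventually_elim (auto simp: w_def M_def)
  have sol2: "weak_solution w W g f p N" by (rule rep) (use aeu in auto)
  have aeall: "AE x in lborel. u x = w x \<and> weak_grad u x = g x \<and> V x = W x"
    using aeu aeg aeV by auto
  have F: "(primitive f has_real_derivative f t) (at t)" for t by (rule primitive_has_derivative[OF f])
  have [measurable]: "primitive f \<in> borel_measurable borel"
    by (intro borel_measurable_continuous_onI continuous_at_imp_continuous_on ballI DERIV_isCont[OF F])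
  have W2: "integrable lborel (\<lambda>x. indicator (cball 0 R) x * (W x)\<^sup>2)" for R
  proof -
    let ?b = "max 2 (N / p)"
    have "set_integrable lebesgue (cball 0 R) (\<lambda>x. norm (V x) powr ?b)" using assms(8) by (auto simp: Lp_loc_def)
    then have "integrable lebesgue (\<lambda>x. indicator (cball 0 R) x *\<^sub>R (norm (V x) powr ?b))" by (simp add: set_integrable_def)
    also have "?this \<longleftrightarrow> integrable lborel (\<lambda>x. indicator (cball 0 R) x *\<^sub>R (norm (W x) powr ?b))"
      by (rule lebesgue_integral_cong_AE(1)) (use aeV in \<open>measurable, auto elim: eventually_mono\<close>)
    finally have i: "integrable lborel (\<lambda>x. indicator (cball 0 R) x *\<^sub>R (norm (W x) powr ?b))" .
    show ?thesis
    proof (rule Bochner_Integration.integrable_bound[OF Bochner_Integration.integrable_add[OF integrable_indicator_cball[of 0 R] i]])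
      show "AE x in lborel. norm (indicator (cball 0 R) x * (W x)\<^sup>2) \<le> norm (indicator (cball 0 R) x + indicator (cball 0 R) x *\<^sub>R (norm (W x) powr ?b))"
      proof (rule AE_I2)
        fix x
        \<comment> \<open>Large values use \<open>?b \<ge> 2\<close>, small ones the constant 1,
          which is integrable over the ball.\<close>
        have "(W x)\<^sup>2 \<le> 1 + W x powr ?b"
        proof (cases "W x \<le> 1")
          case True
          then show ?thesis using W0[of x] power_le_one[of "W x" 2] by (simp add: add_increasing2)
        next
          case False
          then have "W x powr 2 \<le> W x powr ?b" by (intro powr_mono) auto
          then show ?thesis using False by simp
        qed
        then show "norm (indicator (cball 0 R) x * (W x)\<^sup>2) \<le> norm (indicator (cball 0 R) x + indicator (cball 0 R) x *\<^sub>R (norm (W x) powr ?b))"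
          using W0[of x] by (auto simp: indicator_def)
      qed
    qed measurable
  qed
  have bsol: "bounded_solution w W g f p N M (primitive f)"
    by (intro bounded_solution.intro sol2 bounded_solution_axioms.intro wM W2 F)
  have iF: "integrable lborel (\<lambda>x. primitive f (w x))"
  proof -
    \<comment> \<open>For \<open>t > 0\<close> the hypothesis bounds \<open>f\<close> below by the
      power \<open>s - 1\<close> and above by the power \<open>q - 1\<close>; the sum of both bounds
      \<open>|f|\<close>, and oddness covers \<open>t \<le> 0\<close>.\<close>
    have fb: "\<bar>f t\<bar> \<le> c * (\<bar>t\<bar> powr (s - 1) + \<bar>t\<bar> powr (q - 1))" for t
    proof -
      have pos: "\<bar>f t\<bar> \<le> c * (t powr (s - 1) + t powr (q - 1))" if "0 < t" for t
      proof -
        have "- c * t powr (s - 1) \<le> f t" "f t \<le> c * t powr (q - 1)" using assms(13) that by auto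
        moreover have "0 \<le> c * t powr (s - 1)" "0 \<le> c * t powr (q - 1)" using c by auto
        ultimately show ?thesis by (simp add: algebra_simps abs_le_iff)
      qed
      consider "t > 0" | "t = 0" | "t < 0" by linarith
      then show ?thesis
      proof cases
        case 2
        then show ?thesis using odd[of 0] by simp
      next
        case 3
        then show ?thesis using pos[of "- t"] odd[of t] by simp
      qed (use pos in auto)
    qed
    have i_s: "integrable lborel (\<lambda>x. \<bar>w x\<bar> powr s)"
      using Lp_pow_int[OF us _ aeu] pow_int_finite_iff[of w s] by auto
    have ip: "integrable lborel (\<lambda>x. \<bar>w x\<bar> powr p)"
      using Lp_pow_int[OF up(2) _ aeu] pow_int_finite_iff[of w p] by auto
    show ?thesis
    proof (rule Bochner_Integration.integrable_bound)
      show "integrable lborel (\<lambda>x. c * (\<bar>w x\<bar> powr s + M powr (q - p) * \<bar>w x\<bar> powr p))"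
        by (intro integrable_mult_right Bochner_Integration.integrable_add i_s ip)
      show "AE x in lborel. norm (primitive f (w x)) \<le> norm (c * (\<bar>w x\<bar> powr s + M powr (q - p) * \<bar>w x\<bar> powr p))"
      proof (rule AE_I2)
        fix x
        have "\<bar>primitive f (w x)\<bar> \<le> c * (\<bar>w x\<bar> powr s + \<bar>w x\<bar> powr q)"
          by (rule primitive_bound[OF f fb c]) (use s p2 pq in auto)
        \<comment> \<open>Boundedness lowers the exponent \<open>q\<close> to \<open>p\<close>, so
          that the assumptions \<open>u\<close> in \<open>L^s\<close> and \<open>u\<close> in
          \<open>L^p\<close> give the integrability.\<close>
        also have "\<bar>w x\<bar> powr q = \<bar>w x\<bar> powr (q - p) * \<bar>w x\<bar> powr p" by (simp flip: powr_add)
        also have "c * (\<bar>w x\<bar> powr s + \<bar>w x\<bar> powr (q - p) * \<bar>w x\<bar> powr p) \<le> c * (\<bar>w x\<bar> powr s + M powr (q - p) * \<bar>w x\<bar> powr p)"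
          using wM[of x] pq c by (intro mult_left_mono add_left_mono mult_right_mono powr_mono2) auto
        finally show "norm (primitive f (w x)) \<le> norm (c * (\<bar>w x\<bar> powr s + M powr (q - p) * \<bar>w x\<bar> powr p))" by simp
      qed
    qed measurable
  qed
  have iV: "integrable lborel (\<lambda>x. W x * norm x * \<bar>w x\<bar> powr (p - 1) * norm (g x))"
  proof -
    have m: "(\<lambda>x. W x * norm x * \<bar>w x\<bar> powr (p - 1) * norm (g x)) \<in> borel_measurable borel" by measurable
    have a: "AE x in lborel. V x * norm x * \<bar>u x\<bar> powr (p - 1) * norm (weak_grad u x)
        = W x * norm x * \<bar>w x\<bar> powr (p - 1) * norm (g x)"
      using aeall by eventually_elim simp
    show ?thesis using lebesgue_integral_cong_AE(1)[OF m a] hyp by simp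
  qed
  have m1: "(\<lambda>x. norm (g x) powr p) \<in> borel_measurable borel"
    and m2: "(\<lambda>x. primitive f (w x)) \<in> borel_measurable borel"
    and m3: "(\<lambda>x. W x * \<bar>w x\<bar> powr (p - 2) * w x * (x \<bullet> g x)) \<in> borel_measurable borel"
    by measurable
  have a1: "AE x in lborel. norm (weak_grad u x) powr p = norm (g x) powr p"
    and a2: "AE x in lborel. primitive f (u x) = primitive f (w x)"
    and a3: "AE x in lborel. V x * \<bar>u x\<bar> powr (p - 2) * u x * (x \<bullet> weak_grad u x)
      = W x * \<bar>w x\<bar> powr (p - 2) * w x * (x \<bullet> g x)"
    using aeall by (auto elim: eventually_mono)
  show ?thesis
    unfolding lebesgue_integral_cong_AE(2)[OF m1 a1] lebesgue_integral_cong_AE(2)[OF m2 a2]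
      lebesgue_integral_cong_AE(2)[OF m3 a3]
    by (rule bounded_solution.global_pohozaev[OF bsol iF iV])
qed

end
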